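(* Let $n\ge 3$, let $\Sigma$ be a closed Riemann surface of genus $\ge2$, and for $t\in\mathbb{C}$ let $(E,\phi^t)$ be the cyclic $SL(n,\mathbb{C})$-Higgs bundle over $\Sigma$ parameterized by $(\gamma_1,\dots,\gamma_{n-1},t\gamma_n)$, where $\gamma_n\neq 0$. Suppose the cyclic Higgs bundle parameterized by $(\gamma_1,\dots,\gamma_{n-1},0)$ is stable. Then, outside the branch points, the pullback metric $g^t$ of the branched minimal immersion corresponding to $(E,\phi^t)$ strictly increases as $|t|$ increases, i.e. if $0\le|t'|<|t|$ then $g^{t'}<g^{t}$ at every point of $\Sigma$ that is not a common zero of $\gamma_1,\dots,\gamma_n$. Moreover the Morse function $f(E,\phi^t)$ also strictly increases as $|t|$ increases ($t\in\mathbb{C}$).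
   Context: Let $K_\Sigma$ be the canonical bundle of $\Sigma$. A cyclic $SL(n,\mathbb{C})$-Higgs bundle parameterized by $(\gamma_1,\dots,\gamma_n)$ is a pair $(E,\phi)$ with $E=L_1\oplus\cdots\oplus L_n$ a direct sum of holomorphic line bundles, $\det E=\mathcal{O}$, and $\phi$ the holomorphic section of $\mathrm{End}(E)\otimes K_\Sigma$ whose only nonzero components are $\gamma_k:L_k\to L_{k+1}\otimes K_\Sigma$, $k=1,\dots,n$ (indices mod $n$). Here $\gamma_k$ is a holomorphic section of $L_k^{-1}L_{k+1}K_\Sigma$ and $\gamma_k\not\equiv 0$ for $1\le k\le n-1$. A Higgs bundle $(E,\phi)$ is stable if $\deg F/\mathrm{rank}\,F<\deg E/\mathrm{rank}\,E$ for every proper nonzero $\phi$-invariant holomorphic subbundle $F$. The harmonic metric $h$ of $(E,\phi)$ is the Hermitian metric on $E$ inducing the trivial metric on $\det E=\mathcal{O}$ and solving the Hitchin equation $F^{\nabla^h}+[\phi,\phi^{*_h}]=0$, where $\nabla^h$ is the Chern connection and $\phi^{*_h}$ the $h$-adjoint. For a cyclic Higgs bundle with $\gamma_n\ne0$, or stable with $\gamma_n=0$, it exists and is diagonal, $h=\mathrm{diag}(h_1,\dots,h_n)$; in a local holomorphic frame the equation reads $\partial_z\partial_{\bar z}\log h_k+|\gamma_k|^2h_k^{-1}h_{k+1}-|\gamma_{k-1}|^2h_{k-1}^{-1}h_k=0$, $k=1,\dots,n$ (indices mod $n$). The harmonic metric gives an equivariant harmonic map $\widetilde\Sigma\to SL(n,\mathbb{C})/SU(n)$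 (target metric induced by the Killing form $2n\,\mathrm{tr}(XY)$), which for $n\ge3$ is a branched minimal immersion. Its pullback metric is $g=2n\,\mathrm{tr}(\phi\phi^{*_h})\,dz\otimes d\bar z$, and its branch points are the zeros of $\phi$. The Morse function is $f(E,\phi)=\int_\Sigma \mathrm{tr}(\phi\phi^{*_h})\sqrt{-1}\,dz\wedge d\bar z$. For $(E,\phi^t)$ all quantities are computed with $\phi^t$ and its own harmonic metric. *)

theory Defs
  imports
    "HOL-Complex_Analysis.Complex_Analysis"
    "HOL-Homology.Homology"
    "HOL-Algebra.Free_Abelian_Groups"
    "Jordan_Normal_Form.Schur_Decomposition"
begin

section \<open>Closed Riemann surfaces\<close>

text \<open>
  The underlying space of a surface is all of the type \<open>'a\<close>; \<open>'i\<close> is the index type of an atlas.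
  All bundles below are given by transition functions with respect to the chart domains of that
  atlas. After refining the atlas this covers every finite family of holomorphic vector bundles.
\<close>

record ('i, 'a) surface =
  chart_dom :: "'i \<Rightarrow> 'a set"
  coord :: "'i \<Rightarrow> 'a \<Rightarrow> complex"

definition param :: "('i, 'a) surface \<Rightarrow> 'i \<Rightarrow> complex \<Rightarrow> 'a" where
  "param S \<alpha> = inv_into (chart_dom S \<alpha>) (coord S \<alpha>)"

definition holo_on :: "('i, 'a) surface \<Rightarrow> 'i \<Rightarrow> 'a set \<Rightarrow> ('a \<Rightarrow> complex) \<Rightarrow> bool" where
  "holo_on S \<alpha> W f \<longleftrightarrow> (f \<circ> param S \<alpha>) holomorphic_on coord S \<alpha> ` W"

definition closed_riemann_surface :: "('i, 'a::t2_space) surface \<Rightarrow> bool" where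
  "closed_riemann_surface S \<longleftrightarrow>
     compact (UNIV :: 'a set) \<and> connected (UNIV :: 'a set) \<and>
     (\<Union>\<alpha>. chart_dom S \<alpha>) = UNIV \<and>
     (\<forall>\<alpha>. open (chart_dom S \<alpha>) \<and> open (coord S \<alpha> ` chart_dom S \<alpha>) \<and>
          homeomorphism (chart_dom S \<alpha>) (coord S \<alpha> ` chart_dom S \<alpha>) (coord S \<alpha>) (param S \<alpha>)) \<and>
     (\<forall>\<alpha> \<beta>. holo_on S \<alpha> (chart_dom S \<alpha> \<inter> chart_dom S \<beta>) (coord S \<beta>))"

text \<open>A closed orientable surface has genus \<open>g\<close> iff its first integral homology is free of rank
  \<open>2g\<close>.\<close>

definition has_genus :: "('i, 'a::topological_space) surface \<Rightarrow> nat \<Rightarrow> bool" where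
  "has_genus S g \<longleftrightarrow>
     homology_group 1 (euclidean :: 'a topology) \<cong> free_Abelian_group ({..<2 * g} :: nat set)"


section \<open>Calculus in charts\<close>

primrec Ck_on :: "nat \<Rightarrow> complex set \<Rightarrow> (complex \<Rightarrow> complex) \<Rightarrow> bool" where
  "Ck_on 0 V f \<longleftrightarrow> continuous_on V f"
| "Ck_on (Suc k) V f \<longleftrightarrow>
     f differentiable_on V \<and> (\<forall>v. Ck_on k V (\<lambda>\<zeta>. frechet_derivative f (at \<zeta>) v))"

definition smooth_in_chart :: "('i, 'a) surface \<Rightarrow> 'i \<Rightarrow> ('a \<Rightarrow> complex) \<Rightarrow> bool" where
  "smooth_in_chart S \<alpha> f \<longleftrightarrow> (\<forall>k. Ck_on k (coord S \<alpha> ` chart_dom S \<alpha>) (f \<circ> param S \<alpha>))"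

definition d_z :: "('i, 'a) surface \<Rightarrow> 'i \<Rightarrow> ('a \<Rightarrow> complex) \<Rightarrow> 'a \<Rightarrow> complex" where
  "d_z S \<alpha> f p =
     (let D = frechet_derivative (f \<circ> param S \<alpha>) (at (coord S \<alpha> p)) in (D 1 - \<i> * D \<i>) / 2)"

definition d_zbar :: "('i, 'a) surface \<Rightarrow> 'i \<Rightarrow> ('a \<Rightarrow> complex) \<Rightarrow> 'a \<Rightarrow> complex" where
  "d_zbar S \<alpha> f p =
     (let D = frechet_derivative (f \<circ> param S \<alpha>) (at (coord S \<alpha> p)) in (D 1 + \<i> * D \<i>) / 2)"

definition entrywise :: "(('a \<Rightarrow> complex) \<Rightarrow> 'a \<Rightarrow> complex) \<Rightarrow> nat \<Rightarrow>
    ('a \<Rightarrow> complex mat) \<Rightarrow> 'a \<Rightarrow> complex mat" where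
  "entrywise D n M p = Matrix.mat n n (\<lambda>(i, j). D (\<lambda>q. M q $$ (i, j)) p)"

text \<open>A real 2-form is a family \<open>w\<close>, standing for \<open>w \<alpha> dx \<and> dy\<close> in chart \<open>\<alpha>\<close> with
  \<open>z = x + \<i>y\<close>. For continuous forms the integral does not depend on the partition of unity
  (change of variables), which is why an arbitrary one is chosen.\<close>

definition partition_of_unity ::
    "('i, 'a::topological_space) surface \<Rightarrow> 'i set \<Rightarrow> ('i \<Rightarrow> 'a \<Rightarrow> real) \<Rightarrow> bool" where
  "partition_of_unity S A \<rho> \<longleftrightarrow>
     finite A \<and>
     (\<forall>\<alpha>\<in>A. continuous_on UNIV (\<rho> \<alpha>) \<and> (\<forall>p. 0 \<le> \<rho> \<alpha> p) \<and>
            closure {p. \<rho> \<alpha> p \<noteq> 0} \<subseteq> chart_dom S \<alpha>) \<and>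
     (\<forall>p. (\<Sum>\<alpha>\<in>A. \<rho> \<alpha> p) = 1)"

definition surface_integral ::
    "('i, 'a::topological_space) surface \<Rightarrow> ('i \<Rightarrow> 'a \<Rightarrow> real) \<Rightarrow> real" where
  "surface_integral S w =
     (let (A, \<rho>) = (SOME (A, \<rho>). partition_of_unity S A \<rho>) in
      \<Sum>\<alpha>\<in>A. integral (coord S \<alpha> ` chart_dom S \<alpha>)
                  (\<lambda>\<zeta>. \<rho> \<alpha> (param S \<alpha> \<zeta>) * w \<alpha> (param S \<alpha> \<zeta>)))"


section \<open>Holomorphic line bundles and their degree\<close>

text \<open>\<open>L \<alpha> \<beta>\<close> is the transition function from chart \<open>\<beta>\<close> to chart \<open>\<alpha>\<close>: local representatives of a
  section satisfy \<open>s \<alpha> = L \<alpha> \<beta> * s \<beta>\<close> on the overlap.\<close>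

type_synonym ('i, 'a) cocycle = "'i \<Rightarrow> 'i \<Rightarrow> 'a \<Rightarrow> complex"

definition line_bundle :: "('i, 'a) surface \<Rightarrow> ('i, 'a) cocycle \<Rightarrow> bool" where
  "line_bundle S L \<longleftrightarrow>
     (\<forall>\<alpha> \<beta>. holo_on S \<alpha> (chart_dom S \<alpha> \<inter> chart_dom S \<beta>) (L \<alpha> \<beta>) \<and>
            (\<forall>p \<in> chart_dom S \<alpha> \<inter> chart_dom S \<beta>. L \<alpha> \<beta> p \<noteq> 0)) \<and>
     (\<forall>\<alpha> \<beta> \<delta>. \<forall>p \<in> chart_dom S \<alpha> \<inter> chart_dom S \<beta> \<inter> chart_dom S \<delta>.
            L \<alpha> \<delta> p = L \<alpha> \<beta> p * L \<beta> \<delta> p)"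

definition holo_section ::
    "('i, 'a) surface \<Rightarrow> ('i, 'a) cocycle \<Rightarrow> ('i \<Rightarrow> 'a \<Rightarrow> complex) \<Rightarrow> bool" where
  "holo_section S L s \<longleftrightarrow>
     (\<forall>\<alpha>. holo_on S \<alpha> (chart_dom S \<alpha>) (s \<alpha>)) \<and>
     (\<forall>\<alpha> \<beta>. \<forall>p \<in> chart_dom S \<alpha> \<inter> chart_dom S \<beta>. s \<alpha> p = L \<alpha> \<beta> p * s \<beta> p)"

definition zero_section :: "('i, 'a) surface \<Rightarrow> ('i \<Rightarrow> 'a \<Rightarrow> complex) \<Rightarrow> bool" where
  "zero_section S s \<longleftrightarrow> (\<forall>\<alpha>. \<forall>p \<in> chart_dom S \<alpha>. s \<alpha> p = 0)"

definition tensor :: "('i, 'a) cocycle \<Rightarrow> ('i, 'a) cocycle \<Rightarrow> ('i, 'a) cocycle" where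
  "tensor L M = (\<lambda>\<alpha> \<beta> p. L \<alpha> \<beta> p * M \<alpha> \<beta> p)"

definition dual :: "('i, 'a) cocycle \<Rightarrow> ('i, 'a) cocycle" where
  "dual L = (\<lambda>\<alpha> \<beta> p. inverse (L \<alpha> \<beta> p))"

text \<open>Sections of the canonical bundle are represented by the coefficient of \<open>dz\<^sub>\<alpha>\<close>, so the
  transition function is \<open>dz\<^sub>\<beta>/dz\<^sub>\<alpha>\<close>.\<close>

definition canonical_bundle :: "('i, 'a) surface \<Rightarrow> ('i, 'a) cocycle" where
  "canonical_bundle S = (\<lambda>\<alpha> \<beta> p. deriv (coord S \<beta> \<circ> param S \<alpha>) (coord S \<alpha> p))"

text \<open>Since \<open>|s|\<^sup>2 = h \<alpha> * |s \<alpha>|\<^sup>2\<close>, a Hermitian metric transforms as below.\<close>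

definition line_metric ::
    "('i, 'a) surface \<Rightarrow> ('i, 'a) cocycle \<Rightarrow> ('i \<Rightarrow> 'a \<Rightarrow> real) \<Rightarrow> bool" where
  "line_metric S L h \<longleftrightarrow>
     (\<forall>\<alpha>. smooth_in_chart S \<alpha> (\<lambda>p. complex_of_real (h \<alpha> p)) \<and>
          (\<forall>p \<in> chart_dom S \<alpha>. 0 < h \<alpha> p)) \<and>
     (\<forall>\<alpha> \<beta>. \<forall>p \<in> chart_dom S \<alpha> \<inter> chart_dom S \<beta>. h \<beta> p = (cmod (L \<alpha> \<beta> p))\<^sup>2 * h \<alpha> p)"

text \<open>Chern--Weil: the degree is the integral of
  \<open>(\<i>/2\<pi>) F = -(\<i>/2\<pi>) (d_z d_zbar (ln h)) dz \<and> dzbar = -(1/\<pi>) (d_z d_zbar (ln h)) dx \<and> dy\<close>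
  for any Hermitian metric \<open>h\<close>; by Stokes it does not depend on \<open>h\<close>.\<close>

definition chern_density ::
    "('i, 'a) surface \<Rightarrow> ('i \<Rightarrow> 'a \<Rightarrow> real) \<Rightarrow> 'i \<Rightarrow> 'a \<Rightarrow> real" where
  "chern_density S h \<alpha> p =
     - Re (d_z S \<alpha> (d_zbar S \<alpha> (\<lambda>q. complex_of_real (ln (h \<alpha> q)))) p) / pi"

definition degree_bundle :: "('i, 'a::topological_space) surface \<Rightarrow> ('i, 'a) cocycle \<Rightarrow> real" where
  "degree_bundle S L = surface_integral S (chern_density S (SOME h. line_metric S L h))"


section \<open>Higgs bundles, stability and harmonic metrics\<close>

text \<open>A vector bundle of rank \<open>n\<close> is given by transition matrices \<open>G \<alpha> \<beta>\<close>, acting on column vectors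
  of components: \<open>v \<alpha> = G \<alpha> \<beta> *\<^sub>v v \<beta>\<close>. A Higgs field is given in chart \<open>\<alpha>\<close> by the matrix
  \<open>\<Phi> \<alpha>\<close>, the coefficient of \<open>dz\<^sub>\<alpha>\<close>.\<close>

type_synonym ('i, 'a) mat_cocycle = "'i \<Rightarrow> 'i \<Rightarrow> 'a \<Rightarrow> complex mat"
type_synonym ('i, 'a) mat_family = "'i \<Rightarrow> 'a \<Rightarrow> complex mat"

definition vector_bundle :: "('i, 'a) surface \<Rightarrow> nat \<Rightarrow> ('i, 'a) mat_cocycle \<Rightarrow> bool" where
  "vector_bundle S n G \<longleftrightarrow>
     (\<forall>\<alpha> \<beta>. (\<forall>i<n. \<forall>j<n.
               holo_on S \<alpha> (chart_dom S \<alpha> \<inter> chart_dom S \<beta>) (\<lambda>p. G \<alpha> \<beta> p $$ (i, j))) \<and>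
            (\<forall>p \<in> chart_dom S \<alpha> \<inter> chart_dom S \<beta>.
               G \<alpha> \<beta> p \<in> carrier_mat n n \<and> Determinant.det (G \<alpha> \<beta> p) \<noteq> 0)) \<and>
     (\<forall>\<alpha> \<beta> \<delta>. \<forall>p \<in> chart_dom S \<alpha> \<inter> chart_dom S \<beta> \<inter> chart_dom S \<delta>.
            G \<alpha> \<delta> p = G \<alpha> \<beta> p * G \<beta> \<delta> p)"

definition det_bundle :: "('i, 'a) mat_cocycle \<Rightarrow> ('i, 'a) cocycle" where
  "det_bundle G = (\<lambda>\<alpha> \<beta> p. Determinant.det (G \<alpha> \<beta> p))"

text \<open>A holomorphic subbundle \<open>F\<close> of rank \<open>r\<close>: the columns of \<open>B \<alpha> p\<close> form a holomorphic frame of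
  \<open>F\<close> over chart \<open>\<alpha>\<close>, and \<open>F\<close> has the transition matrices \<open>T\<close> in these frames.\<close>

definition subbundle :: "('i, 'a) surface \<Rightarrow> nat \<Rightarrow> ('i, 'a) mat_cocycle \<Rightarrow>
    nat \<Rightarrow> ('i, 'a) mat_cocycle \<Rightarrow> ('i, 'a) mat_family \<Rightarrow> bool" where
  "subbundle S n G r T B \<longleftrightarrow>
     vector_bundle S r T \<and>
     (\<forall>\<alpha>. (\<forall>i<n. \<forall>j<r. holo_on S \<alpha> (chart_dom S \<alpha>) (\<lambda>p. B \<alpha> p $$ (i, j))) \<and>
          (\<forall>p \<in> chart_dom S \<alpha>. B \<alpha> p \<in> carrier_mat n r \<and>
             (\<forall>x \<in> carrier_vec r. B \<alpha> p *\<^sub>v x = 0\<^sub>v n \<longrightarrow> x = 0\<^sub>v r))) \<and>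
     (\<forall>\<alpha> \<beta>. \<forall>p \<in> chart_dom S \<alpha> \<inter> chart_dom S \<beta>. G \<alpha> \<beta> p * B \<beta> p = B \<alpha> p * T \<alpha> \<beta> p)"

definition higgs_invariant ::
    "('i, 'a) surface \<Rightarrow> ('i, 'a) mat_family \<Rightarrow> nat \<Rightarrow> ('i, 'a) mat_family \<Rightarrow> bool" where
  "higgs_invariant S \<Phi> r B \<longleftrightarrow>
     (\<forall>\<alpha>. \<forall>p \<in> chart_dom S \<alpha>. \<exists>M \<in> carrier_mat r r. \<Phi> \<alpha> p * B \<alpha> p = B \<alpha> p * M)"

definition stable_higgs :: "('i, 'a::topological_space) surface \<Rightarrow> nat \<Rightarrow>
    ('i, 'a) mat_cocycle \<Rightarrow> ('i, 'a) mat_family \<Rightarrow> bool" where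
  "stable_higgs S n G \<Phi> \<longleftrightarrow>
     (\<forall>r T B. 0 < r \<and> r < n \<and> subbundle S n G r T B \<and> higgs_invariant S \<Phi> r B \<longrightarrow>
        degree_bundle S (det_bundle T) / real r < degree_bundle S (det_bundle G) / real n)"

text \<open>\<open>H \<alpha>\<close> is the Gram matrix of the metric: \<open>h(u, v) = v\<^sup>* H u\<close>.\<close>

definition hermitian_metric :: "('i, 'a) surface \<Rightarrow> nat \<Rightarrow> ('i, 'a) mat_cocycle \<Rightarrow>
    ('i, 'a) mat_family \<Rightarrow> bool" where
  "hermitian_metric S n G H \<longleftrightarrow>
     (\<forall>\<alpha>. (\<forall>i<n. \<forall>j<n. smooth_in_chart S \<alpha> (\<lambda>p. H \<alpha> p $$ (i, j))) \<and>
          (\<forall>p \<in> chart_dom S \<alpha>. H \<alpha> p \<in> carrier_mat n n \<and> mat_adjoint (H \<alpha> p) = H \<alpha> p \<and>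
             (\<forall>v \<in> carrier_vec n. v \<noteq> 0\<^sub>v n \<longrightarrow> 0 < Re ((H \<alpha> p *\<^sub>v v) \<bullet>c v)))) \<and>
     (\<forall>\<alpha> \<beta>. \<forall>p \<in> chart_dom S \<alpha> \<inter> chart_dom S \<beta>.
          H \<beta> p = mat_adjoint (G \<alpha> \<beta> p) * H \<alpha> p * G \<alpha> \<beta> p)"

definition mat_inv :: "complex mat \<Rightarrow> complex mat" where
  "mat_inv A = the (mat_inverse A)"

text \<open>The \<open>h\<close>-adjoint of \<open>\<phi> = \<Phi> dz\<close> is \<open>(H\<^sup>-\<^sup>1 \<Phi>\<^sup>* H) dzbar\<close>; this is its coefficient.\<close>

definition h_adjoint :: "complex mat \<Rightarrow> complex mat \<Rightarrow> complex mat" where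
  "h_adjoint H \<Phi> = mat_inv H * mat_adjoint \<Phi> * H"

text \<open>The Chern connection is \<open>d + H\<^sup>-\<^sup>1 (d_z H) dz\<close>, with curvature
  \<open>- d_zbar (H\<^sup>-\<^sup>1 (d_z H)) dz \<and> dzbar\<close>. Likewise
  \<open>[\<phi>, \<phi>\<^sup>*] = (\<Phi> \<Phi>\<^sup>* - \<Phi>\<^sup>* \<Phi>) dz \<and> dzbar\<close>. Both definitions below give the coefficient of
  \<open>dz \<and> dzbar\<close>.\<close>

definition chern_curvature ::
    "('i, 'a) surface \<Rightarrow> nat \<Rightarrow> ('i, 'a) mat_family \<Rightarrow> 'i \<Rightarrow> 'a \<Rightarrow> complex mat" where
  "chern_curvature S n H \<alpha> p =
     - entrywise (d_zbar S \<alpha>) n (\<lambda>q. mat_inv (H \<alpha> q) * entrywise (d_z S \<alpha>) n (H \<alpha>) q) p"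

definition higgs_bracket :: "complex mat \<Rightarrow> complex mat \<Rightarrow> complex mat" where
  "higgs_bracket H \<Phi> = \<Phi> * h_adjoint H \<Phi> - h_adjoint H \<Phi> * \<Phi>"

text \<open>The isomorphism \<open>det E \<cong> O\<close> is given by a nowhere vanishing holomorphic section \<open>\<tau>\<close> of
  \<open>det E\<close>. That a metric induces the trivial metric on \<open>det E\<close> means that \<open>\<tau>\<close> has norm one.\<close>

definition det_trivialization ::
    "('i, 'a) surface \<Rightarrow> ('i, 'a) mat_cocycle \<Rightarrow> ('i \<Rightarrow> 'a \<Rightarrow> complex) \<Rightarrow> bool" where
  "det_trivialization S G \<tau> \<longleftrightarrow>
     holo_section S (det_bundle G) \<tau> \<and> (\<forall>\<alpha>. \<forall>p \<in> chart_dom S \<alpha>. \<tau> \<alpha> p \<noteq> 0)"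

definition harmonic_metric :: "('i, 'a) surface \<Rightarrow> nat \<Rightarrow> ('i, 'a) mat_cocycle \<Rightarrow>
    ('i \<Rightarrow> 'a \<Rightarrow> complex) \<Rightarrow> ('i, 'a) mat_family \<Rightarrow> ('i, 'a) mat_family \<Rightarrow> bool" where
  "harmonic_metric S n G \<tau> \<Phi> H \<longleftrightarrow>
     hermitian_metric S n G H \<and>
     (\<forall>\<alpha>. \<forall>p \<in> chart_dom S \<alpha>.
        Determinant.det (H \<alpha> p) * complex_of_real ((cmod (\<tau> \<alpha> p))\<^sup>2) = 1) \<and>
     (\<forall>\<alpha>. \<forall>p \<in> chart_dom S \<alpha>.
        chern_curvature S n H \<alpha> p + higgs_bracket (H \<alpha> p) (\<Phi> \<alpha> p) = 0\<^sub>m n n)"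

definition higgs_energy ::
    "('i, 'a) mat_family \<Rightarrow> ('i, 'a) mat_family \<Rightarrow> 'i \<Rightarrow> 'a \<Rightarrow> real" where
  "higgs_energy H \<Phi> \<alpha> p = Re (sum_list (diag_mat (\<Phi> \<alpha> p * h_adjoint (H \<alpha> p) (\<Phi> \<alpha> p))))"

text \<open>The coefficient of \<open>dz\<^sub>\<alpha> \<otimes> dzbar\<^sub>\<alpha>\<close> in the pullback metric of the equivariant harmonic map; the
  factor \<open>2n\<close> comes from the Killing form.\<close>

definition pullback_metric ::
    "nat \<Rightarrow> ('i, 'a) mat_family \<Rightarrow> ('i, 'a) mat_family \<Rightarrow> 'i \<Rightarrow> 'a \<Rightarrow> real" where
  "pullback_metric n H \<Phi> \<alpha> p = 2 * real n * higgs_energy H \<Phi> \<alpha> p"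

text \<open>Note \<open>\<i> dz \<and> dzbar = 2 dx \<and> dy\<close>.\<close>

definition morse_function :: "('i, 'a::topological_space) surface \<Rightarrow>
    ('i, 'a) mat_family \<Rightarrow> ('i, 'a) mat_family \<Rightarrow> real" where
  "morse_function S H \<Phi> = surface_integral S (\<lambda>\<alpha> p. 2 * higgs_energy H \<Phi> \<alpha> p)"


section \<open>Cyclic Higgs bundles\<close>

text \<open>Indices are shifted by one: \<open>L k\<close> and \<open>\<gamma> k\<close> for \<open>k < n\<close> stand for the line bundle and the
  Higgs field component with index \<open>k + 1\<close>. In particular the last component, mapping the last
  summand to the first, is \<open>\<gamma> (n - 1)\<close>.\<close>

definition direct_sum :: "nat \<Rightarrow> (nat \<Rightarrow> ('i, 'a) cocycle) \<Rightarrow> ('i, 'a) mat_cocycle" where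
  "direct_sum n L = (\<lambda>\<alpha> \<beta> p. Matrix.mat n n (\<lambda>(i, j). if i = j then L i \<alpha> \<beta> p else 0))"

definition cyclic_field :: "nat \<Rightarrow> (nat \<Rightarrow> 'i \<Rightarrow> 'a \<Rightarrow> complex) \<Rightarrow> ('i, 'a) mat_family" where
  "cyclic_field n \<gamma> =
     (\<lambda>\<alpha> p. Matrix.mat n n (\<lambda>(i, j). if i = Suc j mod n then \<gamma> j \<alpha> p else 0))"

definition cyclic_higgs_bundle :: "('i, 'a) surface \<Rightarrow> nat \<Rightarrow> (nat \<Rightarrow> ('i, 'a) cocycle) \<Rightarrow>
    ('i \<Rightarrow> 'a \<Rightarrow> complex) \<Rightarrow> (nat \<Rightarrow> 'i \<Rightarrow> 'a \<Rightarrow> complex) \<Rightarrow> bool" where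
  "cyclic_higgs_bundle S n L \<tau> \<gamma> \<longleftrightarrow>
     (\<forall>k<n. line_bundle S (L k)) \<and>
     det_trivialization S (direct_sum n L) \<tau> \<and>
     (\<forall>k<n. holo_section S
        (tensor (dual (L k)) (tensor (L (Suc k mod n)) (canonical_bundle S))) (\<gamma> k)) \<and>
     (\<forall>k<n - 1. \<not> zero_section S (\<gamma> k))"

definition scale_last ::
    "nat \<Rightarrow> complex \<Rightarrow> (nat \<Rightarrow> 'i \<Rightarrow> 'a \<Rightarrow> complex) \<Rightarrow> nat \<Rightarrow> 'i \<Rightarrow> 'a \<Rightarrow> complex" where
  "scale_last n t \<gamma> = \<gamma>(n - 1 := (\<lambda>\<alpha> p. t * \<gamma> (n - 1) \<alpha> p))"

end

theory Submission
  imports Defs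
begin

text \<open>Write \<open>h\<^sub>k\<close> for the \<open>k\<close>-th diagonal entry of the Gram matrix of a harmonic metric and
  \<open>a\<^sub>k = |\<gamma>\<^sub>k|\<^sup>2 h\<^sub>k\<^sub>+\<^sub>1 / h\<^sub>k\<close>, with indices modulo \<open>n\<close>, and let \<open>\<Delta>\<close>
  be \<open>\<partial>\<^sup>2 / \<partial>z \<partial>zbar\<close> in a chart. The proof has two independent parts.

  \<^bold>\<open>From the Hitchin equation to the Toda system.\<close> Whether or not the metric is diagonal, taking the
  diagonal entries of the Hitchin equation and applying Cauchy--Schwarz for the inverse Gram matrix
  twice, once to the Chern curvature and once to the bracket, gives
  \<open>\<Delta> ln h\<^sub>k \<ge> a\<^sub>k\<^sub>-\<^sub>1 - a\<^sub>k\<close> (\<open>hitchin_diagonal_laplacian\<close>,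
  \<open>toda_term_le_quadratic_form\<close>). The right-hand sides sum
  to zero, so the function \<open>\<Sum> ln h\<^sub>k - ln det H\<close>, which is globally defined because \<open>det E\<close> is
  trivial, is subharmonic on a closed surface, hence constant. All the inequalities are therefore
  equalities (\<open>toda_system\<close>). This gives the Toda equations for the \<open>h\<^sub>k\<close>, and the equality
  case of Cauchy--Schwarz shows that the energy density \<open>tr (\<phi> \<phi>\<^sup>*)\<close> is exactly \<open>\<Sum> a\<^sub>k\<close>.
  Thus the energy of any harmonic metric is governed by a scalar system.

  \<^bold>\<open>Comparison of two solutions.\<close> For parameters with \<open>|t'| < |t|\<close> put \<open>v\<^sub>k = ln (a\<^sub>k / a\<^sub>k')\<close>, where
  the prime refers to \<open>t'\<close>. These extend over the zeros of the \<open>\<gamma>\<^sub>k\<close> to global functions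
  with the constant positive sum \<open>ln (|t|\<^sup>2 / |t'|\<^sup>2)\<close>, and with \<open>f\<^sub>k = a\<^sub>k - a\<^sub>k'\<close>, which has the sign of \<open>v\<^sub>k\<close>, the Toda equations
  give \<open>\<Delta> v\<^sub>k = 2 f\<^sub>k - f\<^sub>k\<^sub>-\<^sub>1 - f\<^sub>k\<^sub>+\<^sub>1\<close>. This system is cooperative and its columns
  sum to zero, so the sum of the negative parts of the \<open>v\<^sub>k\<close> is subharmonic in the viscosity sense
  and thus constant. If it were not zero, then at a point where no \<open>\<gamma>\<^sub>k\<close> vanishes all \<open>v\<^sub>k\<close> would
  be negative, against the sign of their sum. Once \<open>v\<^sub>k \<ge> 0\<close>, each \<open>v\<^sub>k\<close> is a supersolution of a
  linear equation, so it vanishes identically or nowhere; if one vanishes then so do its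
  neighbours, again contradicting the sum. Hence all \<open>v\<^sub>k\<close> are positive everywhere
  (\<open>toda_comparison\<close>), so each \<open>a\<^sub>k\<close> grows strictly off the zeros of \<open>\<gamma>\<^sub>k\<close>
  (\<open>toda_term_strict_mono\<close>). For \<open>t' = 0\<close>, where \<open>v\<^sub>n\<close> would be infinite, the constant
  \<open>ln (|t|\<^sup>2 / |t'|\<^sup>2)\<close> is replaced by one so large that \<open>v\<^sub>n\<close> is positive from the start.

  Both parts rest on one strong maximum principle on closed Riemann surfaces
  (\<open>strong_maximum_principle\<close>).\<close>

section \<open>The Laplacian of a real function on the plane\<close>

lemma second_derivative_nonpos_at_local_max:
  fixes \<phi> \<phi>' :: "real \<Rightarrow> real"
  assumes "d > 0"
    and der: "\<And>s. \<bar>s\<bar> < d \<Longrightarrow> (\<phi> has_real_derivative \<phi>' s) (at s)"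
    and der2: "(\<phi>' has_real_derivative D) (at 0)"
    and max: "\<And>s. \<bar>s\<bar> < d \<Longrightarrow> \<phi> s \<le> \<phi> 0"
  shows "D \<le> 0"
proof (rule ccontr)
  assume "\<not> D \<le> 0"
  hence "D > 0" by simp
  have z: "\<phi>' 0 = 0"
  proof (rule DERIV_local_max[of \<phi> _ 0 d])
    show "(\<phi> has_real_derivative \<phi>' 0) (at 0)" using der[of 0] \<open>d > 0\<close> by simp
    show "0 < d" by fact
    show "\<forall>y. \<bar>0 - y\<bar> < d \<longrightarrow> \<phi> y \<le> \<phi> 0" using max by auto
  qed
  obtain e where e: "e > 0" "\<And>h. 0 < h \<Longrightarrow> h < e \<Longrightarrow> \<phi>' 0 < \<phi>' (0 + h)"
    using DERIV_pos_inc_right[OF der2 \<open>D > 0\<close>] by blast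
  define h where "h = min d e / 2"
  have h: "0 < h" "h < d" "h < e" using \<open>d > 0\<close> \<open>e > 0\<close> by (auto simp: h_def)
  have "\<exists>z. 0 < z \<and> z < h \<and> \<phi> h - \<phi> 0 = (h - 0) * \<phi>' z"
    by (rule MVT2) (use h der in auto)
  then obtain w where w: "0 < w" "w < h" "\<phi> h - \<phi> 0 = h * \<phi>' w" by auto
  have "\<phi>' w > 0" using e(2)[of w] w h z by simp
  hence "\<phi> h > \<phi> 0" using w(3) mult_pos_pos[OF h(1)] by fastforce
  with max[of h] h show False by simp
qed

text \<open>The Laplacian is normalised as \<open>\<Delta> = \<partial>\<^sup>2 / \<partial>z \<partial>zbar\<close>, a quarter of the usual one. The witness \<open>a\<close> is
  \<open>\<partial>\<^sub>z u\<close>: \<open>u\<close> is twice differentiable, which is the regularity that the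
  second-derivative test uses.\<close>

definition has_laplacian :: "complex set \<Rightarrow> (complex \<Rightarrow> real) \<Rightarrow> (complex \<Rightarrow> real) \<Rightarrow> bool" where
  "has_laplacian V u l \<longleftrightarrow>
     (\<exists>a. \<forall>z\<in>V. (u has_derivative (\<lambda>v. 2 * Re (a z * v))) (at z) \<and>
        (\<exists>c q. (a has_derivative (\<lambda>v. c * v + q * cnj v)) (at z) \<and> Re q = l z))"

lemma has_laplacianI:
  assumes "\<And>z. z \<in> V \<Longrightarrow> (u has_derivative (\<lambda>v. 2 * Re (a z * v))) (at z)"
    and "\<And>z. z \<in> V \<Longrightarrow> (a has_derivative (\<lambda>v. c z * v + q z * cnj v)) (at z)"
    and "\<And>z. z \<in> V \<Longrightarrow> Re (q z) = l z"
  shows "has_laplacian V u l"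
  unfolding has_laplacian_def using assms by blast

lemma has_laplacian_subset: "has_laplacian V u l \<Longrightarrow> W \<subseteq> V \<Longrightarrow> has_laplacian W u l"
  unfolding has_laplacian_def by blast

lemma has_laplacian_cong:
  assumes "has_laplacian V u l" "open V" "\<And>z. z \<in> V \<Longrightarrow> u z = u' z" "\<And>z. z \<in> V \<Longrightarrow> l z = l' z"
  shows "has_laplacian V u' l'"
proof -
  obtain a where a: "\<forall>z\<in>V. (u has_derivative (\<lambda>v. 2 * Re (a z * v))) (at z) \<and>
        (\<exists>c q. (a has_derivative (\<lambda>v. c * v + q * cnj v)) (at z) \<and> Re q = l z)"
    using assms(1) unfolding has_laplacian_def by blast
  have "(u' has_derivative (\<lambda>v. 2 * Re (a z * v))) (at z)" if "z \<in> V" for z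
    by (rule has_derivative_transform_within_open[OF _ assms(2) that])
      (use a that assms(3) in blast)+
  moreover have "\<exists>c q. (a has_derivative (\<lambda>v. c * v + q * cnj v)) (at z) \<and> Re q = l' z" if "z \<in> V" for z
    using a that unfolding assms(4)[OF that, symmetric] by blast
  ultimately show ?thesis unfolding has_laplacian_def by blast
qed

lemma has_laplacian_imp_continuous_on:
  assumes "has_laplacian V u l"
  shows "continuous_on V u"
proof -
  have "u differentiable (at z)" if "z \<in> V" for z
    using assms that unfolding has_laplacian_def differentiable_def by blast
  then show ?thesis
    by (meson continuous_at_imp_continuous_on differentiable_imp_continuous_within)
qed

lemma has_laplacian_const: "has_laplacian V (\<lambda>_. k) (\<lambda>_. 0)"
  by (rule has_laplacianI[where a = "\<lambda>_. 0" and c = "\<lambda>_. 0" and q = "\<lambda>_. 0"]) auto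

lemma has_laplacian_add:
  assumes "has_laplacian V u l" "has_laplacian V u' l'"
  shows "has_laplacian V (\<lambda>z. u z + u' z) (\<lambda>z. l z + l' z)"
proof -
  obtain a where a: "\<forall>z\<in>V. (u has_derivative (\<lambda>v. 2 * Re (a z * v))) (at z) \<and>
        (\<exists>c q. (a has_derivative (\<lambda>v. c * v + q * cnj v)) (at z) \<and> Re q = l z)"
    using assms(1) unfolding has_laplacian_def by blast
  obtain a' where a': "\<forall>z\<in>V. (u' has_derivative (\<lambda>v. 2 * Re (a' z * v))) (at z) \<and>
        (\<exists>c q. (a' has_derivative (\<lambda>v. c * v + q * cnj v)) (at z) \<and> Re q = l' z)"
    using assms(2) unfolding has_laplacian_def by blast
  show ?thesis unfolding has_laplacian_def
  proof (intro exI[of _ "\<lambda>z. a z + a' z"] ballI conjI)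
    fix z assume "z \<in> V"
    have "(u has_derivative (\<lambda>v. 2 * Re (a z * v))) (at z)" "(u' has_derivative (\<lambda>v. 2 * Re (a' z * v))) (at z)"
      using a a' \<open>z \<in> V\<close> by auto
    from has_derivative_add[OF this]
    show "((\<lambda>z. u z + u' z) has_derivative (\<lambda>v. 2 * Re ((a z + a' z) * v))) (at z)"
      by (simp add: algebra_simps)
    obtain c q c' q' where "(a has_derivative (\<lambda>v. c * v + q * cnj v)) (at z)" "Re q = l z"
      "(a' has_derivative (\<lambda>v. c' * v + q' * cnj v)) (at z)" "Re q' = l' z"
      using a a' \<open>z \<in> V\<close> by blast
    then show "\<exists>c q. ((\<lambda>z. a z + a' z) has_derivative (\<lambda>v. c * v + q * cnj v)) (at z) \<and> Re q = l z + l' z"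
      by (intro exI[of _ "c + c'"] exI[of _ "q + q'"])
         (auto intro!: derivative_eq_intros simp: algebra_simps)
  qed
qed

lemma has_laplacian_cmult:
  assumes "has_laplacian V u l"
  shows "has_laplacian V (\<lambda>z. k * u z) (\<lambda>z. k * l z)"
proof -
  obtain a where a: "\<forall>z\<in>V. (u has_derivative (\<lambda>v. 2 * Re (a z * v))) (at z) \<and>
        (\<exists>c q. (a has_derivative (\<lambda>v. c * v + q * cnj v)) (at z) \<and> Re q = l z)"
    using assms(1) unfolding has_laplacian_def by blast
  show ?thesis unfolding has_laplacian_def
  proof (intro exI[of _ "\<lambda>z. of_real k * a z"] ballI conjI)
    fix z assume "z \<in> V"
    have "(u has_derivative (\<lambda>v. 2 * Re (a z * v))) (at z)"
      using a \<open>z \<in> V\<close> by auto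
    from has_derivative_mult_right[OF this, of k]
    show "((\<lambda>z. k * u z) has_derivative (\<lambda>v. 2 * Re (of_real k * a z * v))) (at z)"
      by (simp add: algebra_simps)
    obtain c q where "(a has_derivative (\<lambda>v. c * v + q * cnj v)) (at z)" "Re q = l z"
      using a \<open>z \<in> V\<close> by blast
    then show "\<exists>c q. ((\<lambda>z. of_real k * a z) has_derivative (\<lambda>v. c * v + q * cnj v)) (at z) \<and> Re q = k * l z"
      by (intro exI[of _ "of_real k * c"] exI[of _ "of_real k * q"])
         (auto intro!: derivative_eq_intros simp: algebra_simps)
  qed
qed

lemma has_laplacian_minus: "has_laplacian V u l \<Longrightarrow> has_laplacian V (\<lambda>z. - u z) (\<lambda>z. - l z)"
  using has_laplacian_cmult[of V u l "-1"] by simp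

lemma has_laplacian_diff:
  "has_laplacian V u l \<Longrightarrow> has_laplacian V u' l' \<Longrightarrow> has_laplacian V (\<lambda>z. u z - u' z) (\<lambda>z. l z - l' z)"
  using has_laplacian_add[of V u l "\<lambda>z. - u' z" "\<lambda>z. - l' z"] has_laplacian_minus[of V u' l'] by simp

lemma has_laplacian_sum:
  assumes "\<And>k. k \<in> I \<Longrightarrow> has_laplacian V (u k) (l k)"
  shows "has_laplacian V (\<lambda>z. \<Sum>k\<in>I. u k z) (\<lambda>z. \<Sum>k\<in>I. l k z)"
  using assms
  by (induction I rule: infinite_finite_induct) (auto intro: has_laplacian_const has_laplacian_add)

text \<open>The second-derivative test along the directions \<open>1\<close> and \<open>\<i>\<close>: the second derivatives there are
  \<open>2 Re (c + q)\<close> and \<open>2 Re (q - c)\<close>, so their sum isolates \<open>q\<close>.\<close>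

lemma laplacian_nonpos_at_local_max:
  assumes lap: "has_laplacian V u l" and "open V" "z \<in> V"
    and max: "\<And>w. w \<in> V \<Longrightarrow> u w \<le> u z"
  shows "l z \<le> 0"
proof -
  obtain a where a: "\<And>w. w \<in> V \<Longrightarrow> (u has_derivative (\<lambda>v. 2 * Re (a w * v))) (at w)"
    and a2: "\<And>w. w \<in> V \<Longrightarrow> (\<exists>c q. (a has_derivative (\<lambda>v. c * v + q * cnj v)) (at w) \<and> Re q = l w)"
    using lap unfolding has_laplacian_def by blast
  obtain c q where cq: "(a has_derivative (\<lambda>v. c * v + q * cnj v)) (at z)" "Re q = l z"
    using a2 \<open>z \<in> V\<close> by blast
  obtain d where d: "d > 0" "ball z d \<subseteq> V" using \<open>open V\<close> \<open>z \<in> V\<close> openE by blast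
  have dir: "2 * Re ((c * e + q * cnj e) * e) \<le> 0" if "cmod e = 1" for e
  proof (rule second_derivative_nonpos_at_local_max[of d "\<lambda>s. u (z + of_real s * e)"
      "\<lambda>s. 2 * Re (a (z + of_real s * e) * e)"])
    show "d > 0" by fact
    have inV: "z + of_real s * e \<in> V" if "\<bar>s\<bar> < d" for s
      using that d(2) \<open>cmod e = 1\<close> by (auto simp: dist_norm norm_mult intro!: subsetD[OF d(2)])
    have line: "((\<lambda>s. z + of_real s * e) has_derivative (\<lambda>h. of_real h * e)) (at s)" for s
      by (auto intro!: derivative_eq_intros)
    show "((\<lambda>s. u (z + of_real s * e)) has_real_derivative 2 * Re (a (z + of_real s * e) * e)) (at s)"
      if "\<bar>s\<bar> < d" for s
      unfolding has_field_derivative_def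
      by (rule has_derivative_eq_rhs[OF has_derivative_compose[OF line[of s] a[OF inV[OF that]]]])
         (auto simp: fun_eq_iff algebra_simps)
    have "(a has_derivative (\<lambda>v. c * v + q * cnj v)) (at (z + of_real 0 * e))" using cq by simp
    from has_derivative_compose[OF line[of 0] this]
    have "((\<lambda>s. a (z + of_real s * e)) has_derivative (\<lambda>h. c * (of_real h * e) + q * cnj (of_real h * e))) (at 0)" .
    hence "((\<lambda>s. 2 * Re (a (z + of_real s * e) * e)) has_derivative
       (\<lambda>h. 2 * Re ((c * (of_real h * e) + q * cnj (of_real h * e)) * e))) (at 0)"
      by (auto intro!: derivative_eq_intros)
    then show "((\<lambda>s. 2 * Re (a (z + of_real s * e) * e)) has_real_derivative 2 * Re ((c * e + q * cnj e) * e)) (at 0)"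
      unfolding has_field_derivative_def 
      by (rule has_derivative_eq_rhs) (auto simp: fun_eq_iff algebra_simps)
    show "u (z + of_real s * e) \<le> u (z + of_real 0 * e)" if "\<bar>s\<bar> < d" for s
      using max[OF inV[OF that]] by simp
  qed
  from dir[of 1] dir[of \<i>] have "Re q \<le> 0" by (simp add: algebra_simps)
  with cq show ?thesis by simp
qed

text \<open>Here \<open>\<partial>\<^sub>z ln |f|\<^sup>2 = f'/f\<close> is holomorphic, so its derivative in \<open>zbar\<close> vanishes.\<close>

lemma has_laplacian_ln_cmod_square:
  assumes "f holomorphic_on V" "open V" "\<And>z. z \<in> V \<Longrightarrow> f z \<noteq> 0"
  shows "has_laplacian V (\<lambda>z. ln ((cmod (f z))\<^sup>2)) (\<lambda>_. 0)"
proof (rule has_laplacianI[where a = "\<lambda>z. deriv f z / f z" and c = "\<lambda>z. deriv (\<lambda>z. deriv f z / f z) z" and q = "\<lambda>_. 0"])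
  fix z assume z: "z \<in> V"
  have df: "(f has_derivative (\<lambda>v. deriv f z * v)) (at z)"
    using holomorphic_derivI[OF assms(1,2) z] by (simp add: has_field_derivative_def)
  have eq: "(\<lambda>z. ln ((cmod (f z))\<^sup>2)) = (\<lambda>z. ln (Re (f z) ^ 2 + Im (f z) ^ 2))"
    by (simp add: cmod_power2)
  have pos: "Re (f z) ^ 2 + Im (f z) ^ 2 > 0" using assms(3)[OF z]
    by (simp add: complex_neq_0)
  have "((\<lambda>z. ln (Re (f z) ^ 2 + Im (f z) ^ 2)) has_derivative
     (\<lambda>v. (2 * Re (f z) * Re (deriv f z * v) + 2 * Im (f z) * Im (deriv f z * v)) / (Re (f z) ^ 2 + Im (f z) ^ 2))) (at z)"
    using df pos by (auto intro!: derivative_eq_intros simp: fun_eq_iff field_simps)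
  moreover have "(2 * Re (f z) * Re (deriv f z * v) + 2 * Im (f z) * Im (deriv f z * v)) / (Re (f z) ^ 2 + Im (f z) ^ 2)
     = 2 * Re (deriv f z / f z * v)" for v
  proof -
    have "deriv f z / f z * v = deriv f z * v * cnj (f z) / (f z * cnj (f z))"
      using assms(3)[OF z] by simp
    also have "f z * cnj (f z) = of_real (Re (f z) ^ 2 + Im (f z) ^ 2)"
      by (simp add: complex_mult_cnj)
    finally show ?thesis by (simp add: Re_divide_of_real algebra_simps)
  qed
  ultimately show "((\<lambda>z. ln ((cmod (f z))\<^sup>2)) has_derivative (\<lambda>v. 2 * Re (deriv f z / f z * v))) (at z)"
    unfolding eq by simp
  have "(\<lambda>z. deriv f z / f z) holomorphic_on V"
    by (intro holomorphic_intros assms) 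
  from holomorphic_derivI[OF this assms(2) z]
  show "((\<lambda>z. deriv f z / f z) has_derivative (\<lambda>v. deriv (\<lambda>z. deriv f z / f z) z * v + 0 * cnj v)) (at z)"
    by (simp add: has_field_derivative_def)
qed auto

text \<open>A polynomial barrier for the Hopf argument. It is positive inside the circle of radius \<open>R\<close> about
  \<open>y\<close>, vanishes on it, is negative just outside, and is strictly subharmonic near it, because
  the Laplacian equals \<open>R\<^sup>2\<close> on the circle.\<close>

lemma has_laplacian_hopf_barrier:
  "has_laplacian V (\<lambda>z. (R\<^sup>2 - (cmod (z - y))\<^sup>2) * (2 * R\<^sup>2 - (cmod (z - y))\<^sup>2))
     (\<lambda>z. 4 * (cmod (z - y))\<^sup>2 - 3 * R\<^sup>2)"
proof -
  define q where "q = (\<lambda>z. (Re z - Re y)\<^sup>2 + (Im z - Im y)\<^sup>2)"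
  have q: "(cmod (z - y))\<^sup>2 = q z" for z by (simp add: q_def cmod_power2)
  have qq: "complex_of_real (q z) = (z - y) * cnj (z - y)" for z
    by (subst complex_mult_cnj) (simp add: q_def)
  have dq: "(q has_derivative (\<lambda>v. 2 * Re (cnj (z - y) * v))) (at z)" for z
    unfolding q_def by (auto intro!: derivative_eq_intros simp: fun_eq_iff algebra_simps)
  have dq': "((\<lambda>z. complex_of_real (q z)) has_derivative (\<lambda>v. of_real (2 * Re (cnj (z - y) * v)))) (at z)" for z
    using dq by (auto intro!: derivative_eq_intros)
  have twoRe: "complex_of_real (2 * Re w) = w + cnj w" for w
    by (simp add: complex_add_cnj)
  show ?thesis unfolding q
  proof (rule has_laplacianI[where a = "\<lambda>z. (2 * of_real (q z) - 3 * of_real R^2) * cnj (z - y)"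
        and c = "\<lambda>z. 2 * cnj (z - y) * cnj (z - y)"
        and q = "\<lambda>z. 2 * (z - y) * cnj (z - y) + (2 * of_real (q z) - 3 * of_real R^2)"])
    fix z assume "z \<in> V"
    have "((\<lambda>z. (R\<^sup>2 - q z) * (2 * R\<^sup>2 - q z)) has_derivative
        (\<lambda>v. (2 * q z - 3 * R\<^sup>2) * (2 * Re (cnj (z - y) * v)))) (at z)"
      using dq by (auto intro!: derivative_eq_intros simp: fun_eq_iff algebra_simps)
    then show "((\<lambda>z. (R\<^sup>2 - q z) * (2 * R\<^sup>2 - q z)) has_derivative
        (\<lambda>v. 2 * Re ((2 * of_real (q z) - 3 * of_real R^2) * cnj (z - y) * v))) (at z)"
    proof (rule has_derivative_eq_rhs, intro ext)
      fix v
      have "(2 * complex_of_real (q z) - 3 * of_real R^2) * cnj (z - y) * v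
          = of_real (2 * q z - 3 * R^2) * (cnj (z - y) * v)" by simp
      also have "Re \<dots> = (2 * q z - 3 * R^2) * Re (cnj (z - y) * v)"
        using complex_scaleR[of "2 * q z - 3 * R^2"] by (simp add: scaleR_conv_of_real[symmetric])
      finally show "(2 * q z - 3 * R\<^sup>2) * (2 * Re (cnj (z - y) * v)) =
         2 * Re ((2 * complex_of_real (q z) - 3 * of_real R^2) * cnj (z - y) * v)" by simp
    qed
    have dcnj: "((\<lambda>z. cnj (z - y)) has_derivative (\<lambda>v. cnj v)) (at z)"
      by (auto intro!: derivative_eq_intros)
    have "((\<lambda>z. 2 * complex_of_real (q z) - 3 * of_real R^2) has_derivative (\<lambda>v. 2 * of_real (2 * Re (cnj (z - y) * v)))) (at z)"
      by (intro has_derivative_eq_rhs[OF has_derivative_diff[OF has_derivative_mult_right[OF dq'] has_derivative_const]]) simp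
    from has_derivative_mult[OF this dcnj]
    show "((\<lambda>z. (2 * complex_of_real (q z) - 3 * of_real R^2) * cnj (z - y)) has_derivative
       (\<lambda>v. 2 * cnj (z - y) * cnj (z - y) * v +
             (2 * (z - y) * cnj (z - y) + (2 * of_real (q z) - 3 * of_real R^2)) * cnj v)) (at z)"
      unfolding twoRe by (rule has_derivative_eq_rhs) (auto simp: fun_eq_iff algebra_simps)
    have "2 * (z - y) * cnj (z - y) + (2 * of_real (q z) - 3 * of_real R^2) = of_real (4 * q z - 3 * R^2)"
      using qq[of z, symmetric] by (simp only: mult.assoc) simp
    then show "Re (2 * (z - y) * cnj (z - y) + (2 * of_real (q z) - 3 * of_real R^2)) = 4 * q z - 3 * R\<^sup>2"
      by (metis Re_complex_of_real)
  qed
qed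

section \<open>The strong maximum principle\<close>

text \<open>\<open>\<Delta> \<psi> \<ge> C \<psi>\<close> at \<open>z\<close> in the viscosity sense, witnessed by a test function touching \<open>\<psi>\<close>
  from below. A maximum of finitely many smooth functions qualifies as soon as each of them is a
  subsolution wherever it attains the maximum; the sum of the negative parts of several functions
  is such a maximum.\<close>

definition viscosity_subsolution :: "real \<Rightarrow> (complex \<Rightarrow> real) \<Rightarrow> complex \<Rightarrow> bool" where
  "viscosity_subsolution C \<psi> z \<longleftrightarrow>
     (\<exists>f l W. open W \<and> z \<in> W \<and> has_laplacian W f l \<and>
        f z = \<psi> z \<and> (\<forall>w\<in>W. f w \<le> \<psi> w) \<and> C * \<psi> z \<le> l z)"

lemma viscosity_subsolutionI:
  assumes "open W" "z \<in> W" "has_laplacian W f l" "f z = \<psi> z" "\<And>w. w \<in> W \<Longrightarrow> f w \<le> \<psi> w" "C * \<psi> z \<le> l z"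
  shows "viscosity_subsolution C \<psi> z"
  unfolding viscosity_subsolution_def using assms by blast

text \<open>The Hopf argument. If \<open>\<psi>\<close> had a negative value arbitrarily close to a zero, there would be a disc
  on which \<open>\<psi> < 0\<close> except for a single zero \<open>x\<close> on its boundary. Adding a small multiple of the
  barrier of that disc keeps \<open>\<psi>\<close> negative on a small circle about \<open>x\<close> but leaves the value \<open>0\<close> at
  \<open>x\<close>, so an interior maximum appears, where the test function contradicts the strict
  subharmonicity of the barrier. Near \<open>x\<close> the barrier itself is small, which is why the
  zeroth-order term \<open>C \<psi>\<close> does no harm.\<close>

lemma strong_maximum_principle_plane:
  fixes \<psi> :: "complex \<Rightarrow> real"
  assumes "open V" "continuous_on V \<psi>" "z0 \<in> V" "\<psi> z0 = 0" "0 \<le> C"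
    and nonpos: "\<And>z. z \<in> V \<Longrightarrow> \<psi> z \<le> 0"
    and sub: "\<And>z. z \<in> V \<Longrightarrow> viscosity_subsolution C \<psi> z"
  shows "\<exists>e>0. ball z0 e \<subseteq> V \<and> (\<forall>z\<in>ball z0 e. \<psi> z = 0)"
proof (rule ccontr)
  assume no_ball: "\<not> ?thesis"
  obtain d where d: "d > 0" "ball z0 d \<subseteq> V" using \<open>open V\<close> \<open>z0 \<in> V\<close> openE by blast
  define r where "r = d / 4"
  have r: "r > 0" "cball z0 (3 * r) \<subseteq> V" using d by (auto simp: r_def intro!: subsetD[OF d(2)])
  have "\<not> (\<forall>z\<in>ball z0 r. \<psi> z = 0)"
  proof -
    have "ball z0 r \<subseteq> cball z0 (3 * r)" using r(1) by auto
    then show ?thesis using no_ball r by blast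
  qed
  then obtain y where y: "y \<in> ball z0 r" "\<psi> y \<noteq> 0" by blast
  define Z where "Z = {z \<in> cball z0 (3 * r). \<psi> z = 0}"
  have contc: "continuous_on (cball z0 (3 * r)) \<psi>" using assms(2) r(2) continuous_on_subset by blast
  have "closed Z" unfolding Z_def
    by (rule continuous_closed_preimage_constant[OF contc]) auto
  moreover have "z0 \<in> Z" using assms(4) r(1) by (simp add: Z_def)
  ultimately obtain x where x: "x \<in> Z" "\<And>z. z \<in> Z \<Longrightarrow> dist y x \<le> dist y z"
    using distance_attains_inf[of Z y thesis] by auto
  have yx: "dist y x < r" using x(2)[OF \<open>z0 \<in> Z\<close>] y(1) by (simp add: dist_commute)
  have neg1: "\<psi> z < 0" if "dist y z < dist y x" for z
  proof -
    have "dist z0 z \<le> dist z0 y + dist y z" by (rule dist_triangle)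
    hence zc: "z \<in> cball z0 (3 * r)" using that yx y(1) r(1) by simp
    have "z \<notin> Z" using x(2)[of z] that by force
    with zc have "\<psi> z \<noteq> 0" by (simp add: Z_def)
    moreover have "\<psi> z \<le> 0" using nonpos zc r(2) by blast
    ultimately show ?thesis by simp
  qed
  \<comment> \<open>Halving the disc leaves \<open>x\<close> as the only zero on its boundary.\<close>
  define y' where "y' = midpoint y x"
  define R where "R = dist y' x"
  have Rhalf: "R = dist y x / 2" and yy': "dist y y' = dist y x / 2"
    by (auto simp: R_def y'_def dist_midpoint)
  have "y \<noteq> x" using x(1) y(2) by (auto simp: Z_def)
  hence R: "R > 0" by (simp add: Rhalf)
  have neg: "\<psi> z < 0" if "dist y' z \<le> R" "z \<noteq> x" for z
  proof (cases "dist y z < dist y x")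
    case True then show ?thesis by (rule neg1)
  next
    case False
    have "dist y z \<le> dist y y' + dist y' z" by (rule dist_triangle)
    hence eqs: "dist y z = dist y y' + dist y' z" "dist y' z = R"
      using that yy' Rhalf False by linarith+
    have *: "norm ((y - y') + (y' - z)) = norm (y - y') + norm (y' - z)"
      using eqs(1) by (simp add: dist_norm)
    have "norm (y - y') = R" "norm (y' - z) = R"
      using yy' Rhalf eqs(2) by (auto simp: dist_norm)
    moreover have "norm (y - y') *\<^sub>R (y' - z) = norm (y' - z) *\<^sub>R (y - y')"
      using * norm_triangle_eq by blast
    ultimately have "R *\<^sub>R (y' - z) = R *\<^sub>R (y - y')" by simp
    hence "y' - z = y - y'" using R by simp
    moreover have "2 * y' = y + x" by (simp add: y'_def midpoint_def scaleR_conv_of_real)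
    moreover have "z = 2 * y' - (y' + (y' - z))" by simp
    ultimately have "z = x" by simp
    with that show ?thesis by simp
  qed
  define b where "b = (\<lambda>z. (R\<^sup>2 - (cmod (z - y'))\<^sup>2) * (2 * R\<^sup>2 - (cmod (z - y'))\<^sup>2))"
  define lb where "lb = (\<lambda>z. 4 * (cmod (z - y'))\<^sup>2 - 3 * R\<^sup>2)"
  have bx: "b x = 0" and lbx: "lb x > C * b x"
    using R by (auto simp: b_def lb_def R_def dist_norm norm_minus_commute)
  have contb: "continuous_on UNIV b" "continuous_on UNIV lb"
    unfolding b_def lb_def by (intro continuous_intros)+
  have "open {z. C * b z < lb z}"
    by (rule open_Collect_less) (intro continuous_intros contb)+
  moreover have "open {z. (cmod (z - y'))\<^sup>2 < 2 * R\<^sup>2}"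
    by (rule open_Collect_less) (intro continuous_intros)+
  moreover have "x \<in> ball z0 (3 * r)"
  proof -
    have "dist z0 x \<le> dist z0 y + dist y x" by (rule dist_triangle)
    then show ?thesis using yx y(1) r by simp
  qed
  ultimately have "open (ball z0 (3 * r) \<inter> {z. C * b z < lb z} \<inter> {z. (cmod (z - y'))\<^sup>2 < 2 * R\<^sup>2})"
     "x \<in> ball z0 (3 * r) \<inter> {z. C * b z < lb z} \<inter> {z. (cmod (z - y'))\<^sup>2 < 2 * R\<^sup>2}"
    using lbx R by (auto simp: R_def dist_norm norm_minus_commute)
  then obtain s where s: "s > 0" "cball x s \<subseteq> ball z0 (3 * r) \<inter> {z. C * b z < lb z} \<inter> {z. (cmod (z - y'))\<^sup>2 < 2 * R\<^sup>2}"
    unfolding open_contains_cball by blast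
  have sV: "cball x s \<subseteq> V" using s(2) r(2) ball_subset_cball[of z0 "3 * r"] by blast
  have contx: "continuous_on (cball x s) \<psi>" using assms(2) sV continuous_on_subset by blast
  define K where "K = sphere x s \<inter> cball y' R"
  have "compact K" by (simp add: K_def compact_Int_closed)
  have "\<exists>\<eta>>0. \<forall>z\<in>K. \<psi> z \<le> - \<eta>"
  proof (cases "K = {}")
    case False
    have "continuous_on K \<psi>" by (rule continuous_on_subset[OF contx]) (auto simp: K_def)
    then obtain k where k: "k \<in> K" "\<And>z. z \<in> K \<Longrightarrow> \<psi> z \<le> \<psi> k"
      using continuous_attains_sup[OF \<open>compact K\<close> False] by blast
    have "\<psi> k < 0" using k(1) s(1) by (intro neg) (auto simp: K_def)
    then show ?thesis using k by (intro exI[of _ "- \<psi> k"]) auto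
  qed (auto intro: exI[of _ 1])
  then obtain \<eta> where \<eta>: "\<eta> > 0" "\<And>z. z \<in> K \<Longrightarrow> \<psi> z \<le> - \<eta>" by blast
  \<comment> \<open>The barrier is at most \<open>2 R\<^sup>4\<close> on the disc.\<close>
  define \<epsilon> where "\<epsilon> = \<eta> / (4 * R ^ 4)"
  have \<epsilon>: "\<epsilon> > 0" using \<eta> R by (simp add: \<epsilon>_def)
  have sphere: "\<psi> z + \<epsilon> * b z < 0" if z: "z \<in> sphere x s" for z
  proof (cases "z \<in> K")
    case True
    have q: "0 \<le> (cmod (z - y'))\<^sup>2" by simp
    have q1: "(cmod (z - y'))\<^sup>2 \<le> R\<^sup>2" using True R
      by (intro power_mono) (auto simp: K_def dist_norm norm_minus_commute)
    have "b z \<le> R\<^sup>2 * (2 * R\<^sup>2)" unfolding b_def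
      by (rule mult_mono) (use q q1 zero_le_power2[of R] in linarith)+
    also have "\<dots> = 2 * R ^ 4" by (simp add: power2_eq_square power4_eq_xxxx)
    finally have "\<epsilon> * b z \<le> \<epsilon> * (2 * R ^ 4)" using \<epsilon> by simp
    also have "\<dots> = \<eta> / 2" using R by (simp add: \<epsilon>_def)
    finally show ?thesis using \<eta>(2)[OF True] \<eta>(1) by simp
  next
    case False
    hence "R < cmod (z - y')" using z by (auto simp: K_def dist_norm norm_minus_commute)
    hence "R\<^sup>2 < (cmod (z - y'))\<^sup>2" using R by (intro power_strict_mono) auto
    moreover have "(cmod (z - y'))\<^sup>2 < 2 * R\<^sup>2" using s(2) z by auto
    ultimately have "b z < 0" unfolding b_def by (intro mult_neg_pos) auto
    moreover have "\<psi> z \<le> 0" using nonpos sV z by (simp add: subset_iff)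
    ultimately show ?thesis using \<epsilon> by (simp add: add_nonpos_neg mult_pos_neg)
  qed
  have "continuous_on (cball x s) (\<lambda>z. \<psi> z + \<epsilon> * b z)"
    by (intro continuous_intros contx continuous_on_subset[OF contb(1)]) auto
  then obtain p where p: "p \<in> cball x s" "\<And>z. z \<in> cball x s \<Longrightarrow> \<psi> z + \<epsilon> * b z \<le> \<psi> p + \<epsilon> * b p"
    using continuous_attains_sup[of "cball x s" "\<lambda>z. \<psi> z + \<epsilon> * b z"] s(1) by fastforce
  have p0: "\<psi> p + \<epsilon> * b p \<ge> 0"
    using p(2)[of x] s(1) bx x(1) by (simp add: Z_def)
  hence "p \<notin> sphere x s" using sphere by force
  hence pb: "p \<in> ball x s" using p(1) by auto
  have "p \<in> V" using p(1) sV by auto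
  then obtain f l W where W: "open W" "p \<in> W" "has_laplacian W f l" "f p = \<psi> p"
     "\<forall>w\<in>W. f w \<le> \<psi> w" "C * \<psi> p \<le> l p"
    using sub unfolding viscosity_subsolution_def by blast
  have "has_laplacian (W \<inter> ball x s) (\<lambda>z. f z + \<epsilon> * b z) (\<lambda>z. l z + \<epsilon> * lb z)"
    unfolding b_def lb_def
    by (intro has_laplacian_add has_laplacian_cmult has_laplacian_hopf_barrier has_laplacian_subset[OF W(3)]) auto
  moreover have "f w + \<epsilon> * b w \<le> f p + \<epsilon> * b p" if "w \<in> W \<inter> ball x s" for w
    using p(2)[of w] W(4,5) that by fastforce
  ultimately have "l p + \<epsilon> * lb p \<le> 0"
    using laplacian_nonpos_at_local_max[of "W \<inter> ball x s" "\<lambda>z. f z + \<epsilon> * b z" "\<lambda>z. l z + \<epsilon> * lb z" p] W pb by auto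
  moreover have "C * \<psi> p \<ge> C * (- \<epsilon> * b p)" using p0 \<open>0 \<le> C\<close> by (intro mult_left_mono) auto
  moreover have "\<epsilon> * lb p > \<epsilon> * (C * b p)" using \<epsilon> s(2) p(1) by auto
  ultimately show False using W(6) by (simp add: algebra_simps)
qed

lemma chart_cover:
  assumes "closed_riemann_surface S"
  obtains \<alpha> where "p \<in> chart_dom S \<alpha>"
  using assms unfolding closed_riemann_surface_def by blast

text \<open>The set where \<open>\<psi>\<close> attains its maximum \<open>0\<close> is closed by continuity and open by the planar
  statement, so connectedness decides. The constant \<open>C\<close> may depend on the chart and the point.\<close>

lemma strong_maximum_principle:
  fixes S :: "('i, 'a::t2_space) surface" and \<psi> :: "'a \<Rightarrow> real"
  assumes S: "closed_riemann_surface S"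
    and cont: "continuous_on UNIV \<psi>" and nonpos: "\<And>p. \<psi> p \<le> 0" and "\<psi> x = 0"
    and sub: "\<And>\<alpha> p. p \<in> chart_dom S \<alpha> \<Longrightarrow> \<exists>C\<ge>0. \<exists>W. open W \<and> coord S \<alpha> p \<in> W \<and>
        W \<subseteq> coord S \<alpha> ` chart_dom S \<alpha> \<and> (\<forall>z\<in>W. viscosity_subsolution C (\<lambda>z. \<psi> (param S \<alpha> z)) z)"
  shows "\<psi> p = 0"
proof -
  let ?Z = "{p. \<psi> p = 0}"
  have "closed ?Z" by (rule closed_Collect_eq) (auto intro: cont)
  moreover have "open ?Z"
  proof (subst open_subopen, intro ballI)
    fix p assume p: "p \<in> ?Z"
    obtain \<alpha> where \<alpha>: "p \<in> chart_dom S \<alpha>" using chart_cover[OF S] .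
    let ?D = "chart_dom S \<alpha>" and ?c = "coord S \<alpha>"
    have hom: "homeomorphism ?D (?c ` ?D) ?c (param S \<alpha>)" "open ?D" "open (?c ` ?D)"
      using S unfolding closed_riemann_surface_def by blast+
    have par: "param S \<alpha> (?c q) = q" if "q \<in> ?D" for q
      using hom(1) that by (auto simp: homeomorphism_def)
    obtain C W where W: "C \<ge> 0" "open W" "?c p \<in> W" "W \<subseteq> ?c ` ?D"
      "\<And>z. z \<in> W \<Longrightarrow> viscosity_subsolution C (\<lambda>z. \<psi> (param S \<alpha> z)) z"
      using sub[OF \<alpha>] by blast
    have "\<exists>e>0. ball (?c p) e \<subseteq> W \<and> (\<forall>z\<in>ball (?c p) e. \<psi> (param S \<alpha> z) = 0)"
    proof (rule strong_maximum_principle_plane[OF W(2) _ W(3) _ W(1)])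
      have "continuous_on W (\<psi> \<circ> param S \<alpha>)"
        by (rule continuous_on_compose)
           (use hom W(4) in \<open>auto simp: homeomorphism_def intro: continuous_on_subset continuous_on_subset[OF cont]\<close>)
      then show "continuous_on W (\<lambda>z. \<psi> (param S \<alpha> z))" by (simp add: o_def)
      show "\<psi> (param S \<alpha> (?c p)) = 0" using par[OF \<alpha>] p by simp
    qed (use nonpos W(5) in blast)+
    then obtain e where e: "e > 0" "ball (?c p) e \<subseteq> W" "\<And>z. z \<in> ball (?c p) e \<Longrightarrow> \<psi> (param S \<alpha> z) = 0"
      by blast
    have "open (?D \<inter> ?c -` ball (?c p) e)"
      using hom by (intro continuous_open_preimage) (auto simp: homeomorphism_def)
    moreover have "p \<in> ?D \<inter> ?c -` ball (?c p) e" using \<alpha> e(1) by simp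
    moreover have "?D \<inter> ?c -` ball (?c p) e \<subseteq> ?Z"
    proof
      fix q assume "q \<in> ?D \<inter> ?c -` ball (?c p) e"
      then show "q \<in> ?Z" using e(3)[of "?c q"] par[of q] by simp
    qed
    ultimately show "\<exists>T. open T \<and> p \<in> T \<and> T \<subseteq> ?Z" by blast
  qed
  moreover have "connected (UNIV :: 'a set)" using S by (simp add: closed_riemann_surface_def)
  ultimately have "?Z = {} \<or> ?Z = UNIV"
    unfolding connected_clopen by (auto simp del: Collect_empty_eq)
  with \<open>\<psi> x = 0\<close> show ?thesis by blast
qed

section \<open>Functions on a surface in charts\<close>

lemma chart_facts:
  assumes "closed_riemann_surface S"
  shows chart_open: "open (chart_dom S \<alpha>)"
    and chart_image_open: "open (coord S \<alpha> ` chart_dom S \<alpha>)"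
    and coord_continuous: "continuous_on (chart_dom S \<alpha>) (coord S \<alpha>)"
    and param_continuous: "continuous_on (coord S \<alpha> ` chart_dom S \<alpha>) (param S \<alpha>)"
    and param_coord: "p \<in> chart_dom S \<alpha> \<Longrightarrow> param S \<alpha> (coord S \<alpha> p) = p"
    and coord_param: "z \<in> coord S \<alpha> ` chart_dom S \<alpha> \<Longrightarrow> coord S \<alpha> (param S \<alpha> z) = z"
    and param_in_chart: "z \<in> coord S \<alpha> ` chart_dom S \<alpha> \<Longrightarrow> param S \<alpha> z \<in> chart_dom S \<alpha>"
proof -
  have *: "homeomorphism (chart_dom S \<alpha>) (coord S \<alpha> ` chart_dom S \<alpha>) (coord S \<alpha>) (param S \<alpha>)"
    "open (chart_dom S \<alpha>)" "open (coord S \<alpha> ` chart_dom S \<alpha>)"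
    using assms unfolding closed_riemann_surface_def by blast+
  show "open (chart_dom S \<alpha>)" "open (coord S \<alpha> ` chart_dom S \<alpha>)" by fact+
  show "continuous_on (chart_dom S \<alpha>) (coord S \<alpha>)"
    "continuous_on (coord S \<alpha> ` chart_dom S \<alpha>) (param S \<alpha>)"
    using *(1) unfolding homeomorphism_def by blast+
  show "p \<in> chart_dom S \<alpha> \<Longrightarrow> param S \<alpha> (coord S \<alpha> p) = p"
    using *(1) unfolding homeomorphism_def by blast
  show "z \<in> coord S \<alpha> ` chart_dom S \<alpha> \<Longrightarrow> coord S \<alpha> (param S \<alpha> z) = z"
    using *(1) unfolding homeomorphism_def by blast
  show "z \<in> coord S \<alpha> ` chart_dom S \<alpha> \<Longrightarrow> param S \<alpha> z \<in> chart_dom S \<alpha>"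
    using *(1) unfolding homeomorphism_def by blast
qed

lemma continuous_on_chart_iff:
  assumes S: "closed_riemann_surface S"
  shows "continuous_on (chart_dom S \<alpha>) u \<longleftrightarrow>
         continuous_on (coord S \<alpha> ` chart_dom S \<alpha>) (\<lambda>z. u (param S \<alpha> z))"
proof
  assume "continuous_on (chart_dom S \<alpha>) u"
  then show "continuous_on (coord S \<alpha> ` chart_dom S \<alpha>) (\<lambda>z. u (param S \<alpha> z))"
    by (rule continuous_on_compose2[OF _ param_continuous[OF S]]) (auto intro: param_in_chart[OF S])
next
  assume "continuous_on (coord S \<alpha> ` chart_dom S \<alpha>) (\<lambda>z. u (param S \<alpha> z))"
  then have "continuous_on (chart_dom S \<alpha>) (\<lambda>p. u (param S \<alpha> (coord S \<alpha> p)))"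
    by (rule continuous_on_compose2[OF _ coord_continuous[OF S]]) auto
  then show "continuous_on (chart_dom S \<alpha>) u"
    by (rule continuous_on_eq) (simp add: param_coord[OF S])
qed

lemma continuous_on_charts:
  assumes S: "closed_riemann_surface S" and "\<And>\<alpha>. continuous_on (chart_dom S \<alpha>) u"
  shows "continuous_on UNIV u"
proof -
  have "continuous_on (\<Union>\<alpha>. chart_dom S \<alpha>) u"
    by (rule continuous_on_open_UN) (use assms chart_open[OF S] in auto)
  moreover have "(\<Union>\<alpha>. chart_dom S \<alpha>) = UNIV" using S unfolding closed_riemann_surface_def by blast
  ultimately show ?thesis by simp
qed

section \<open>Cyclic second differences\<close>

abbreviation cyc_suc :: "nat \<Rightarrow> nat \<Rightarrow> nat" where "cyc_suc n k \<equiv> Suc k mod n"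
abbreviation cyc_pred :: "nat \<Rightarrow> nat \<Rightarrow> nat" where "cyc_pred n k \<equiv> (k + n - 1) mod n"

lemma cyc_pred_suc: "k < n \<Longrightarrow> cyc_pred n (cyc_suc n k) = k"
  by (cases "Suc k = n") auto

lemma cyc_suc_pred: "k < n \<Longrightarrow> cyc_suc n (cyc_pred n k) = k"
  by (cases k) (auto simp: mod_if)

lemma sum_cyc_suc: "(\<Sum>k<n. g (cyc_suc n k)) = (\<Sum>k<n. g k)"
proof (cases "n = 0")
  case False
  then show ?thesis
    by (intro sum.reindex_bij_witness[of _ "cyc_pred n" "cyc_suc n"])
       (auto simp: cyc_pred_suc cyc_suc_pred simp del: One_nat_def)
qed simp

lemma sum_cyc_pred: "(\<Sum>k<n. g (cyc_pred n k)) = (\<Sum>k<n. g k)"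
proof (cases "n = 0")
  case False
  then show ?thesis
    by (intro sum.reindex_bij_witness[of _ "cyc_suc n" "cyc_pred n"])
       (auto simp: cyc_pred_suc cyc_suc_pred simp del: One_nat_def)
qed simp

lemma cyclic_induct:
  assumes "P k0" "k0 < n" and step: "\<And>k. k < n \<Longrightarrow> P k \<Longrightarrow> P (cyc_suc n k)" and "k < n"
  shows "P k"
proof -
  have *: "P ((k0 + i) mod n)" for i
  proof (induction i)
    case 0 then show ?case using assms by simp
  next
    case (Suc i)
    have "P (cyc_suc n ((k0 + i) mod n))" by (rule step) (use Suc assms in auto)
    then show ?case by (simp add: mod_Suc_eq)
  qed
  have "(k0 + (k + (n - k0))) mod n = k" using assms by simp
  with *[of "k + (n - k0)"] show ?thesis by simp
qed

text \<open>Replacing \<open>F\<close> by \<open>min F 0\<close> can only decrease the sum over \<open>J\<close>, and second differences on a cycle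
  have total sum zero; the terms outside \<open>J\<close> that are thereby split off have a sign. In the equality
  case these terms vanish, so the complement of \<open>J\<close> is closed under the cyclic shift.\<close>

lemma cyclic_second_difference_sum:
  fixes F :: "nat \<Rightarrow> real"
  assumes J: "J \<subseteq> {..<n}" and neg: "\<And>k. k \<in> J \<Longrightarrow> F k \<le> 0"
    and nonneg: "\<And>k. k < n \<Longrightarrow> k \<notin> J \<Longrightarrow> 0 \<le> F k"
  shows "0 \<le> (\<Sum>k\<in>J. F (cyc_pred n k) + F (cyc_suc n k) - 2 * F k)"
    and "(\<Sum>k\<in>J. F (cyc_pred n k) + F (cyc_suc n k) - 2 * F k) = 0 \<Longrightarrow>
         (\<And>k. k \<in> J \<Longrightarrow> F k < 0) \<Longrightarrow> J \<noteq> {} \<Longrightarrow> J = {..<n}"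
proof -
  define g where "g k = (if k \<in> J then F k else 0)" for k
  have gF: "g k \<le> F k" if "k < n" for k using nonneg[OF that] by (simp add: g_def)
  have g0: "g k \<le> 0" for k using neg by (simp add: g_def)
  let ?T = "\<lambda>k. g (cyc_pred n k) + g (cyc_suc n k) - 2 * g k"
  let ?E = "\<Sum>k\<in>{..<n} - J. - g (cyc_pred n k) - g (cyc_suc n k)"
  have fin: "finite J" using J finite_subset by blast
  have "(\<Sum>k<n. ?T k) = 0"
    using sum_cyc_suc[of g n] sum_cyc_pred[of g n]
    by (simp add: sum.distrib sum_subtractf sum_distrib_left[symmetric])
  moreover have "(\<Sum>k<n. ?T k) = (\<Sum>k\<in>J. ?T k) + (\<Sum>k\<in>{..<n} - J. ?T k)"
    using J by (simp add: sum.subset_diff add.commute)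
  moreover have "(\<Sum>k\<in>{..<n} - J. ?T k) = - ?E"
    unfolding sum_negf[symmetric] by (rule sum.cong) (auto simp: g_def)
  ultimately have TE: "(\<Sum>k\<in>J. ?T k) = ?E" by linarith
  have "(\<Sum>k\<in>J. ?T k) \<le> (\<Sum>k\<in>J. F (cyc_pred n k) + F (cyc_suc n k) - 2 * F k)"
  proof (rule sum_mono)
    fix k assume "k \<in> J"
    then have "k < n" using J by auto
    then have "cyc_pred n k < n" "cyc_suc n k < n" by auto
    then show "?T k \<le> F (cyc_pred n k) + F (cyc_suc n k) - 2 * F k"
      using gF[of "cyc_pred n k"] gF[of "cyc_suc n k"] \<open>k \<in> J\<close> by (simp add: g_def)
  qed
  with TE have ge: "?E \<le> (\<Sum>k\<in>J. F (cyc_pred n k) + F (cyc_suc n k) - 2 * F k)" by simp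
  have term0: "0 \<le> - g (cyc_pred n k) - g (cyc_suc n k)" for k
    using g0[of "cyc_pred n k"] g0[of "cyc_suc n k"] by simp
  have E0: "0 \<le> ?E" by (rule sum_nonneg) (rule term0)
  show "0 \<le> (\<Sum>k\<in>J. F (cyc_pred n k) + F (cyc_suc n k) - 2 * F k)" using ge E0 by simp
  assume eq: "(\<Sum>k\<in>J. F (cyc_pred n k) + F (cyc_suc n k) - 2 * F k) = 0"
    and strict: "\<And>k. k \<in> J \<Longrightarrow> F k < 0" and "J \<noteq> {}"
  have "?E = 0" using ge E0 eq by simp
  then have each: "- g (cyc_pred n k) - g (cyc_suc n k) = 0" if "k < n" "k \<notin> J" for k
    using that term0 sum_nonneg_eq_0_iff[of "{..<n} - J" "\<lambda>k. - g (cyc_pred n k) - g (cyc_suc n k)"] by auto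
  have closed: "cyc_suc n k \<notin> J" if "k < n" "k \<notin> J" for k
  proof
    assume "cyc_suc n k \<in> J"
    then have "g (cyc_suc n k) < 0" using strict by (simp add: g_def)
    with each[OF that] g0[of "cyc_pred n k"] show False by simp
  qed
  show "J = {..<n}"
  proof (rule ccontr)
    assume "J \<noteq> {..<n}"
    then obtain k0 where "k0 < n" "k0 \<notin> J" using J by auto
    then have "k \<notin> J" if "k < n" for k
      using cyclic_induct[of "\<lambda>k. k \<notin> J" k0 n k] closed that by blast
    with \<open>J \<noteq> {}\<close> J show False by auto
  qed
qed

section \<open>Comparison for Toda-like systems\<close>

text \<open>Here \<open>f k = A k * (exp (v k) - 1)\<close> is the difference of the exponential terms of two solutions
  and \<open>v k\<close> the logarithm of their quotient. Positivity of all \<open>A k\<close> at a single point \<open>x\<close> suffices: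
  by the maximum principle the relevant functions are constant before they are evaluated at \<open>x\<close>.\<close>

lemma toda_comparison:
  fixes S :: "('i, 'a::t2_space) surface" and v :: "nat \<Rightarrow> 'a \<Rightarrow> real" and f A :: "nat \<Rightarrow> 'i \<Rightarrow> 'a \<Rightarrow> real"
  assumes S: "closed_riemann_surface S"
    and lap: "\<And>\<alpha> k. k < n \<Longrightarrow> has_laplacian (coord S \<alpha> ` chart_dom S \<alpha>) (\<lambda>z. v k (param S \<alpha> z))
        (\<lambda>z. 2 * f k \<alpha> (param S \<alpha> z) - f (cyc_pred n k) \<alpha> (param S \<alpha> z) - f (cyc_suc n k) \<alpha> (param S \<alpha> z))"
    and f: "\<And>\<alpha> k p. k < n \<Longrightarrow> p \<in> chart_dom S \<alpha> \<Longrightarrow> f k \<alpha> p = A k \<alpha> p * (exp (v k p) - 1)"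
    and A: "\<And>\<alpha> k p. k < n \<Longrightarrow> p \<in> chart_dom S \<alpha> \<Longrightarrow> 0 \<le> A k \<alpha> p"
    and A_cont: "\<And>\<alpha> k. k < n \<Longrightarrow> continuous_on (chart_dom S \<alpha>) (A k \<alpha>)"
    and x: "x \<in> chart_dom S \<alpha>0" and A_pos: "\<And>k. k < n \<Longrightarrow> 0 < A k \<alpha>0 x"
    and sum: "0 < (\<Sum>k<n. v k x)"
    and "k < n"
  shows "0 < v k p"
proof -
  let ?V = "\<lambda>\<alpha>. coord S \<alpha> ` chart_dom S \<alpha>"
  have v_chart: "continuous_on (chart_dom S \<alpha>) (v k)" if "k < n" for \<alpha> k
    using has_laplacian_imp_continuous_on[OF lap[OF that]] continuous_on_chart_iff[OF S] by blast
  have v_cont: "continuous_on UNIV (v k)" if "k < n" for k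
    by (rule continuous_on_charts[OF S v_chart[OF that]])
  have f_sign: "v k p \<ge> 0 \<Longrightarrow> f k \<alpha> p \<ge> 0" "v k p \<le> 0 \<Longrightarrow> f k \<alpha> p \<le> 0"
    if "k < n" "p \<in> chart_dom S \<alpha>" for k p \<alpha>
    using f[OF that] A[OF that] by (auto simp: mult_nonneg_nonpos)
  have xV: "coord S \<alpha>0 x \<in> ?V \<alpha>0" "param S \<alpha>0 (coord S \<alpha>0 x) = x" using x param_coord[OF S x] by auto

  \<comment> \<open>The sum of the negative parts; near any point it is bounded below by the smooth function
    \<open>- (\<Sum>k\<in>J. v k)\<close> with \<open>J\<close> the set of indices that are active at that point.\<close>
  define \<psi> where "\<psi> p = (\<Sum>k<n. max 0 (- v k p))" for p
  have \<psi>_cont: "continuous_on UNIV \<psi>" unfolding \<psi>_def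
    by (intro continuous_intros v_cont) auto
  have "compact (UNIV :: 'a set)" using S by (simp add: closed_riemann_surface_def)
  then obtain m where m: "\<And>p. \<psi> p \<le> \<psi> m"
    using continuous_attains_sup[OF _ _ \<psi>_cont] by auto
  define J where "J p = {k. k < n \<and> v k p < 0}" for p
  have \<psi>_J: "\<psi> p = - (\<Sum>k\<in>J p. v k p)" for p
  proof -
    have "\<psi> p = (\<Sum>k\<in>J p. max 0 (- v k p))" unfolding \<psi>_def
      by (rule sum.mono_neutral_right) (auto simp: J_def)
    also have "\<dots> = (\<Sum>k\<in>J p. - v k p)" by (rule sum.cong) (auto simp: J_def)
    finally show ?thesis by (simp add: sum_negf)
  qed
  have \<psi>_ge: "- (\<Sum>k\<in>J q. v k p) \<le> \<psi> p" for p q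
  proof -
    have "- (\<Sum>k\<in>J q. v k p) \<le> (\<Sum>k\<in>J q. max 0 (- v k p))"
      by (subst sum_negf[symmetric]) (rule sum_mono, simp)
    also have "\<dots> \<le> \<psi> p" unfolding \<psi>_def by (rule sum_mono2) (auto simp: J_def)
    finally show ?thesis .
  qed
  define l where "l q \<alpha> = (\<lambda>z. - (\<Sum>k\<in>J q. 2 * f k \<alpha> (param S \<alpha> z) - f (cyc_pred n k) \<alpha> (param S \<alpha> z) - f (cyc_suc n k) \<alpha> (param S \<alpha> z)))" for q \<alpha>
  have lap_J: "has_laplacian (?V \<alpha>) (\<lambda>z. - (\<Sum>k\<in>J q. v k (param S \<alpha> z)) - \<psi> m) (l q \<alpha>)" for q \<alpha>
  proof -
    have "has_laplacian (?V \<alpha>) (\<lambda>z. - (\<Sum>k\<in>J q. v k (param S \<alpha> z)) - \<psi> m) (\<lambda>z. l q \<alpha> z - 0)"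
      unfolding l_def
      by (intro has_laplacian_diff has_laplacian_minus has_laplacian_sum has_laplacian_const lap) (auto simp: J_def)
    then show ?thesis by simp
  qed
  have l_eq: "l q \<alpha> z = (\<Sum>k\<in>J q. f (cyc_pred n k) \<alpha> (param S \<alpha> z) + f (cyc_suc n k) \<alpha> (param S \<alpha> z) - 2 * f k \<alpha> (param S \<alpha> z))" for q \<alpha> z
    unfolding l_def by (subst sum_negf[symmetric]) (rule sum.cong, auto)
  have v_nonneg: "0 \<le> v k p" if "k < n" for k p
  proof (rule ccontr)
    assume "\<not> 0 \<le> v k p"
    then have "0 < max 0 (- v k p)" by simp
    also have "\<dots> \<le> \<psi> p" unfolding \<psi>_def by (rule member_le_sum) (use that in auto)
    also have "\<dots> \<le> \<psi> m" by (rule m)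
    finally have M: "0 < \<psi> m" .
    have const: "\<psi> q - \<psi> m = 0" for q
    proof (rule strong_maximum_principle[OF S, where \<psi> = "\<lambda>q. \<psi> q - \<psi> m" and x = m])
      show "continuous_on UNIV (\<lambda>q. \<psi> q - \<psi> m)" by (intro continuous_intros \<psi>_cont)
      show "\<psi> q - \<psi> m \<le> 0" for q using m[of q] by simp
      show "\<psi> m - \<psi> m = 0" by simp
      fix \<alpha> p assume p: "p \<in> chart_dom S \<alpha>"
      have "viscosity_subsolution 0 (\<lambda>z. \<psi> (param S \<alpha> z) - \<psi> m) z" if z: "z \<in> ?V \<alpha>" for z
      proof -
        let ?q = "param S \<alpha> z"
        have q: "?q \<in> chart_dom S \<alpha>" by (rule param_in_chart[OF S z])
        have "0 \<le> l ?q \<alpha> z" unfolding l_eq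
          by (rule cyclic_second_difference_sum(1)) (auto simp: J_def intro!: f_sign q)
        then show ?thesis
          using \<psi>_J[of ?q] \<psi>_ge[where q = ?q]
          by (intro viscosity_subsolutionI[OF chart_image_open[OF S] z lap_J[of \<alpha> ?q]]) auto
      qed
      then show "\<exists>C\<ge>0. \<exists>W. open W \<and> coord S \<alpha> p \<in> W \<and> W \<subseteq> ?V \<alpha> \<and>
          (\<forall>z\<in>W. viscosity_subsolution C (\<lambda>z. \<psi> (param S \<alpha> z) - \<psi> m) z)"
        using chart_image_open[OF S] p by (intro exI[of _ 0] conjI exI[of _ "?V \<alpha>"]) auto
    qed
    have "\<psi> x > 0" using const[of x] M by simp
    then have "J x \<noteq> {}" using \<psi>_J[of x] by auto
    have "l x \<alpha>0 (coord S \<alpha>0 x) \<le> 0"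
    proof (rule laplacian_nonpos_at_local_max[OF lap_J chart_image_open[OF S] xV(1)])
      fix w
      have "- (\<Sum>k\<in>J x. v k (param S \<alpha>0 w)) - \<psi> m \<le> 0"
        using \<psi>_ge[where q = x and p = "param S \<alpha>0 w"] const[of "param S \<alpha>0 w"] by simp
      also have "0 = - (\<Sum>k\<in>J x. v k (param S \<alpha>0 (coord S \<alpha>0 x))) - \<psi> m"
        using const[of x] \<psi>_J[of x] xV(2) by simp
      finally show "- (\<Sum>k\<in>J x. v k (param S \<alpha>0 w)) - \<psi> m \<le> - (\<Sum>k\<in>J x. v k (param S \<alpha>0 (coord S \<alpha>0 x))) - \<psi> m" .
    qed
    moreover have "0 \<le> l x \<alpha>0 (coord S \<alpha>0 x)" unfolding l_eq xV(2)
      by (rule cyclic_second_difference_sum(1)) (auto simp: J_def intro!: f_sign x)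
    ultimately have "l x \<alpha>0 (coord S \<alpha>0 x) = 0" by simp
    then have "J x = {..<n}" unfolding l_eq xV(2)
    proof (rule cyclic_second_difference_sum(2)[rotated 3])
      show "f k \<alpha>0 x < 0" if "k \<in> J x" for k
      proof -
        have "k < n" "v k x < 0" using that by (auto simp: J_def)
        then show ?thesis using f[OF \<open>k < n\<close> x] A_pos[OF \<open>k < n\<close>] by (simp add: mult_pos_neg)
      qed
      then show "f k \<alpha>0 x \<le> 0" if "k \<in> J x" for k using that by force
    qed (use \<open>J x \<noteq> {}\<close> in \<open>auto simp: J_def intro!: f_sign x\<close>)
    then have "\<psi> x = - (\<Sum>k<n. v k x)" using \<psi>_J[of x] by simp
    with \<open>\<psi> x > 0\<close> sum show False by simp
  qed

  \<comment> \<open>Now \<open>- v k\<close> is a nonpositive subsolution of a linear equation.\<close>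
  have zero_imp: "v k q = 0" if k: "k < n" and "v k p = 0" for k p q
  proof -
    have "- v k q = 0"
    proof (rule strong_maximum_principle[OF S, where \<psi> = "\<lambda>q. - v k q" and x = p])
      show "continuous_on UNIV (\<lambda>q. - v k q)" by (intro continuous_intros v_cont k)
      show "- v k q \<le> 0" for q using v_nonneg[OF k] by simp
      show "- v k p = 0" using \<open>v k p = 0\<close> by simp
      fix \<alpha> p assume p: "p \<in> chart_dom S \<alpha>"
      define B where "B = (\<lambda>z. A k \<alpha> (param S \<alpha> z) * exp (v k (param S \<alpha> z)))"
      have B_cont: "continuous_on (?V \<alpha>) B" unfolding B_def
        by (intro continuous_intros; subst continuous_on_chart_iff[OF S, symmetric]) (use A_cont v_chart k in auto)
      let ?K = "B (coord S \<alpha> p) + 1"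
      define W where "W = ?V \<alpha> \<inter> B -` {..<?K}"
      have W: "open W" unfolding W_def
        by (rule continuous_open_preimage[OF B_cont chart_image_open[OF S]]) auto
      have K: "?K \<ge> 0" using A[OF k p] param_coord[OF S p] by (simp add: B_def)
      have "viscosity_subsolution (2 * ?K) (\<lambda>z. - v k (param S \<alpha> z)) z" if z: "z \<in> W" for z
      proof -
        let ?q = "param S \<alpha> z"
        have zV: "z \<in> ?V \<alpha>" using z by (simp add: W_def)
        have q: "?q \<in> chart_dom S \<alpha>" by (rule param_in_chart[OF S zV])
        have v0: "v k ?q \<ge> 0" by (rule v_nonneg[OF k])
        \<comment> \<open>\<open>e\<^sup>v - 1 \<le> v e\<^sup>v\<close> turns the exponential into a zeroth-order term.\<close>
        have "1 - v k ?q \<le> exp (- v k ?q)" using exp_ge_add_one_self[of "- v k ?q"] by simp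
        then have "(1 - v k ?q) * exp (v k ?q) \<le> exp (- v k ?q) * exp (v k ?q)"
          by (rule mult_right_mono) simp
        then have "exp (v k ?q) - 1 \<le> exp (v k ?q) * v k ?q"
          by (simp add: exp_minus algebra_simps)
        then have "f k \<alpha> ?q \<le> A k \<alpha> ?q * (exp (v k ?q) * v k ?q)"
          unfolding f[OF k q] by (rule mult_left_mono) (rule A[OF k q])
        also have "\<dots> = B z * v k ?q" by (simp add: B_def)
        also have "\<dots> \<le> ?K * v k ?q" by (rule mult_right_mono) (use z v0 in \<open>auto simp: W_def\<close>)
        finally have "f k \<alpha> ?q \<le> ?K * v k ?q" .
        moreover have "cyc_pred n k < n" "cyc_suc n k < n" using k by auto
        then have "0 \<le> f (cyc_pred n k) \<alpha> ?q" "0 \<le> f (cyc_suc n k) \<alpha> ?q"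
          using f_sign(1)[OF _ q] v_nonneg by blast+
        moreover have "2 * ?K * (- v k ?q) = - 2 * (?K * v k ?q)" by simp
        ultimately have "2 * ?K * (- v k ?q) \<le> - (2 * f k \<alpha> ?q - f (cyc_pred n k) \<alpha> ?q - f (cyc_suc n k) \<alpha> ?q)"
          by linarith
        then show ?thesis
          by (intro viscosity_subsolutionI[OF W z has_laplacian_subset[OF has_laplacian_minus[OF lap[OF k, of \<alpha>]], of W]])
             (auto simp: W_def)
      qed
      then show "\<exists>C\<ge>0. \<exists>W. open W \<and> coord S \<alpha> p \<in> W \<and> W \<subseteq> ?V \<alpha> \<and>
          (\<forall>z\<in>W. viscosity_subsolution C (\<lambda>z. - v k (param S \<alpha> z)) z)"
        using W K p by (intro exI[of _ "2 * ?K"] conjI exI[of _ W]) (auto simp: W_def)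
    qed
    then show ?thesis by simp
  qed

  have propagate: "v (cyc_suc n k) x = 0" if k: "k < n" and "v k x = 0" for k
  proof -
    have zero: "v k q = 0" for q by (rule zero_imp[OF k \<open>v k x = 0\<close>])
    let ?l = "\<lambda>z. 2 * f k \<alpha>0 (param S \<alpha>0 z) - f (cyc_pred n k) \<alpha>0 (param S \<alpha>0 z) - f (cyc_suc n k) \<alpha>0 (param S \<alpha>0 z)"
    have "- ?l (coord S \<alpha>0 x) \<le> 0"
      using laplacian_nonpos_at_local_max[OF has_laplacian_minus[OF lap[OF k, of \<alpha>0]] chart_image_open[OF S] xV(1)] zero
      by simp
    then have "f (cyc_pred n k) \<alpha>0 x + f (cyc_suc n k) \<alpha>0 x \<le> 0"
      using f[OF k x] zero[of x] xV(2) by simp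
    moreover have n: "cyc_pred n k < n" "cyc_suc n k < n" using k by auto
    moreover have "0 \<le> f (cyc_pred n k) \<alpha>0 x" "0 \<le> f (cyc_suc n k) \<alpha>0 x"
      using f_sign(1)[OF _ x] v_nonneg n by blast+
    ultimately have "f (cyc_suc n k) \<alpha>0 x = 0" by linarith
    then show ?thesis using f[OF n(2) x] A_pos[OF n(2)] by simp
  qed
  show "0 < v k p"
  proof (rule ccontr)
    assume "\<not> 0 < v k p"
    then have "v k p = 0" using v_nonneg[OF \<open>k < n\<close>, of p] by simp
    then have "v k x = 0" by (rule zero_imp[OF \<open>k < n\<close>])
    then have "v j x = 0" if "j < n" for j
      using cyclic_induct[of "\<lambda>k. v k x = 0" k n j] propagate \<open>k < n\<close> that by blast
    with sum show False by simp
  qed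
qed

section \<open>Linear algebra of the Hitchin equation\<close>

lemma index_mat_adjoint:
  fixes A :: "complex mat"
  assumes "A \<in> carrier_mat n n" "i < n" "j < n"
  shows "mat_adjoint A $$ (i, j) = cnj (A $$ (j, i))"
proof -
  have d: "dim_row A = n" "dim_col A = n" using assms by auto
  have "mat_adjoint A $$ (i, j) = (map conjugate (cols A) ! i) $ j"
    unfolding mat_adjoint_def using assms(2,3) d by (intro mat_of_rows_index) auto
  also have "map conjugate (cols A) ! i = conjugate (col A i)" using assms(2) d by simp
  also have "conjugate (col A i) $ j = conjugate (col A i $ j)" using assms(2,3) d by simp
  also have "\<dots> = cnj (A $$ (j, i))" using assms(2,3) d by simp
  finally show ?thesis .
qed

lemma mat_adjoint_carrier:
  fixes A :: "complex mat"
  assumes "A \<in> carrier_mat n n"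
  shows "mat_adjoint A \<in> carrier_mat n n"
proof -
  have d: "dim_row A = n" "dim_col A = n" using assms by auto
  show ?thesis unfolding mat_adjoint_def carrier_mat_def
    by (simp only: mem_Collect_eq mat_of_rows_carrier length_map cols_length d mat_of_rows_def dim_row_mat dim_col_mat)
qed

lemma index_mult_mat_sum:
  fixes A B :: "complex mat"
  assumes "A \<in> carrier_mat n n" "B \<in> carrier_mat n n" "i < n" "j < n"
  shows "(A * B) $$ (i, j) = (\<Sum>l<n. A $$ (i, l) * B $$ (l, j))"
  using assms by (auto simp: scalar_prod_def atLeast0LessThan intro!: sum.cong)

lemma mat_inv_facts:
  assumes "A \<in> carrier_mat n n" "Determinant.det A \<noteq> 0"
  shows "mat_inv A \<in> carrier_mat n n" "A * mat_inv A = 1\<^sub>m n" "mat_inv A * A = 1\<^sub>m n"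
    and "mat_inv A = inverse (Determinant.det A) \<cdot>\<^sub>m adj_mat A"
proof -
  have "A \<in> Units (ring_mat TYPE(complex) n ())" by (rule det_non_zero_imp_unit[OF assms])
  then obtain B where B: "mat_inverse A = Some B"
    using mat_inverse(1)[OF assms(1), where b = "()"] by blast
  with mat_inverse(2)[OF assms(1) B] show *: "mat_inv A \<in> carrier_mat n n" "A * mat_inv A = 1\<^sub>m n" "mat_inv A * A = 1\<^sub>m n"
    by (auto simp: mat_inv_def)
  let ?C = "inverse (Determinant.det A) \<cdot>\<^sub>m adj_mat A"
  note adj = adj_mat[OF assms(1)]
  have "A * ?C = inverse (Determinant.det A) \<cdot>\<^sub>m (A * adj_mat A)"
    by (rule mult_smult_distrib[OF assms(1) adj(1)])
  also have "\<dots> = 1\<^sub>m n" using adj(2) assms(2) by (auto intro!: eq_matI)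
  finally have C: "A * ?C = 1\<^sub>m n" .
  have "mat_inv A = mat_inv A * (A * ?C)" using * C by simp
  also have "\<dots> = mat_inv A * A * ?C" 
    by (rule assoc_mult_mat[symmetric, of _ n n _ n _ n]) (use * adj(1) assms(1) in auto)
  also have "\<dots> = ?C" using * adj(1) by simp
  finally show "mat_inv A = ?C" .
qed

definition quadratic_form :: "nat \<Rightarrow> complex mat \<Rightarrow> (nat \<Rightarrow> complex) \<Rightarrow> complex" where
  "quadratic_form n Q w = (\<Sum>i<n. \<Sum>j<n. cnj (w i) * Q $$ (i, j) * w j)"

lemma quadratic_form_eq_vec:
  assumes "Q \<in> carrier_mat n n"
  shows "quadratic_form n Q w = (Q *\<^sub>v Matrix.vec n w) \<bullet>c Matrix.vec n w"
  using assms unfolding quadratic_form_def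
  by (auto simp: scalar_prod_def atLeast0LessThan sum_distrib_right sum_distrib_left mult_ac intro!: sum.cong)

lemma index_congruence_diag:
  assumes "P \<in> carrier_mat n n" "Q \<in> carrier_mat n n" "k < n"
  shows "(mat_adjoint P * (Q * P)) $$ (k, k) = quadratic_form n Q (\<lambda>i. P $$ (i, k))"
proof -
  have "(mat_adjoint P * (Q * P)) $$ (k, k) = (\<Sum>l<n. cnj (P $$ (l, k)) * (Q * P) $$ (l, k))"
    by (subst index_mult_mat_sum[of _ n])
       (use assms in \<open>auto simp: index_mat_adjoint[of P n] mat_adjoint_carrier simp del: index_mult_mat intro!: sum.cong\<close>)
  also have "\<dots> = (\<Sum>l<n. cnj (P $$ (l, k)) * (\<Sum>j<n. Q $$ (l, j) * P $$ (j, k)))"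
    by (intro sum.cong refl) (use assms in \<open>simp add: index_mult_mat_sum[of Q n] del: index_mult_mat\<close>)
  finally show ?thesis by (simp add: quadratic_form_def sum_distrib_left mult_ac)
qed

lemma sum_single_support:
  fixes k n :: nat and g :: "nat \<Rightarrow> complex"
  assumes "k < n"
  shows "(\<Sum>i<n. (if i = k then a else 0) * g i) = a * g k" "(\<Sum>i<n. g i * (if i = k then a else 0)) = g k * a"
proof -
  show "(\<Sum>i<n. (if i = k then a else 0) * g i) = a * g k"
    using assms by (subst sum.remove[of _ k]) (auto intro: sum.neutral)
  show "(\<Sum>i<n. g i * (if i = k then a else 0)) = g k * a"
    using assms by (subst sum.remove[of _ k]) (auto intro: sum.neutral)
qed

text \<open>Cauchy--Schwarz for the form \<open>Q\<close> inverse to \<open>H\<close>, applied to \<open>w\<close> and the \<open>k\<close>-th column of \<open>H\<close>.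
  The difference of the two sides is the \<open>H\<close>-norm of \<open>y = Q w - (w\<^sub>k / H\<^sub>k\<^sub>k) e\<^sub>k\<close>, so equality
  forces \<open>y = 0\<close>.\<close>

lemma inverse_form_cauchy_schwarz:
  assumes H: "H \<in> carrier_mat n n" and Q: "Q \<in> carrier_mat n n" and HQ: "H * Q = 1\<^sub>m n"
    and herm: "mat_adjoint H = H"
    and pos: "\<And>v. v \<in> carrier_vec n \<Longrightarrow> v \<noteq> 0\<^sub>v n \<Longrightarrow> 0 < Re ((H *\<^sub>v v) \<bullet>c v)"
    and k: "k < n"
  shows "H $$ (k, k) = complex_of_real (Re (H $$ (k, k)))" and "0 < Re (H $$ (k, k))"
    and "(cmod (w k))\<^sup>2 / Re (H $$ (k, k)) \<le> Re (quadratic_form n Q w)"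
    and "Re (quadratic_form n Q w) = (cmod (w k))\<^sup>2 / Re (H $$ (k, k)) \<Longrightarrow> i < n \<Longrightarrow>
         (\<Sum>j<n. Q $$ (i, j) * w j) = (if i = k then w k / H $$ (k, k) else 0)"
proof -
  have hc: "H $$ (i, j) = cnj (H $$ (j, i))" if "i < n" "j < n" for i j
    using index_mat_adjoint[OF H that] herm by simp
  have "H $$ (k, k) = cnj (H $$ (k, k))" by (rule hc[OF k k])
  then show real: "H $$ (k, k) = complex_of_real (Re (H $$ (k, k)))" by (simp add: complex_eq_iff)
  have pos': "0 < Re (quadratic_form n H y)" if "i < n" "y i \<noteq> 0" for y i
  proof -
    have "Matrix.vec n y \<noteq> 0\<^sub>v n" using that by (metis index_vec index_zero_vec(1))
    then show ?thesis using pos[of "Matrix.vec n y"] quadratic_form_eq_vec[OF H] by simp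
  qed
  define e where "e = (\<lambda>i. if i = k then 1 else 0 :: complex)"
  have "quadratic_form n H e = H $$ (k, k)"
    unfolding quadratic_form_def e_def
    by (simp add: if_distrib[of cnj] mult.assoc sum_distrib_left[symmetric] k sum_single_support cong: if_cong)
  with pos'[of k e] k show hpos: "0 < Re (H $$ (k, k))" by (simp add: e_def)
  define x where "x i = (\<Sum>j<n. Q $$ (i, j) * w j)" for i
  have Hx: "(\<Sum>j<n. H $$ (i, j) * x j) = w i" if i: "i < n" for i
  proof -
    have "(\<Sum>j<n. H $$ (i, j) * x j) = (\<Sum>j<n. \<Sum>l<n. H $$ (i, j) * Q $$ (j, l) * w l)"
      by (simp add: x_def sum_distrib_left mult.assoc)
    also have "\<dots> = (\<Sum>l<n. (\<Sum>j<n. H $$ (i, j) * Q $$ (j, l)) * w l)"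
      by (subst sum.swap) (simp add: sum_distrib_right)
    also have "\<dots> = (\<Sum>l<n. (if l = i then 1 else 0) * w l)"
    proof (intro sum.cong refl)
      fix l assume "l \<in> {..<n}"
      then show "(\<Sum>j<n. H $$ (i, j) * Q $$ (j, l)) * w l = (if l = i then 1 else 0) * w l"
        using index_mult_mat_sum[OF H Q i, of l] i by (auto simp: HQ)
    qed
    finally show ?thesis using i by (simp add: sum_single_support)
  qed
  let ?c = "w k / H $$ (k, k)"
  define y where "y i = x i - (if i = k then ?c else 0)" for i
  have Hy: "(\<Sum>j<n. H $$ (i, j) * y j) = w i - H $$ (i, k) * ?c" if i: "i < n" for i
    unfolding y_def right_diff_distrib sum_subtractf using Hx[OF i] k by (simp add: sum_single_support)
  have xH: "(\<Sum>i<n. cnj (x i) * H $$ (i, k)) = cnj (w k)"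
  proof -
    have "(\<Sum>i<n. cnj (x i) * H $$ (i, k)) = (\<Sum>i<n. cnj (H $$ (k, i) * x i))"
    proof (intro sum.cong refl)
      fix i assume "i \<in> {..<n}"
      then have "H $$ (i, k) = cnj (H $$ (k, i))" by (intro hc k) simp
      then show "cnj (x i) * H $$ (i, k) = cnj (H $$ (k, i) * x i)" by (simp add: mult.commute)
    qed
    also have "\<dots> = cnj (w k)" using Hx[OF k] by (simp only: cnj_sum[symmetric])
    finally show ?thesis .
  qed
  have xw: "(\<Sum>i<n. cnj (x i) * w i) = cnj (quadratic_form n Q w)"
  proof -
    have "(\<Sum>i<n. cnj (x i) * w i) = (\<Sum>i<n. \<Sum>j<n. cnj (Q $$ (i, j)) * cnj (w j) * w i)"
      by (simp add: x_def sum_distrib_right)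
    then show ?thesis by (simp add: quadratic_form_def mult_ac)
  qed
  have "quadratic_form n H y = (\<Sum>i<n. cnj (y i) * (\<Sum>j<n. H $$ (i, j) * y j))"
    by (simp add: quadratic_form_def sum_distrib_left mult.assoc)
  also have "\<dots> = (\<Sum>i<n. cnj (y i) * (w i - H $$ (i, k) * ?c))"
    by (intro sum.cong refl) (simp add: Hy)
  also have "\<dots> = (\<Sum>i<n. cnj (x i) * (w i - H $$ (i, k) * ?c)) - (\<Sum>i<n. (if i = k then cnj ?c else 0) * (w i - H $$ (i, k) * ?c))"
    unfolding sum_subtractf[symmetric] by (intro sum.cong refl) (auto simp: y_def algebra_simps)
  also have "(\<Sum>i<n. (if i = k then cnj ?c else 0) * (w i - H $$ (i, k) * ?c)) = 0"
    using k hpos by (subst sum_single_support) auto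
  also have "(\<Sum>i<n. cnj (x i) * (w i - H $$ (i, k) * ?c)) = cnj (quadratic_form n Q w) - cnj (w k) * ?c"
    unfolding xw[symmetric] xH[symmetric] sum_distrib_right sum_subtractf[symmetric]
    by (intro sum.cong refl) (simp add: algebra_simps)
  also have "cnj (w k) * ?c = of_real ((cmod (w k))\<^sup>2 / Re (H $$ (k, k)))"
    using complex_norm_square[of "w k"] by (subst real) (simp add: mult.commute)
  finally have key: "Re (quadratic_form n H y) = Re (quadratic_form n Q w) - (cmod (w k))\<^sup>2 / Re (H $$ (k, k))"
    by simp
  have nonneg: "0 \<le> Re (quadratic_form n H y)"
  proof (cases "\<exists>i<n. y i \<noteq> 0")
    case True then show ?thesis using pos' by force
  next
    case False then show ?thesis by (simp add: quadratic_form_def)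
  qed
  show "(cmod (w k))\<^sup>2 / Re (H $$ (k, k)) \<le> Re (quadratic_form n Q w)" using key nonneg by simp
  assume "Re (quadratic_form n Q w) = (cmod (w k))\<^sup>2 / Re (H $$ (k, k))" "i < n"
  then have "y i = 0" using key pos'[of i y] by fastforce
  then show "(\<Sum>j<n. Q $$ (i, j) * w j) = (if i = k then w k / H $$ (k, k) else 0)"
    by (simp add: y_def x_def)
qed

lemma index_adjoint_cyclic_mult:
  fixes H :: "complex mat" and g :: "nat \<Rightarrow> complex"
  assumes H: "H \<in> carrier_mat n n"
    and \<Phi>: "\<Phi> = Matrix.mat n n (\<lambda>(i, j). if i = Suc j mod n then g j else 0)"
    and ij: "i < n" "j < n"
  shows "(mat_adjoint \<Phi> * H) $$ (i, j) = cnj (g i) * H $$ (cyc_suc n i, j)"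
proof -
  have P: "\<Phi> \<in> carrier_mat n n" by (simp add: \<Phi>)
  have Pi: "\<Phi> $$ (l, i) = (if l = cyc_suc n i then g i else 0)" if "l < n" for l
    using that ij by (simp add: \<Phi>)
  have "(mat_adjoint \<Phi> * H) $$ (i, j) = (\<Sum>l<n. (if l = cyc_suc n i then cnj (g i) else 0) * H $$ (l, j))"
    unfolding index_mult_mat_sum[OF mat_adjoint_carrier[OF P] H ij]
    by (intro sum.cong refl) (use ij in \<open>simp add: index_mat_adjoint[OF P] Pi\<close>)
  then show ?thesis using ij by (simp add: sum_single_support)
qed

text \<open>Multiplying the bracket by \<open>H\<close> removes one inverse:
  \<open>H [\<Phi>, \<Phi>\<^sup>*] = (\<Phi>\<^sup>\<dagger> H)\<^sup>\<dagger> Q (\<Phi>\<^sup>\<dagger> H) - \<Phi>\<^sup>\<dagger> H \<Phi>\<close>, where \<open>\<dagger>\<close> is the conjugate transpose.\<close>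

lemma cyclic_bracket_diag:
  fixes H :: "complex mat" and g :: "nat \<Rightarrow> complex"
  assumes H: "H \<in> carrier_mat n n" and Q: "Q \<in> carrier_mat n n" and HQ: "H * Q = 1\<^sub>m n" and QH: "Q * H = 1\<^sub>m n"
    and herm: "mat_adjoint H = H"
    and \<Phi>: "\<Phi> = Matrix.mat n n (\<lambda>(i, j). if i = Suc j mod n then g j else 0)"
    and k: "k < n"
  shows "(H * (\<Phi> * (Q * mat_adjoint \<Phi> * H) - (Q * mat_adjoint \<Phi> * H) * \<Phi>)) $$ (k, k) =
     quadratic_form n Q (\<lambda>i. cnj (g i) * H $$ (cyc_suc n i, k))
      - of_real ((cmod (g k))\<^sup>2) * H $$ (cyc_suc n k, cyc_suc n k)"
proof -
  let ?A = "mat_adjoint \<Phi>"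
  have n: "0 < n" using k by simp
  have P: "\<Phi> \<in> carrier_mat n n" by (simp add: \<Phi>)
  have A: "?A \<in> carrier_mat n n" by (rule mat_adjoint_carrier[OF P])
  note c = H Q P A
  have Pi: "\<Phi> $$ (i, j) = (if i = cyc_suc n j then g j else 0)" if "i < n" "j < n" for i j
    using that by (simp add: \<Phi>)
  have AH: "(?A * H) $$ (i, j) = cnj (g i) * H $$ (cyc_suc n i, j)" if "i < n" "j < n" for i j
    by (rule index_adjoint_cyclic_mult[OF H \<Phi> that])
  have HP: "mat_adjoint (?A * H) = H * \<Phi>"
  proof (rule eq_matI)
    show "dim_row (mat_adjoint (?A * H)) = dim_row (H * \<Phi>)" "dim_col (mat_adjoint (?A * H)) = dim_col (H * \<Phi>)"
      using mat_adjoint_carrier[of "?A * H" n] c by auto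
    fix i j assume "i < dim_row (H * \<Phi>)" "j < dim_col (H * \<Phi>)"
    then have ij: "i < n" "j < n" using c by auto
    have "mat_adjoint (?A * H) $$ (i, j) = cnj ((?A * H) $$ (j, i))"
      by (rule index_mat_adjoint) (use c ij in auto)
    also have "\<dots> = g j * cnj (H $$ (cyc_suc n j, i))" using AH ij by simp
    also have "cnj (H $$ (cyc_suc n j, i)) = H $$ (i, cyc_suc n j)"
      using index_mat_adjoint[OF H ij(1), of "cyc_suc n j"] herm n by simp
    also have "g j * H $$ (i, cyc_suc n j) = (\<Sum>l<n. H $$ (i, l) * (if l = cyc_suc n j then g j else 0))"
      using n by (subst sum_single_support) (auto simp: mult.commute)
    also have "\<dots> = (H * \<Phi>) $$ (i, j)"
      unfolding index_mult_mat_sum[OF H P ij] by (intro sum.cong refl) (use ij in \<open>simp add: Pi\<close>)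
    finally show "mat_adjoint (?A * H) $$ (i, j) = (H * \<Phi>) $$ (i, j)" .
  qed
  have e1: "H * (\<Phi> * (Q * ?A * H)) = mat_adjoint (?A * H) * (Q * (?A * H))"
    unfolding HP using c by (simp add: assoc_mult_mat[of _ n n _ n _ n])
  have "H * (Q * ?A * H * \<Phi>) = (H * Q) * (?A * H * \<Phi>)"
    using c by (simp add: assoc_mult_mat[of _ n n _ n _ n])
  then have e2: "H * (Q * ?A * H * \<Phi>) = ?A * H * \<Phi>" using c HQ by simp
  have "H * (\<Phi> * (Q * ?A * H) - (Q * ?A * H) * \<Phi>) = H * (\<Phi> * (Q * ?A * H)) - H * ((Q * ?A * H) * \<Phi>)"
    using c by (intro mult_minus_distrib_mat[of _ n n _ n]) auto
  then have "H * (\<Phi> * (Q * ?A * H) - (Q * ?A * H) * \<Phi>) = mat_adjoint (?A * H) * (Q * (?A * H)) - ?A * H * \<Phi>"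
    by (simp only: e1 e2)
  then have "(H * (\<Phi> * (Q * ?A * H) - (Q * ?A * H) * \<Phi>)) $$ (k, k) =
     (mat_adjoint (?A * H) * (Q * (?A * H))) $$ (k, k) - (?A * H * \<Phi>) $$ (k, k)"
    using c k mat_adjoint_carrier[of "?A * H" n] by simp
  also have "(mat_adjoint (?A * H) * (Q * (?A * H))) $$ (k, k) = quadratic_form n Q (\<lambda>i. (?A * H) $$ (i, k))"
    by (rule index_congruence_diag) (use c k in auto)
  also have "\<dots> = quadratic_form n Q (\<lambda>i. cnj (g i) * H $$ (cyc_suc n i, k))"
    unfolding quadratic_form_def by (intro sum.cong refl) (use AH k in auto)
  also have "(?A * H * \<Phi>) $$ (k, k) = (\<Sum>l<n. (?A * H) $$ (k, l) * (if l = cyc_suc n k then g k else 0))"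
    by (subst index_mult_mat_sum[of _ n]) (use c k in \<open>auto intro!: sum.cong simp: Pi\<close>)
  also have "\<dots> = cnj (g k) * H $$ (cyc_suc n k, cyc_suc n k) * g k"
    using n k AH by (simp add: sum_single_support)
  also have "\<dots> = of_real ((cmod (g k))\<^sup>2) * H $$ (cyc_suc n k, cyc_suc n k)"
    unfolding complex_norm_square by (simp add: mult_ac)
  finally show ?thesis .
qed

lemma cyclic_energy_trace:
  fixes H :: "complex mat" and g :: "nat \<Rightarrow> complex"
  assumes H: "H \<in> carrier_mat n n" and Q: "Q \<in> carrier_mat n n"
    and \<Phi>: "\<Phi> = Matrix.mat n n (\<lambda>(i, j). if i = Suc j mod n then g j else 0)"
  shows "sum_list (diag_mat (\<Phi> * (Q * mat_adjoint \<Phi> * H))) =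
     (\<Sum>j<n. g j * (\<Sum>i<n. Q $$ (j, i) * (cnj (g i) * H $$ (cyc_suc n i, cyc_suc n j))))"
proof -
  let ?A = "mat_adjoint \<Phi>"
  have P: "\<Phi> \<in> carrier_mat n n" by (simp add: \<Phi>)
  have A: "?A \<in> carrier_mat n n" by (rule mat_adjoint_carrier[OF P])
  have Pi: "\<Phi> $$ (i, j) = (if i = cyc_suc n j then g j else 0)" if "i < n" "j < n" for i j
    using that by (simp add: \<Phi>)
  have AH: "(?A * H) $$ (i, j) = cnj (g i) * H $$ (cyc_suc n i, j)" if "i < n" "j < n" for i j
    by (rule index_adjoint_cyclic_mult[OF H \<Phi> that])
  have QAH: "Q * ?A * H = Q * (?A * H)" using H Q A by (simp add: assoc_mult_mat[of _ n n _ n _ n])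
  have C: "Q * ?A * H \<in> carrier_mat n n" using H Q A by simp
  have "sum_list (diag_mat (\<Phi> * (Q * ?A * H))) = (\<Sum>k<n. (\<Phi> * (Q * ?A * H)) $$ (k, k))"
    using P by (simp add: diag_mat_def interv_sum_list_conv_sum_set_nat atLeast0LessThan)
  also have "\<dots> = (\<Sum>k<n. \<Sum>j<n. \<Phi> $$ (k, j) * (Q * ?A * H) $$ (j, k))"
    by (intro sum.cong refl) (simp add: index_mult_mat_sum[OF P C])
  also have "\<dots> = (\<Sum>j<n. \<Sum>k<n. \<Phi> $$ (k, j) * (Q * ?A * H) $$ (j, k))" by (rule sum.swap)
  also have "\<dots> = (\<Sum>j<n. g j * (Q * ?A * H) $$ (j, cyc_suc n j))"
  proof (intro sum.cong refl)
    fix j assume "j \<in> {..<n}"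
    then have "(\<Sum>k<n. \<Phi> $$ (k, j) * (Q * ?A * H) $$ (j, k)) =
       (\<Sum>k<n. (if k = cyc_suc n j then g j else 0) * (Q * ?A * H) $$ (j, k))"
      by (intro sum.cong refl) (simp add: Pi)
    then show "(\<Sum>k<n. \<Phi> $$ (k, j) * (Q * ?A * H) $$ (j, k)) = g j * (Q * ?A * H) $$ (j, cyc_suc n j)"
      using \<open>j \<in> {..<n}\<close> by (simp add: sum_single_support)
  qed
  also have "\<dots> = (\<Sum>j<n. g j * (\<Sum>i<n. Q $$ (j, i) * (cnj (g i) * H $$ (cyc_suc n i, cyc_suc n j))))"
  proof (intro sum.cong refl arg_cong2[of _ _ _ _ "(*)"])
    fix j assume "j \<in> {..<n}"
    then have j: "j < n" "cyc_suc n j < n" by auto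
    have "?A * H \<in> carrier_mat n n" using A H by simp
    from index_mult_mat_sum[OF Q this j]
    show "(Q * ?A * H) $$ (j, cyc_suc n j) = (\<Sum>i<n. Q $$ (j, i) * (cnj (g i) * H $$ (cyc_suc n i, cyc_suc n j)))"
      unfolding QAH by (simp add: AH j)
  qed
  finally show ?thesis .
qed

section \<open>Wirtinger derivatives in charts\<close>

lemma wirtinger_has_derivative:
  assumes S: "closed_riemann_surface S" and z: "z \<in> coord S \<alpha> ` chart_dom S \<alpha>"
    and diff: "(\<lambda>w. f (param S \<alpha> w)) differentiable (at z)"
  shows "((\<lambda>w. f (param S \<alpha> w)) has_derivative
          (\<lambda>v. d_z S \<alpha> f (param S \<alpha> z) * v + d_zbar S \<alpha> f (param S \<alpha> z) * cnj v)) (at z)"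
proof -
  define D where "D = frechet_derivative (\<lambda>w. f (param S \<alpha> w)) (at z)"
  have D: "((\<lambda>w. f (param S \<alpha> w)) has_derivative D) (at z)"
    using diff unfolding D_def by (simp add: frechet_derivative_works)
  have lin: "linear D" using D by (rule has_derivative_linear)
  have z': "coord S \<alpha> (param S \<alpha> z) = z" by (rule coord_param[OF S z])
  have eq: "d_z S \<alpha> f (param S \<alpha> z) = (D 1 - \<i> * D \<i>) / 2" "d_zbar S \<alpha> f (param S \<alpha> z) = (D 1 + \<i> * D \<i>) / 2"
    by (simp_all add: d_z_def d_zbar_def z' D_def o_def Let_def)
  have "D v = d_z S \<alpha> f (param S \<alpha> z) * v + d_zbar S \<alpha> f (param S \<alpha> z) * cnj v" for v
  proof -
    have v: "v = Re v *\<^sub>R 1 + Im v *\<^sub>R \<i>" by (simp add: complex_eq_iff)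
    have "D v = Re v *\<^sub>R D 1 + Im v *\<^sub>R D \<i>"
      by (subst v) (simp only: linear_add[OF lin] linear_scale[OF lin])
    also have "\<dots> = (D 1 - \<i> * D \<i>) / 2 * v + (D 1 + \<i> * D \<i>) / 2 * cnj v"
      by (simp add: complex_eq_iff field_simps)
    finally show ?thesis by (simp only: eq)
  qed
  then have "D = (\<lambda>v. d_z S \<alpha> f (param S \<alpha> z) * v + d_zbar S \<alpha> f (param S \<alpha> z) * cnj v)" by (rule ext)
  with D show ?thesis by simp
qed

lemma wirtinger_eqI:
  assumes S: "closed_riemann_surface S" and z: "z \<in> coord S \<alpha> ` chart_dom S \<alpha>"
    and der: "((\<lambda>w. f (param S \<alpha> w)) has_derivative (\<lambda>v. a * v + b * cnj v)) (at z)"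
  shows "d_z S \<alpha> f (param S \<alpha> z) = a" and "d_zbar S \<alpha> f (param S \<alpha> z) = b"
proof -
  have D: "frechet_derivative (\<lambda>w. f (param S \<alpha> w)) (at z) = (\<lambda>v. a * v + b * cnj v)"
    using frechet_derivative_at[OF der] by simp
  have z': "coord S \<alpha> (param S \<alpha> z) = z" by (rule coord_param[OF S z])
  show "d_z S \<alpha> f (param S \<alpha> z) = a" "d_zbar S \<alpha> f (param S \<alpha> z) = b"
    by (simp_all add: d_z_def d_zbar_def z' o_def Let_def D algebra_simps)
qed

lemma smooth_in_chart_differentiable:
  assumes S: "closed_riemann_surface S" and z: "z \<in> coord S \<alpha> ` chart_dom S \<alpha>"
    and f: "smooth_in_chart S \<alpha> f"
  shows "(\<lambda>w. f (param S \<alpha> w)) differentiable (at z)"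
    and "(\<lambda>w. d_z S \<alpha> f (param S \<alpha> w)) differentiable (at z)"
proof -
  let ?V = "coord S \<alpha> ` chart_dom S \<alpha>"
  note V = chart_image_open[OF S, of \<alpha>]
  have C: "Ck_on (Suc (Suc 0)) ?V (\<lambda>w. f (param S \<alpha> w))"
    using f unfolding smooth_in_chart_def o_def by (rule spec)
  then have C1: "(\<lambda>w. f (param S \<alpha> w)) differentiable_on ?V"
    and C2: "\<And>v. (\<lambda>w. frechet_derivative (\<lambda>w. f (param S \<alpha> w)) (at w) v) differentiable_on ?V"
    unfolding Ck_on.simps by blast+
  have at: "g differentiable (at z)" if "g differentiable_on ?V" for g :: "complex \<Rightarrow> complex"
    using bspec[OF that[unfolded differentiable_on_def] z] by (simp only: at_within_open[OF z V])
  show "(\<lambda>w. f (param S \<alpha> w)) differentiable (at z)" by (rule at[OF C1])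
  let ?D = "\<lambda>v w. frechet_derivative (\<lambda>w. f (param S \<alpha> w)) (at w) v"
  have D: "?D v differentiable (at z)" for v by (rule at[OF C2])
  have "(\<lambda>w. (?D 1 w - \<i> * ?D \<i> w) / 2) differentiable (at z)"
    using D by (intro derivative_intros) auto
  then show "(\<lambda>w. d_z S \<alpha> f (param S \<alpha> w)) differentiable (at z)"
    unfolding differentiable_def
  proof (elim exE)
    fix F assume "((\<lambda>w. (?D 1 w - \<i> * ?D \<i> w) / 2) has_derivative F) (at z)"
    then have "((\<lambda>w. d_z S \<alpha> f (param S \<alpha> w)) has_derivative F) (at z)"
      by (rule has_derivative_transform_within_open[OF _ V z])
         (simp add: d_z_def coord_param[OF S] o_def Let_def)
    then show "\<exists>F. ((\<lambda>w. d_z S \<alpha> f (param S \<alpha> w)) has_derivative F) (at z)" by blast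
  qed
qed

lemma differentiable_prod:
  fixes f :: "'b \<Rightarrow> complex \<Rightarrow> complex"
  assumes "\<And>i. i \<in> I \<Longrightarrow> f i differentiable (at z)"
  shows "(\<lambda>w. \<Prod>i\<in>I. f i w) differentiable (at z)"
  using assms by (induction I rule: infinite_finite_induct) (auto intro: differentiable_mult)

lemma differentiable_det:
  fixes m :: "nat \<Rightarrow> nat \<Rightarrow> complex \<Rightarrow> complex"
  assumes "\<And>i j. i < n \<Longrightarrow> j < n \<Longrightarrow> m i j differentiable (at z)"
  shows "(\<lambda>w. Determinant.det (Matrix.mat n n (\<lambda>(i, j). m i j w))) differentiable (at z)"
proof -
  have "(\<lambda>w. Determinant.det (Matrix.mat n n (\<lambda>(i, j). m i j w))) =
     (\<lambda>w. \<Sum>p | p permutes {0..<n}. signof p * (\<Prod>i = 0..<n. m i (p i) w))"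
  proof
    fix w
    show "Determinant.det (Matrix.mat n n (\<lambda>(i, j). m i j w)) =
      (\<Sum>p | p permutes {0..<n}. signof p * (\<Prod>i = 0..<n. m i (p i) w))"
      by (subst det_def'[of _ n])
         (auto intro!: sum.cong prod.cong arg_cong2[of _ _ _ _ "(*)"] dest: permutes_in_image)
  qed
  moreover have "(\<lambda>w. \<Sum>p | p permutes {0..<n}. signof p * (\<Prod>i = 0..<n. m i (p i) w)) differentiable (at z)"
  proof (intro differentiable_sum ballI differentiable_mult differentiable_const differentiable_prod)
    show "finite {p. p permutes {0..<n}}" by (simp add: finite_permutations)
    fix p i assume "p \<in> {p. p permutes {0..<n}}" "i \<in> {0..<n}"
    then have "p i \<in> {0..<n}" by (simp add: permutes_in_image)
    then show "m i (p i) differentiable (at z)" using \<open>i \<in> {0..<n}\<close> by (intro assms) auto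
  qed
  ultimately show ?thesis by simp
qed

lemma differentiable_transform_open:
  assumes "f differentiable (at z)" "open V" "z \<in> V" "\<And>w. w \<in> V \<Longrightarrow> f w = g w"
  shows "g differentiable (at z)"
  using assms has_derivative_transform_within_open unfolding differentiable_def by blast

text \<open>By Cramer's rule the entries of the inverse are quotients of determinants.\<close>

lemma differentiable_mat_inv:
  fixes M :: "complex \<Rightarrow> complex mat"
  assumes V: "open V" "z \<in> V" and M: "\<And>w. w \<in> V \<Longrightarrow> M w \<in> carrier_mat n n"
    and det: "\<And>w. w \<in> V \<Longrightarrow> Determinant.det (M w) \<noteq> 0"
    and diff: "\<And>i j. i < n \<Longrightarrow> j < n \<Longrightarrow> (\<lambda>w. M w $$ (i, j)) differentiable (at z)"
    and ij: "i < n" "j < n"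
  shows "(\<lambda>w. mat_inv (M w) $$ (i, j)) differentiable (at z)"
proof -
  have Mw: "M w = Matrix.mat n n (\<lambda>(i, j). M w $$ (i, j))" if "w \<in> V" for w
    using M[OF that] by (auto intro!: eq_matI)
  let ?\<sigma> = "\<lambda>a. if a < j then a else Suc a" and ?\<tau> = "\<lambda>b. if b < i then b else Suc b"
  let ?d = "\<lambda>w. Determinant.det (Matrix.mat n n (\<lambda>(i, j). M w $$ (i, j)))"
  let ?c = "\<lambda>w. Determinant.det (Matrix.mat (n - 1) (n - 1) (\<lambda>(a, b). M w $$ (?\<sigma> a, ?\<tau> b)))"
  have "?d differentiable (at z)" by (intro differentiable_det diff)
  moreover have "?c differentiable (at z)" by (intro differentiable_det diff) (use ij in auto)
  moreover have "?d z \<noteq> 0" using det[OF V(2)] Mw[OF V(2)] by simp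
  ultimately have "(\<lambda>w. inverse (?d w) * ((-1) ^ (j + i) * ?c w)) differentiable (at z)"
    by (intro differentiable_mult differentiable_inverse differentiable_const)
  then show ?thesis
  proof (rule differentiable_transform_open[OF _ V])
    fix w assume w: "w \<in> V"
    have d: "dim_row (M w) = n" "dim_col (M w) = n" using M[OF w] by auto
    have "mat_inv (M w) $$ (i, j) = inverse (Determinant.det (M w)) * adj_mat (M w) $$ (i, j)"
      using mat_inv_facts(4)[OF M[OF w] det[OF w]] adj_mat(1)[OF M[OF w]] ij by simp
    also have "adj_mat (M w) $$ (i, j) = (-1) ^ (j + i) * Determinant.det (mat_delete (M w) j i)"
      using ij d by (simp add: adj_mat_def cofactor_def)
    also have "mat_delete (M w) j i = Matrix.mat (n - 1) (n - 1) (\<lambda>(a, b). M w $$ (?\<sigma> a, ?\<tau> b))"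
      by (simp add: mat_delete_def d)
    also have "Determinant.det (M w) = ?d w" using Mw[OF w] by simp
    finally show "inverse (?d w) * ((-1) ^ (j + i) * ?c w) = mat_inv (M w) $$ (i, j)" by simp
  qed
qed

lemma has_derivative_wirtinger_mult:
  assumes "(f has_derivative (\<lambda>v. a * v + b * cnj v)) (at z)" "(g has_derivative (\<lambda>v. c * v + d * cnj v)) (at z)"
  shows "((\<lambda>w. f w * g w) has_derivative (\<lambda>v. (a * g z + f z * c) * v + (b * g z + f z * d) * cnj v)) (at z)"
  by (rule has_derivative_eq_rhs[OF has_derivative_mult[OF assms]]) (simp add: fun_eq_iff algebra_simps)

lemma has_derivative_wirtinger_sum:
  assumes "\<And>i. i \<in> I \<Longrightarrow> (f i has_derivative (\<lambda>v. a i * v + b i * cnj v)) (at z)"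
  shows "((\<lambda>w. \<Sum>i\<in>I. f i w) has_derivative (\<lambda>v. (\<Sum>i\<in>I. a i) * v + (\<Sum>i\<in>I. b i) * cnj v)) (at z)"
  by (rule has_derivative_eq_rhs[OF has_derivative_sum[OF assms]])
     (simp_all add: fun_eq_iff sum.distrib sum_distrib_right)

section \<open>The diagonal of the Hitchin equation\<close>

definition metric_diag :: "('i, 'a) mat_family \<Rightarrow> nat \<Rightarrow> 'i \<Rightarrow> 'a \<Rightarrow> real" where
  "metric_diag H k \<alpha> p = Re (H \<alpha> p $$ (k, k))"

definition toda_term ::
    "nat \<Rightarrow> (nat \<Rightarrow> 'i \<Rightarrow> 'a \<Rightarrow> complex) \<Rightarrow> ('i, 'a) mat_family \<Rightarrow> nat \<Rightarrow> 'i \<Rightarrow> 'a \<Rightarrow> real" where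
  "toda_term n \<gamma> H k \<alpha> p = (cmod (\<gamma> k \<alpha> p))\<^sup>2 * metric_diag H (Suc k mod n) \<alpha> p / metric_diag H k \<alpha> p"

lemma harmonic_metric_pointwise:
  assumes hm: "harmonic_metric S n G \<tau> \<Phi> H" and p: "p \<in> chart_dom S \<alpha>"
  shows "H \<alpha> p \<in> carrier_mat n n" "mat_adjoint (H \<alpha> p) = H \<alpha> p"
    "v \<in> carrier_vec n \<Longrightarrow> v \<noteq> 0\<^sub>v n \<Longrightarrow> 0 < Re ((H \<alpha> p *\<^sub>v v) \<bullet>c v)"
    "Determinant.det (H \<alpha> p) \<noteq> 0"
    "chern_curvature S n H \<alpha> p + higgs_bracket (H \<alpha> p) (\<Phi> \<alpha> p) = 0\<^sub>m n n"
    "i < n \<Longrightarrow> j < n \<Longrightarrow> smooth_in_chart S \<alpha> (\<lambda>p. H \<alpha> p $$ (i, j))"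
proof -
  have herm: "hermitian_metric S n G H"
    and det: "Determinant.det (H \<alpha> p) * complex_of_real ((cmod (\<tau> \<alpha> p))\<^sup>2) = 1"
    and curv: "chern_curvature S n H \<alpha> p + higgs_bracket (H \<alpha> p) (\<Phi> \<alpha> p) = 0\<^sub>m n n"
    using hm p unfolding harmonic_metric_def by blast+
  show "H \<alpha> p \<in> carrier_mat n n" "mat_adjoint (H \<alpha> p) = H \<alpha> p"
    "v \<in> carrier_vec n \<Longrightarrow> v \<noteq> 0\<^sub>v n \<Longrightarrow> 0 < Re ((H \<alpha> p *\<^sub>v v) \<bullet>c v)"
    "i < n \<Longrightarrow> j < n \<Longrightarrow> smooth_in_chart S \<alpha> (\<lambda>p. H \<alpha> p $$ (i, j))"
    using herm p unfolding hermitian_metric_def by blast+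
  show "Determinant.det (H \<alpha> p) \<noteq> 0" using det by auto
  show "chern_curvature S n H \<alpha> p + higgs_bracket (H \<alpha> p) (\<Phi> \<alpha> p) = 0\<^sub>m n n" by (rule curv)
qed

lemma metric_diag_facts:
  assumes hm: "harmonic_metric S n G \<tau> \<Phi> H" and p: "p \<in> chart_dom S \<alpha>" and k: "k < n"
  shows "H \<alpha> p $$ (k, k) = complex_of_real (metric_diag H k \<alpha> p)" and "0 < metric_diag H k \<alpha> p"
proof -
  note H = harmonic_metric_pointwise[OF hm p]
  note Q = mat_inv_facts[OF H(1) H(4)]
  show "H \<alpha> p $$ (k, k) = complex_of_real (metric_diag H k \<alpha> p)" "0 < metric_diag H k \<alpha> p"
    unfolding metric_diag_def
    by (rule inverse_form_cauchy_schwarz(1,2)[OF H(1) Q(1,2) H(2,3) k]; assumption)+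
qed

text \<open>With \<open>A = H\<inverse> \<partial>H\<close> the Hitchin equation reads \<open>dbar A = [\<Phi>, \<Phi>\<^sup>*]\<close>. Differentiating
  \<open>H A = \<partial>H\<close> gives \<open>dbar \<partial>H = (\<partial>H)\<^sup>\<dagger> H\<inverse> \<partial>H + H [\<Phi>, \<Phi>\<^sup>*]\<close>, and the first term dominates
  \<open>|\<partial>H\<^sub>k\<^sub>k|\<^sup>2 / H\<^sub>k\<^sub>k\<close> by Cauchy--Schwarz, which is what the logarithm subtracts.\<close>

lemma hitchin_diagonal_laplacian:
  assumes S: "closed_riemann_surface S" and hm: "harmonic_metric S n G \<tau> (cyclic_field n \<gamma>) H" and k: "k < n"
  obtains l where "has_laplacian (coord S \<alpha> ` chart_dom S \<alpha>) (\<lambda>z. ln (metric_diag H k \<alpha> (param S \<alpha> z))) l"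
    and "\<And>p. p \<in> chart_dom S \<alpha> \<Longrightarrow>
        Re (quadratic_form n (mat_inv (H \<alpha> p)) (\<lambda>i. cnj (\<gamma> i \<alpha> p) * H \<alpha> p $$ (cyc_suc n i, k))) / metric_diag H k \<alpha> p
          - toda_term n \<gamma> H k \<alpha> p \<le> l (coord S \<alpha> p)"
proof -
  let ?V = "coord S \<alpha> ` chart_dom S \<alpha>"
  note V = chart_image_open[OF S, of \<alpha>]
  define h where "h i j w = H \<alpha> (param S \<alpha> w) $$ (i, j)" for i j w
  define P where "P i j w = d_z S \<alpha> (\<lambda>q. H \<alpha> q $$ (i, j)) (param S \<alpha> w)" for i j w
  define Pb where "Pb i j w = d_zbar S \<alpha> (\<lambda>q. H \<alpha> q $$ (i, j)) (param S \<alpha> w)" for i j w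
  define Q where "Q w = mat_inv (H \<alpha> (param S \<alpha> w))" for w
  define PM where "PM w = entrywise (d_z S \<alpha>) n (H \<alpha>) (param S \<alpha> w)" for w
  define A where "A = (\<lambda>q. mat_inv (H \<alpha> q) * entrywise (d_z S \<alpha>) n (H \<alpha>) q)"
  define R where "R w = quadratic_form n (Q w) (\<lambda>i. P i k w) +
      (H \<alpha> (param S \<alpha> w) * higgs_bracket (H \<alpha> (param S \<alpha> w)) (cyclic_field n \<gamma> \<alpha> (param S \<alpha> w))) $$ (k, k)" for w
  have pw: "param S \<alpha> w \<in> chart_dom S \<alpha>" if "w \<in> ?V" for w by (rule param_in_chart[OF S that])
  note HP = harmonic_metric_pointwise[OF hm pw]
  have QP: "Q w \<in> carrier_mat n n" "H \<alpha> (param S \<alpha> w) * Q w = 1\<^sub>m n" "Q w * H \<alpha> (param S \<alpha> w) = 1\<^sub>m n" if "w \<in> ?V" for w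
    unfolding Q_def using mat_inv_facts[OF HP(1)[OF that] HP(4)[OF that]] by auto
  have PM: "PM w \<in> carrier_mat n n" "i < n \<Longrightarrow> j < n \<Longrightarrow> PM w $$ (i, j) = P i j w" for w i j
    by (auto simp: PM_def entrywise_def P_def)
  have smooth: "smooth_in_chart S \<alpha> (\<lambda>q. H \<alpha> q $$ (i, j))" if "i < n" "j < n" "z \<in> ?V" for i j z
    using HP(6)[OF that(3,1,2)] .
  have dh: "(h i j has_derivative (\<lambda>v. P i j z * v + Pb i j z * cnj v)) (at z)" if "i < n" "j < n" "z \<in> ?V" for i j z
    unfolding h_def P_def Pb_def
    by (rule wirtinger_has_derivative[OF S that(3) smooth_in_chart_differentiable(1)[OF S that(3) smooth[OF that]]])
  have dP: "P i j differentiable (at z)" if "i < n" "j < n" "z \<in> ?V" for i j z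
    unfolding P_def by (rule smooth_in_chart_differentiable(2)[OF S that(3) smooth[OF that]])
  have herm: "h i j w = cnj (h j i w)" if "i < n" "j < n" "w \<in> ?V" for i j w
    using index_mat_adjoint[OF HP(1)[OF that(3)] that(1,2)] HP(2)[OF that(3)] by (simp add: h_def)
  have Pb: "Pb i j z = cnj (P j i z)" if "i < n" "j < n" "z \<in> ?V" for i j z
  proof -
    have "((\<lambda>w. cnj (h j i w)) has_derivative (\<lambda>v. cnj (P j i z * v + Pb j i z * cnj v))) (at z)"
      by (intro derivative_intros dh that)
    then have "(h i j has_derivative (\<lambda>v. cnj (P j i z * v + Pb j i z * cnj v))) (at z)"
      by (rule has_derivative_transform_within_open[OF _ V that(3)]) (rule herm[OF that(1,2), symmetric])
    then have "(h i j has_derivative (\<lambda>v. cnj (Pb j i z) * v + cnj (P j i z) * cnj v)) (at z)"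
      by (rule has_derivative_eq_rhs) (simp add: fun_eq_iff)
    from wirtinger_eqI(2)[OF S that(3) this[unfolded h_def]] show ?thesis by (simp add: Pb_def)
  qed
  have AP: "A (param S \<alpha> w) $$ (j, m) = (\<Sum>l<n. Q w $$ (j, l) * P l m w)" if "j < n" "m < n" "w \<in> ?V" for j m w
    using index_mult_mat_sum[OF QP(1)[OF that(3)] PM(1) that(1,2)] PM(2) that
    by (simp add: A_def Q_def PM_def)
  have dA: "((\<lambda>w. A (param S \<alpha> w) $$ (j, m)) has_derivative
      (\<lambda>v. d_z S \<alpha> (\<lambda>q. A q $$ (j, m)) (param S \<alpha> z) * v + d_zbar S \<alpha> (\<lambda>q. A q $$ (j, m)) (param S \<alpha> z) * cnj v)) (at z)"
    if jm: "j < n" "m < n" and z: "z \<in> ?V" for j m z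
  proof (rule wirtinger_has_derivative[OF S z])
    have "(\<lambda>w. Q w $$ (j, l)) differentiable (at z)" if "l < n" for l
      unfolding Q_def
    proof (rule differentiable_mat_inv[OF V z _ _ _ jm(1) that])
      show "(\<lambda>w. H \<alpha> (param S \<alpha> w) $$ (i, j)) differentiable (at z)" if "i < n" "j < n" for i j
        using dh[OF that z] unfolding h_def differentiable_def by blast
    qed (use HP in auto)
    then have "(\<lambda>w. \<Sum>l<n. Q w $$ (j, l) * P l m w) differentiable (at z)"
      by (intro differentiable_sum ballI differentiable_mult dP jm z) auto
    then show "(\<lambda>w. A (param S \<alpha> w) $$ (j, m)) differentiable (at z)"
      by (rule differentiable_transform_open[OF _ V z]) (simp add: AP jm)
  qed
  have curv: "d_zbar S \<alpha> (\<lambda>q. A q $$ (j, m)) (param S \<alpha> z) =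
      higgs_bracket (H \<alpha> (param S \<alpha> z)) (cyclic_field n \<gamma> \<alpha> (param S \<alpha> z)) $$ (j, m)"
    if jm: "j < n" "m < n" and z: "z \<in> ?V" for j m z
  proof -
    let ?B = "higgs_bracket (H \<alpha> (param S \<alpha> z)) (cyclic_field n \<gamma> \<alpha> (param S \<alpha> z))"
    have F: "cyclic_field n \<gamma> \<alpha> (param S \<alpha> z) \<in> carrier_mat n n" by (simp add: cyclic_field_def)
    have B: "?B \<in> carrier_mat n n"
      unfolding higgs_bracket_def h_adjoint_def
      using F mat_adjoint_carrier[OF F] HP(1)[OF z] QP(1)[OF z] by (auto simp: Q_def)
    have "(chern_curvature S n H \<alpha> (param S \<alpha> z) + ?B) $$ (j, m) = 0" using HP(5)[OF z] jm by simp
    moreover have "chern_curvature S n H \<alpha> (param S \<alpha> z) $$ (j, m) = - d_zbar S \<alpha> (\<lambda>q. A q $$ (j, m)) (param S \<alpha> z)"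
      using jm by (simp add: chern_curvature_def A_def entrywise_def[of "d_zbar S \<alpha>"])
    ultimately show ?thesis using B jm by simp
  qed
  have PHA: "P k k w = (\<Sum>j<n. h k j w * A (param S \<alpha> w) $$ (j, k))" if w: "w \<in> ?V" for w
  proof -
    have "H \<alpha> (param S \<alpha> w) * (Q w * PM w) = (H \<alpha> (param S \<alpha> w) * Q w) * PM w"
      by (rule assoc_mult_mat[symmetric, of _ n n _ n _ n]) (use HP(1)[OF w] QP(1)[OF w] PM(1) in auto)
    also have "\<dots> = PM w" using QP(2)[OF w] left_mult_one_mat[OF PM(1)] by simp
    finally have "P k k w = (H \<alpha> (param S \<alpha> w) * (Q w * PM w)) $$ (k, k)" using PM(2)[OF k k] by simp
    also have "\<dots> = (\<Sum>j<n. h k j w * (Q w * PM w) $$ (j, k))"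
      unfolding h_def by (rule index_mult_mat_sum[OF HP(1)[OF w] _ k k]) (use QP(1)[OF w] PM(1) in auto)
    finally show ?thesis by (simp add: A_def Q_def PM_def)
  qed
  have dPkk: "\<exists>c. (P k k has_derivative (\<lambda>v. c * v + R z * cnj v)) (at z)" if z: "z \<in> ?V" for z
  proof -
    let ?B = "\<lambda>j. d_zbar S \<alpha> (\<lambda>q. A q $$ (j, k)) (param S \<alpha> z)"
    let ?c = "\<Sum>j<n. P k j z * A (param S \<alpha> z) $$ (j, k) + h k j z * d_z S \<alpha> (\<lambda>q. A q $$ (j, k)) (param S \<alpha> z)"
    have "((\<lambda>w. \<Sum>j<n. h k j w * A (param S \<alpha> w) $$ (j, k)) has_derivative
       (\<lambda>v. ?c * v + (\<Sum>j<n. Pb k j z * A (param S \<alpha> z) $$ (j, k) + h k j z * ?B j) * cnj v)) (at z)"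
      by (intro has_derivative_wirtinger_sum has_derivative_wirtinger_mult dh dA k z) auto
    then have "(P k k has_derivative
       (\<lambda>v. ?c * v + (\<Sum>j<n. Pb k j z * A (param S \<alpha> z) $$ (j, k) + h k j z * ?B j) * cnj v)) (at z)"
      by (rule has_derivative_transform_within_open[OF _ V z]) (simp add: PHA)
    moreover have "(\<Sum>j<n. Pb k j z * A (param S \<alpha> z) $$ (j, k) + h k j z * ?B j) = R z"
    proof -
      have "(\<Sum>j<n. Pb k j z * A (param S \<alpha> z) $$ (j, k)) = quadratic_form n (Q z) (\<lambda>i. P i k z)"
        unfolding quadratic_form_def
        by (intro sum.cong refl) (simp add: Pb AP k z sum_distrib_left mult.assoc)
      moreover have "(\<Sum>j<n. h k j z * ?B j) =
         (H \<alpha> (param S \<alpha> z) * higgs_bracket (H \<alpha> (param S \<alpha> z)) (cyclic_field n \<gamma> \<alpha> (param S \<alpha> z))) $$ (k, k)"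
      proof (subst index_mult_mat_sum[OF HP(1)[OF z] _ k k])
        have F: "cyclic_field n \<gamma> \<alpha> (param S \<alpha> z) \<in> carrier_mat n n" by (simp add: cyclic_field_def)
        show "higgs_bracket (H \<alpha> (param S \<alpha> z)) (cyclic_field n \<gamma> \<alpha> (param S \<alpha> z)) \<in> carrier_mat n n"
          unfolding higgs_bracket_def h_adjoint_def
          using F mat_adjoint_carrier[OF F] HP(1)[OF z] QP(1)[OF z] by (auto simp: Q_def)
      qed (simp add: h_def curv k z)
      ultimately show ?thesis by (simp add: R_def sum.distrib)
    qed
    ultimately show ?thesis by auto
  qed
  then obtain c where c: "\<And>z. z \<in> ?V \<Longrightarrow> (P k k has_derivative (\<lambda>v. c z * v + R z * cnj v)) (at z)" by metis
  have hkk: "h k k w = of_real (metric_diag H k \<alpha> (param S \<alpha> w))" "0 < metric_diag H k \<alpha> (param S \<alpha> w)"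
    if "w \<in> ?V" for w
    using metric_diag_facts[OF hm pw[OF that] k] by (auto simp: h_def)
  define l where "l z = Re (R z / h k k z - P k k z * Pb k k z / (h k k z)\<^sup>2)" for z
  have "has_laplacian ?V (\<lambda>z. ln (metric_diag H k \<alpha> (param S \<alpha> z))) l"
  proof (rule has_laplacianI[where a = "\<lambda>z. P k k z / h k k z"
        and c = "\<lambda>z. c z / h k k z - P k k z * P k k z / (h k k z)\<^sup>2"
        and q = "\<lambda>z. R z / h k k z - P k k z * Pb k k z / (h k k z)\<^sup>2"])
    fix z assume z: "z \<in> ?V"
    note hz = hkk[OF z]
    have nz: "h k k z \<noteq> 0" using hz by simp
    have "((\<lambda>w. ln (Re (h k k w))) has_derivative (\<lambda>v. Re (P k k z * v + Pb k k z * cnj v) / Re (h k k z))) (at z)"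
      using dh[OF k k z] hz by (auto intro!: derivative_eq_intros simp: fun_eq_iff divide_inverse)
    moreover have "Re (P k k z * v + Pb k k z * cnj v) / Re (h k k z) = 2 * Re (P k k z / h k k z * v)" for v
    proof -
      have "P k k z / h k k z * v = P k k z * v / of_real (metric_diag H k \<alpha> (param S \<alpha> z))" using hz(1) by simp
      then have "Re (P k k z / h k k z * v) = Re (P k k z * v) / Re (h k k z)" by (simp only: Re_divide_of_real hz(1) Re_complex_of_real)
      moreover have "Re (Pb k k z * cnj v) = Re (P k k z * v)" by (simp add: Pb[OF k k z])
      ultimately show ?thesis by (simp add: add_divide_distrib)
    qed
    ultimately show "((\<lambda>z. ln (metric_diag H k \<alpha> (param S \<alpha> z))) has_derivative (\<lambda>v. 2 * Re (P k k z / h k k z * v))) (at z)"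
      by (simp add: metric_diag_def h_def)
    show "((\<lambda>z. P k k z / h k k z) has_derivative
       (\<lambda>v. (c z / h k k z - P k k z * P k k z / (h k k z)\<^sup>2) * v +
         (R z / h k k z - P k k z * Pb k k z / (h k k z)\<^sup>2) * cnj v)) (at z)"
      by (rule has_derivative_eq_rhs[OF has_derivative_divide'[OF c[OF z] dh[OF k k z] nz]])
         (use nz in \<open>auto simp: fun_eq_iff field_simps power2_eq_square\<close>)
  qed (simp add: l_def)
  moreover have "Re (quadratic_form n (mat_inv (H \<alpha> p)) (\<lambda>i. cnj (\<gamma> i \<alpha> p) * H \<alpha> p $$ (cyc_suc n i, k))) / metric_diag H k \<alpha> p
          - toda_term n \<gamma> H k \<alpha> p \<le> l (coord S \<alpha> p)" if p: "p \<in> chart_dom S \<alpha>" for p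
  proof -
    let ?z = "coord S \<alpha> p"
    have z: "?z \<in> ?V" and pz: "param S \<alpha> ?z = p" using p param_coord[OF S p] by auto
    let ?h = "metric_diag H k \<alpha> p"
    let ?X = "quadratic_form n (Q ?z) (\<lambda>i. P i k ?z)"
    let ?Y = "quadratic_form n (mat_inv (H \<alpha> p)) (\<lambda>i. cnj (\<gamma> i \<alpha> p) * H \<alpha> p $$ (cyc_suc n i, k))"
    have hp: "h k k ?z = of_real ?h" "0 < ?h" using hkk[OF z] pz by auto
    note H = harmonic_metric_pointwise[OF hm p]
    note Qp = mat_inv_facts[OF H(1) H(4)]
    have "(cmod (P k k ?z))\<^sup>2 / ?h \<le> Re ?X"
      unfolding Q_def pz metric_diag_def
      by (rule inverse_form_cauchy_schwarz(3)[OF H(1) Qp(1,2) H(2,3) k]) assumption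
    then have X: "0 \<le> Re ?X / ?h - (cmod (P k k ?z))\<^sup>2 / ?h\<^sup>2"
      using hp(2) by (simp add: power2_eq_square field_simps)
    have "(H \<alpha> p * higgs_bracket (H \<alpha> p) (cyclic_field n \<gamma> \<alpha> p)) $$ (k, k) =
       ?Y - of_real ((cmod (\<gamma> k \<alpha> p))\<^sup>2) * H \<alpha> p $$ (cyc_suc n k, cyc_suc n k)"
      unfolding higgs_bracket_def h_adjoint_def
      by (rule cyclic_bracket_diag[OF H(1) Qp(1,2,3) H(2) _ k]) (simp add: cyclic_field_def)
    then have "R ?z = ?X + ?Y - of_real ((cmod (\<gamma> k \<alpha> p))\<^sup>2) * H \<alpha> p $$ (cyc_suc n k, cyc_suc n k)"
      by (simp add: R_def pz)
    moreover have "H \<alpha> p $$ (cyc_suc n k, cyc_suc n k) = of_real (metric_diag H (cyc_suc n k) \<alpha> p)"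
      using k by (intro metric_diag_facts[OF hm p]) auto
    ultimately have "Re (R ?z) = Re ?X + Re ?Y - (cmod (\<gamma> k \<alpha> p))\<^sup>2 * metric_diag H (cyc_suc n k) \<alpha> p"
      by simp
    moreover have "Re (R ?z / h k k ?z) = Re (R ?z) / ?h" by (simp only: hp Re_divide_of_real)
    moreover have "P k k ?z * Pb k k ?z / (h k k ?z)\<^sup>2 = of_real ((cmod (P k k ?z))\<^sup>2 / ?h\<^sup>2)"
      unfolding Pb[OF k k z] hp(1) by (simp add: complex_norm_square[symmetric])
    ultimately have "l ?z = (Re ?X + Re ?Y - (cmod (\<gamma> k \<alpha> p))\<^sup>2 * metric_diag H (cyc_suc n k) \<alpha> p) / ?h - (cmod (P k k ?z))\<^sup>2 / ?h\<^sup>2"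
      by (simp add: l_def)
    then show ?thesis using X by (simp add: toda_term_def add_divide_distrib diff_divide_distrib)
  qed
  ultimately show ?thesis by (rule that)
qed

section \<open>The Toda system for harmonic metrics\<close>

lemma glue_charts:
  assumes S: "closed_riemann_surface S"
    and "\<And>\<alpha> \<beta> p. p \<in> chart_dom S \<alpha> \<Longrightarrow> p \<in> chart_dom S \<beta> \<Longrightarrow> F \<alpha> p = F \<beta> p"
  obtains u where "\<And>\<alpha> p. p \<in> chart_dom S \<alpha> \<Longrightarrow> u p = F \<alpha> p"
proof (rule that)
  fix \<alpha> p assume "p \<in> chart_dom S \<alpha>"
  moreover from this have "p \<in> chart_dom S (SOME \<beta>. p \<in> chart_dom S \<beta>)" by (rule someI)
  ultimately show "F (SOME \<beta>. p \<in> chart_dom S \<beta>) p = F \<alpha> p" by (intro assms(2))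
qed

lemma metric_diag_transition:
  assumes hm: "harmonic_metric S n (direct_sum n L) \<tau> \<Phi> H"
    and p: "p \<in> chart_dom S \<alpha>" "p \<in> chart_dom S \<beta>" and k: "k < n"
  shows "metric_diag H k \<beta> p = (cmod (L k \<alpha> \<beta> p))\<^sup>2 * metric_diag H k \<alpha> p"
proof -
  let ?G = "direct_sum n L \<alpha> \<beta> p"
  have G: "?G \<in> carrier_mat n n" "\<And>i j. i < n \<Longrightarrow> j < n \<Longrightarrow> ?G $$ (i, j) = (if i = j then L i \<alpha> \<beta> p else 0)"
    by (auto simp: direct_sum_def)
  have H: "H \<alpha> p \<in> carrier_mat n n" by (rule harmonic_metric_pointwise(1)[OF hm p(1)])
  have "H \<beta> p = mat_adjoint ?G * H \<alpha> p * ?G"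
    using hm p unfolding harmonic_metric_def hermitian_metric_def by blast
  also have "\<dots> = mat_adjoint ?G * (H \<alpha> p * ?G)"
    by (rule assoc_mult_mat[of _ n n _ n _ n]) (use H G mat_adjoint_carrier[OF G(1)] in auto)
  finally have "H \<beta> p $$ (k, k) = quadratic_form n (H \<alpha> p) (\<lambda>i. ?G $$ (i, k))"
    using index_congruence_diag[OF G(1) H k] by simp
  also have "\<dots> = (\<Sum>i<n. \<Sum>j<n. (if i = k then cnj (L k \<alpha> \<beta> p) else 0) * (H \<alpha> p $$ (i, j) * (if j = k then L k \<alpha> \<beta> p else 0)))"
    unfolding quadratic_form_def by (intro sum.cong refl) (use G(2) k in auto)
  also have "\<dots> = cnj (L k \<alpha> \<beta> p) * (H \<alpha> p $$ (k, k) * L k \<alpha> \<beta> p)"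
    using k by (simp only: sum_distrib_left[symmetric] sum_single_support)
  also have "\<dots> = of_real ((cmod (L k \<alpha> \<beta> p))\<^sup>2) * of_real (metric_diag H k \<alpha> p)"
    unfolding metric_diag_facts(1)[OF hm p(1) k] complex_norm_square by (simp add: mult_ac)
  finally show ?thesis unfolding metric_diag_def[of H k \<beta>] by (simp add: metric_diag_def)
qed

lemma det_direct_sum: "Determinant.det (direct_sum n L \<alpha> \<beta> p) = (\<Prod>k<n. L k \<alpha> \<beta> p)"
proof -
  have "upper_triangular (direct_sum n L \<alpha> \<beta> p)" by (auto simp: direct_sum_def upper_triangular_def)
  then have "Determinant.det (direct_sum n L \<alpha> \<beta> p) = prod_list (diag_mat (direct_sum n L \<alpha> \<beta> p))"
    by (rule det_upper_triangular[of _ n]) (simp add: direct_sum_def)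
  also have "\<dots> = (\<Prod>k<n. L k \<alpha> \<beta> p)"
    by (simp add: prod_list_diag_prod direct_sum_def atLeast0LessThan)
  finally show ?thesis .
qed

text \<open>The second use of Cauchy--Schwarz, against the column with index \<open>j\<close>. In the equality case the
  adjoint of the Higgs field maps the summand \<open>j + 1\<close> into the summand \<open>j\<close>, which makes the
  corresponding term of the energy equal to the Toda term.\<close>

lemma toda_term_le_quadratic_form:
  assumes hm: "harmonic_metric S n G \<tau> (cyclic_field n \<gamma>) H" and p: "p \<in> chart_dom S \<alpha>" and j: "j < n"
  defines "y \<equiv> \<lambda>i. cnj (\<gamma> i \<alpha> p) * H \<alpha> p $$ (cyc_suc n i, cyc_suc n j)"
  shows "toda_term n \<gamma> H j \<alpha> p \<le> Re (quadratic_form n (mat_inv (H \<alpha> p)) y) / metric_diag H (cyc_suc n j) \<alpha> p"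
    and "Re (quadratic_form n (mat_inv (H \<alpha> p)) y) / metric_diag H (cyc_suc n j) \<alpha> p = toda_term n \<gamma> H j \<alpha> p \<Longrightarrow>
      \<gamma> j \<alpha> p * (\<Sum>i<n. mat_inv (H \<alpha> p) $$ (j, i) * y i) = of_real (toda_term n \<gamma> H j \<alpha> p)"
proof -
  let ?k = "cyc_suc n j"
  let ?h = "metric_diag H ?k \<alpha> p" and ?h' = "metric_diag H j \<alpha> p"
  have k: "?k < n" using j by auto
  note H = harmonic_metric_pointwise[OF hm p]
  note Q = mat_inv_facts[OF H(1) H(4)]
  note hk = metric_diag_facts[OF hm p k] and hj = metric_diag_facts[OF hm p j]
  have yj: "y j = cnj (\<gamma> j \<alpha> p) * of_real ?h" by (simp add: y_def hk(1))
  have yj2: "(cmod (y j))\<^sup>2 = (cmod (\<gamma> j \<alpha> p))\<^sup>2 * ?h\<^sup>2" by (simp add: yj norm_mult power_mult_distrib)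
  have "(cmod (y j))\<^sup>2 / Re (H \<alpha> p $$ (j, j)) \<le> Re (quadratic_form n (mat_inv (H \<alpha> p)) y)"
    by (rule inverse_form_cauchy_schwarz(3)[OF H(1) Q(1,2) H(2,3) j]) assumption
  then have "(cmod (\<gamma> j \<alpha> p))\<^sup>2 * ?h\<^sup>2 / ?h' / ?h \<le> Re (quadratic_form n (mat_inv (H \<alpha> p)) y) / ?h"
    using hk(2) by (intro divide_right_mono) (auto simp: yj2 metric_diag_def)
  moreover have T: "(cmod (\<gamma> j \<alpha> p))\<^sup>2 * ?h\<^sup>2 / ?h' / ?h = toda_term n \<gamma> H j \<alpha> p"
    using hk(2) by (simp add: toda_term_def power2_eq_square)
  ultimately show "toda_term n \<gamma> H j \<alpha> p \<le> Re (quadratic_form n (mat_inv (H \<alpha> p)) y) / ?h" by simp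
  assume "Re (quadratic_form n (mat_inv (H \<alpha> p)) y) / ?h = toda_term n \<gamma> H j \<alpha> p"
  then have "Re (quadratic_form n (mat_inv (H \<alpha> p)) y) = (cmod (y j))\<^sup>2 / Re (H \<alpha> p $$ (j, j))"
    unfolding T[symmetric] yj2 metric_diag_def[of H j, symmetric] divide_cancel_right using hk(2) by simp
  from inverse_form_cauchy_schwarz(4)[OF H(1) Q(1,2) H(2,3) j this j]
  have "(\<Sum>i<n. mat_inv (H \<alpha> p) $$ (j, i) * y i) = y j / H \<alpha> p $$ (j, j)" by simp
  then have "\<gamma> j \<alpha> p * (\<Sum>i<n. mat_inv (H \<alpha> p) $$ (j, i) * y i) = \<gamma> j \<alpha> p * cnj (\<gamma> j \<alpha> p) * of_real ?h / of_real ?h'"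
    by (simp add: yj hj(1) mult.assoc)
  also have "\<dots> = of_real (toda_term n \<gamma> H j \<alpha> p)"
    unfolding complex_norm_square[symmetric] toda_term_def by simp
  finally show "\<gamma> j \<alpha> p * (\<Sum>i<n. mat_inv (H \<alpha> p) $$ (j, i) * y i) = of_real (toda_term n \<gamma> H j \<alpha> p)" .
qed

text \<open>The function \<open>\<Sum> ln h\<^sub>k + ln |\<tau>|\<^sup>2\<close>, equal to \<open>\<Sum> ln h\<^sub>k - ln det H\<close>, is global since the
  transition functions of the \<open>h\<^sub>k\<close> and of \<open>\<tau>\<close> cancel. It is subharmonic, hence constant, and its
  Laplacian is a sum of nonnegative defects, which therefore all vanish.\<close>

theorem toda_system:
  fixes S :: "('i, 'a::t2_space) surface"
  assumes S: "closed_riemann_surface S" and \<tau>: "det_trivialization S (direct_sum n L) \<tau>"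
    and hm: "harmonic_metric S n (direct_sum n L) \<tau> (cyclic_field n \<gamma>) H"
  shows "k < n \<Longrightarrow> has_laplacian (coord S \<alpha> ` chart_dom S \<alpha>) (\<lambda>z. ln (metric_diag H k \<alpha> (param S \<alpha> z)))
           (\<lambda>z. toda_term n \<gamma> H (cyc_pred n k) \<alpha> (param S \<alpha> z) - toda_term n \<gamma> H k \<alpha> (param S \<alpha> z))"
    and "p \<in> chart_dom S \<alpha> \<Longrightarrow> higgs_energy H (cyclic_field n \<gamma>) \<alpha> p = (\<Sum>j<n. toda_term n \<gamma> H j \<alpha> p)"
proof -
  let ?V = "\<lambda>\<alpha>. coord S \<alpha> ` chart_dom S \<alpha>"
  let ?h = "\<lambda>k \<alpha> p. metric_diag H k \<alpha> p" and ?a = "\<lambda>k \<alpha> p. toda_term n \<gamma> H k \<alpha> p"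
  define X where "X k \<alpha> p = Re (quadratic_form n (mat_inv (H \<alpha> p)) (\<lambda>i. cnj (\<gamma> i \<alpha> p) * H \<alpha> p $$ (cyc_suc n i, k))) / ?h k \<alpha> p"
    for k \<alpha> p
  have "\<exists>l. k < n \<longrightarrow> has_laplacian (?V \<alpha>) (\<lambda>z. ln (?h k \<alpha> (param S \<alpha> z))) l \<and>
       (\<forall>p\<in>chart_dom S \<alpha>. X k \<alpha> p - ?a k \<alpha> p \<le> l (coord S \<alpha> p))" for k \<alpha>
  proof (cases "k < n")
    case True
    show ?thesis
      by (rule hitchin_diagonal_laplacian[OF S hm True, of \<alpha>]) (unfold X_def, blast)
  qed simp
  then obtain l where l: "\<And>k \<alpha>. k < n \<Longrightarrow> has_laplacian (?V \<alpha>) (\<lambda>z. ln (?h k \<alpha> (param S \<alpha> z))) (l k \<alpha>)"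
    and lX: "\<And>k \<alpha> p. k < n \<Longrightarrow> p \<in> chart_dom S \<alpha> \<Longrightarrow> X k \<alpha> p - ?a k \<alpha> p \<le> l k \<alpha> (coord S \<alpha> p)"
    by metis
  have X: "?a (cyc_pred n k) \<alpha> p \<le> X k \<alpha> p" if "k < n" "p \<in> chart_dom S \<alpha>" for k \<alpha> p
  proof -
    have "cyc_pred n k < n" using that by auto
    from toda_term_le_quadratic_form(1)[OF hm that(2) this] show ?thesis
      unfolding X_def cyc_suc_pred[OF that(1)] .
  qed
  have sum_a: "(\<Sum>k<n. ?a (cyc_pred n k) \<alpha> p - ?a k \<alpha> p) = 0" for \<alpha> p
    unfolding sum_subtractf using sum_cyc_pred[of "\<lambda>k. ?a k \<alpha> p" n] by simp
  have l_ge: "?a (cyc_pred n k) \<alpha> p - ?a k \<alpha> p \<le> l k \<alpha> (coord S \<alpha> p)" if "k < n" "p \<in> chart_dom S \<alpha>" for k \<alpha> p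
    using lX[OF that] X[OF that] by simp

  have \<tau>_sec: "holo_section S (det_bundle (direct_sum n L)) \<tau>" and \<tau>_nz: "p \<in> chart_dom S \<alpha> \<Longrightarrow> \<tau> \<alpha> p \<noteq> 0" for \<alpha> p
    using \<tau> unfolding det_trivialization_def by blast+
  define F where "F \<alpha> p = (\<Sum>k<n. ln (?h k \<alpha> p)) + ln ((cmod (\<tau> \<alpha> p))\<^sup>2)" for \<alpha> p
  have F_glue: "F \<alpha> p = F \<beta> p" if p: "p \<in> chart_dom S \<alpha>" "p \<in> chart_dom S \<beta>" for \<alpha> \<beta> p
  proof -
    have h\<beta>: "?h k \<beta> p = (cmod (L k \<alpha> \<beta> p))\<^sup>2 * ?h k \<alpha> p" if "k < n" for k
      by (rule metric_diag_transition[OF hm p that])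
    have Lnz: "cmod (L k \<alpha> \<beta> p) \<noteq> 0" if "k < n" for k
      using h\<beta>[OF that] metric_diag_facts(2)[OF hm p(2) that] by auto
    have "\<tau> \<alpha> p = (\<Prod>k<n. L k \<alpha> \<beta> p) * \<tau> \<beta> p"
      using \<tau>_sec p unfolding holo_section_def det_bundle_def det_direct_sum by blast
    then have "(cmod (\<tau> \<alpha> p))\<^sup>2 = (\<Prod>k<n. (cmod (L k \<alpha> \<beta> p))\<^sup>2) * (cmod (\<tau> \<beta> p))\<^sup>2"
      by (simp add: norm_mult power_mult_distrib prod_norm[symmetric] prod_power_distrib)
    moreover have "ln ((\<Prod>k<n. (cmod (L k \<alpha> \<beta> p))\<^sup>2) * (cmod (\<tau> \<beta> p))\<^sup>2) =
        ln (\<Prod>k<n. (cmod (L k \<alpha> \<beta> p))\<^sup>2) + ln ((cmod (\<tau> \<beta> p))\<^sup>2)"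
      using Lnz \<tau>_nz[OF p(2)] by (intro ln_mult_pos prod_pos) auto
    moreover have "ln (\<Prod>k<n. (cmod (L k \<alpha> \<beta> p))\<^sup>2) = (\<Sum>k<n. ln ((cmod (L k \<alpha> \<beta> p))\<^sup>2))"
      using Lnz by (intro ln_prod) auto
    moreover have "(\<Sum>k<n. ln (?h k \<beta> p)) = (\<Sum>k<n. ln ((cmod (L k \<alpha> \<beta> p))\<^sup>2)) + (\<Sum>k<n. ln (?h k \<alpha> p))"
      unfolding sum.distrib[symmetric]
    proof (intro sum.cong refl)
      fix k assume "k \<in> {..<n}"
      then have "k < n" by simp
      then show "ln (?h k \<beta> p) = ln ((cmod (L k \<alpha> \<beta> p))\<^sup>2) + ln (?h k \<alpha> p)"
        unfolding h\<beta>[OF \<open>k < n\<close>] using Lnz metric_diag_facts(2)[OF hm p(1)] by (intro ln_mult_pos) auto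
    qed
    ultimately show ?thesis by (simp add: F_def)
  qed
  from glue_charts[OF S, of F, OF F_glue] obtain u where u: "\<And>\<alpha> p. p \<in> chart_dom S \<alpha> \<Longrightarrow> u p = F \<alpha> p" by blast
  have u_lap: "has_laplacian (?V \<alpha>) (\<lambda>z. u (param S \<alpha> z)) (\<lambda>z. \<Sum>k<n. l k \<alpha> z)" for \<alpha>
  proof -
    have "has_laplacian (?V \<alpha>) (\<lambda>z. (\<Sum>k<n. ln (?h k \<alpha> (param S \<alpha> z))) + ln ((cmod ((\<tau> \<alpha> \<circ> param S \<alpha>) z))\<^sup>2))
        (\<lambda>z. (\<Sum>k<n. l k \<alpha> z) + 0)"
    proof (intro has_laplacian_add has_laplacian_sum has_laplacian_ln_cmod_square)
      show "(\<tau> \<alpha> \<circ> param S \<alpha>) holomorphic_on ?V \<alpha>"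
        using \<tau>_sec unfolding holo_section_def holo_on_def by blast
      show "(\<tau> \<alpha> \<circ> param S \<alpha>) z \<noteq> 0" if "z \<in> ?V \<alpha>" for z
        using \<tau>_nz[OF param_in_chart[OF S that]] by simp
    qed (use l chart_image_open[OF S] in auto)
    then show ?thesis
      by (rule has_laplacian_cong[OF _ chart_image_open[OF S]])
         (simp_all add: u[OF param_in_chart[OF S]] F_def del: image_iff)
  qed
  have "continuous_on (chart_dom S \<alpha>) u" for \<alpha>
    using has_laplacian_imp_continuous_on[OF u_lap] continuous_on_chart_iff[OF S] by blast
  then have u_cont: "continuous_on UNIV u" by (rule continuous_on_charts[OF S])
  have "compact (UNIV :: 'a set)" using S by (simp add: closed_riemann_surface_def)
  then obtain m where m: "\<And>p. u p \<le> u m"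
    using continuous_attains_sup[OF _ _ u_cont] by auto
  have sum_l: "0 \<le> (\<Sum>k<n. l k \<alpha> z)" if z: "z \<in> ?V \<alpha>" for \<alpha> z
  proof -
    have "0 = (\<Sum>k<n. ?a (cyc_pred n k) \<alpha> (param S \<alpha> z) - ?a k \<alpha> (param S \<alpha> z))" using sum_a by simp
    also have "\<dots> \<le> (\<Sum>k<n. l k \<alpha> z)"
      by (rule sum_mono) (use l_ge[OF _ param_in_chart[OF S z]] in \<open>simp add: coord_param[OF S z]\<close>)
    finally show ?thesis .
  qed
  have u_const: "u p - u m = 0" for p
  proof (rule strong_maximum_principle[OF S, where \<psi> = "\<lambda>p. u p - u m" and x = m])
    show "continuous_on UNIV (\<lambda>p. u p - u m)" by (intro continuous_intros u_cont)
    show "u p - u m \<le> 0" for p using m[of p] by simp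
    show "u m - u m = 0" by simp
    fix \<alpha> p assume p: "p \<in> chart_dom S \<alpha>"
    have "viscosity_subsolution 0 (\<lambda>z. u (param S \<alpha> z) - u m) z" if z: "z \<in> ?V \<alpha>" for z
      by (rule viscosity_subsolutionI[OF chart_image_open[OF S] z has_laplacian_diff[OF u_lap[of \<alpha>] has_laplacian_const[of _ "u m"]]])
         (use sum_l[OF z] in auto)
    then show "\<exists>C\<ge>0. \<exists>W. open W \<and> coord S \<alpha> p \<in> W \<and> W \<subseteq> ?V \<alpha> \<and>
        (\<forall>z\<in>W. viscosity_subsolution C (\<lambda>z. u (param S \<alpha> z) - u m) z)"
      using chart_image_open[OF S] p by (intro exI[of _ 0] conjI exI[of _ "?V \<alpha>"]) auto
  qed
  have l_eq: "l k \<alpha> (coord S \<alpha> p) = ?a (cyc_pred n k) \<alpha> p - ?a k \<alpha> p" if k: "k < n" and p: "p \<in> chart_dom S \<alpha>" for k \<alpha> p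
  proof -
    have le: "(\<Sum>k<n. l k \<alpha> (coord S \<alpha> p)) \<le> 0"
    proof (rule laplacian_nonpos_at_local_max[OF u_lap chart_image_open[OF S]])
      show "u (param S \<alpha> w) \<le> u (param S \<alpha> (coord S \<alpha> p))" for w
        using m[of "param S \<alpha> w"] u_const[of "param S \<alpha> (coord S \<alpha> p)"] by linarith
    qed (use p in auto)
    define e where "e k = l k \<alpha> (coord S \<alpha> p) - (?a (cyc_pred n k) \<alpha> p - ?a k \<alpha> p)" for k
    have nonneg: "0 \<le> e k" if "k \<in> {..<n}" for k
      using l_ge[of k p \<alpha>] that p by (simp add: e_def)
    have "sum e {..<n} = (\<Sum>k<n. l k \<alpha> (coord S \<alpha> p))"
      using sum_a[of \<alpha> p] unfolding e_def sum_subtractf by linarith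
    then have "sum e {..<n} \<le> 0" using le by simp
    moreover have "0 \<le> sum e {..<n}" by (rule sum_nonneg) (rule nonneg)
    ultimately have "sum e {..<n} = 0" by (rule order_antisym)
    then have "e k = 0" using nonneg k by (intro sum_nonneg_0[of "{..<n}" e k]) auto
    then have "l k \<alpha> (coord S \<alpha> p) - (?a (cyc_pred n k) \<alpha> p - ?a k \<alpha> p) = 0" by (simp add: e_def)
    then show ?thesis by simp
  qed
  show "has_laplacian (?V \<alpha>) (\<lambda>z. ln (?h k \<alpha> (param S \<alpha> z)))
     (\<lambda>z. ?a (cyc_pred n k) \<alpha> (param S \<alpha> z) - ?a k \<alpha> (param S \<alpha> z))" if k: "k < n"
  proof (rule has_laplacian_cong[OF l[OF k] chart_image_open[OF S] refl])
    fix z assume z: "z \<in> ?V \<alpha>"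
    show "l k \<alpha> z = ?a (cyc_pred n k) \<alpha> (param S \<alpha> z) - ?a k \<alpha> (param S \<alpha> z)"
      using l_eq[OF k param_in_chart[OF S z]] coord_param[OF S z] by simp
  qed
  show "higgs_energy H (cyclic_field n \<gamma>) \<alpha> p = (\<Sum>j<n. ?a j \<alpha> p)" if p: "p \<in> chart_dom S \<alpha>"
  proof -
    have eq: "\<gamma> j \<alpha> p * (\<Sum>i<n. mat_inv (H \<alpha> p) $$ (j, i) * (cnj (\<gamma> i \<alpha> p) * H \<alpha> p $$ (cyc_suc n i, cyc_suc n j))) =
        of_real (?a j \<alpha> p)" if j: "j < n" for j
    proof (rule toda_term_le_quadratic_form(2)[OF hm p j])
      have k: "cyc_suc n j < n" using j by auto
      have "X (cyc_suc n j) \<alpha> p \<le> ?a j \<alpha> p"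
        using lX[OF k p] l_eq[OF k p] unfolding cyc_pred_suc[OF j] by linarith
      with X[OF k p] show "Re (quadratic_form n (mat_inv (H \<alpha> p)) (\<lambda>i. cnj (\<gamma> i \<alpha> p) * H \<alpha> p $$ (cyc_suc n i, cyc_suc n j)))
          / ?h (cyc_suc n j) \<alpha> p = ?a j \<alpha> p"
        unfolding cyc_pred_suc[OF j] X_def by simp
    qed
    note Hp = harmonic_metric_pointwise[OF hm p]
    have "sum_list (diag_mat (cyclic_field n \<gamma> \<alpha> p * h_adjoint (H \<alpha> p) (cyclic_field n \<gamma> \<alpha> p))) =
      (\<Sum>j<n. \<gamma> j \<alpha> p * (\<Sum>i<n. mat_inv (H \<alpha> p) $$ (j, i) * (cnj (\<gamma> i \<alpha> p) * H \<alpha> p $$ (cyc_suc n i, cyc_suc n j))))"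
      unfolding h_adjoint_def
      by (rule cyclic_energy_trace[OF Hp(1) mat_inv_facts(1)[OF Hp(1) Hp(4)]]) (simp add: cyclic_field_def)
    also have "\<dots> = of_real (\<Sum>j<n. ?a j \<alpha> p)"
      unfolding of_real_sum by (intro sum.cong refl eq) simp
    finally show ?thesis by (simp only: higgs_energy_def Re_complex_of_real)
  qed
qed

section \<open>Zeros of holomorphic sections\<close>

lemma holo_section_continuous:
  assumes S: "closed_riemann_surface S" and s: "holo_section S M s"
  shows "continuous_on (chart_dom S \<alpha>) (s \<alpha>)"
proof -
  have "(s \<alpha> \<circ> param S \<alpha>) holomorphic_on coord S \<alpha> ` chart_dom S \<alpha>"
    using s unfolding holo_section_def holo_on_def by blast
  then have "continuous_on (coord S \<alpha> ` chart_dom S \<alpha>) (\<lambda>z. s \<alpha> (param S \<alpha> z))"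
    unfolding o_def by (rule holomorphic_on_imp_continuous_on)
  then show ?thesis by (simp only: continuous_on_chart_iff[OF S])
qed

text \<open>The identity theorem: the interior of the zero set is open and, by analytic continuation on
  coordinate discs, closed.\<close>

lemma holo_section_nonzero_dense:
  fixes S :: "('i, 'a::t2_space) surface"
  assumes S: "closed_riemann_surface S" and s: "holo_section S M s" and nz: "\<not> zero_section S s"
    and U: "open U" "U \<noteq> {}"
  shows "\<exists>\<alpha> p. p \<in> U \<and> p \<in> chart_dom S \<alpha> \<and> s \<alpha> p \<noteq> 0"
proof (rule ccontr)
  assume no: "\<not> ?thesis"
  define Z where "Z = {p. \<forall>\<alpha>. p \<in> chart_dom S \<alpha> \<longrightarrow> s \<alpha> p = 0}"
  have UZ: "U \<subseteq> interior Z" using no U(1) by (intro interior_maximal) (auto simp: Z_def)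
  have transition: "s \<beta> p = 0" if "p \<in> chart_dom S \<alpha>" "p \<in> chart_dom S \<beta>" "s \<alpha> p = 0" for \<alpha> \<beta> p
  proof -
    have "s \<beta> p = M \<beta> \<alpha> p * s \<alpha> p" using s that(1,2) unfolding holo_section_def by blast
    with that(3) show ?thesis by simp
  qed
  have "closure (interior Z) \<subseteq> interior Z"
  proof
    fix x assume x: "x \<in> closure (interior Z)"
    obtain \<alpha> where \<alpha>: "x \<in> chart_dom S \<alpha>" using chart_cover[OF S] .
    let ?D = "chart_dom S \<alpha>" and ?c = "coord S \<alpha>"
    let ?V = "?c ` ?D"
    obtain r where r: "r > 0" "ball (?c x) r \<subseteq> ?V"
      using chart_image_open[OF S] \<alpha> openE by blast
    define N where "N = ?D \<inter> ?c -` ball (?c x) r"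
    have "open N" unfolding N_def
      by (rule continuous_open_preimage[OF coord_continuous[OF S] chart_open[OF S]]) auto
    moreover have "x \<in> N" using \<alpha> r(1) by (simp add: N_def)
    ultimately obtain q where q: "q \<in> N" "q \<in> interior Z"
      using x by (auto simp: closure_iff_nhds_not_empty)
    define T where "T = ball (?c x) r \<inter> param S \<alpha> -` interior Z"
    have T: "open T" unfolding T_def
      by (rule continuous_open_preimage[OF continuous_on_subset[OF param_continuous[OF S] r(2)]]) auto
    have qT: "?c q \<in> T" using q param_coord[OF S, of q \<alpha>] by (auto simp: T_def N_def)
    have hol: "(s \<alpha> \<circ> param S \<alpha>) holomorphic_on ball (?c x) r"
      using s r(2) unfolding holo_section_def holo_on_def by (blast intro: holomorphic_on_subset)
    have Tz: "(s \<alpha> \<circ> param S \<alpha>) z = 0" if "z \<in> T" for z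
    proof -
      have "z \<in> ?V" "param S \<alpha> z \<in> Z" using that r(2) interior_subset by (auto simp: T_def)
      then show ?thesis using param_in_chart[OF S \<open>z \<in> ?V\<close>] by (auto simp: Z_def)
    qed
    have zero: "(s \<alpha> \<circ> param S \<alpha>) z = 0" if "z \<in> ball (?c x) r" for z
    proof (rule analytic_continuation_open[OF T open_ball _ connected_ball _ hol holomorphic_on_const Tz that])
      show "T \<noteq> {}" using qT by blast
      show "T \<subseteq> ball (?c x) r" by (simp add: T_def)
    qed
    have "N \<subseteq> Z"
    proof
      fix p assume p: "p \<in> N"
      then have "s \<alpha> p = 0" using zero[of "?c p"] param_coord[OF S, of p \<alpha>] by (auto simp: N_def)
      then show "p \<in> Z" using transition p by (auto simp: Z_def N_def)
    qed
    then show "x \<in> interior Z" using \<open>open N\<close> \<open>x \<in> N\<close> by (meson interiorI)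
  qed
  then have "closed (interior Z)" using closure_subset closure_closed by (metis subset_antisym closed_closure)
  moreover have "connected (UNIV :: 'a set)" using S by (simp add: closed_riemann_surface_def)
  ultimately have "interior Z = {} \<or> interior Z = UNIV"
    unfolding connected_clopen by (simp only: subtopology_UNIV open_openin[symmetric] closed_closedin[symmetric] open_interior simp_thms)
  with UZ U(2) have "interior Z = UNIV" by blast
  then have "Z = UNIV" using interior_subset[of Z] by blast
  then have "zero_section S s" unfolding zero_section_def Z_def by blast
  with nz show False ..
qed

lemma holo_sections_common_nonzero:
  fixes S :: "('i, 'a::t2_space) surface" and m :: nat
  assumes S: "closed_riemann_surface S"
    and s: "\<And>k. k < m \<Longrightarrow> holo_section S (M k) (s k)" "\<And>k. k < m \<Longrightarrow> \<not> zero_section S (s k)"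
    and \<alpha>: "chart_dom S \<alpha> \<noteq> {}"
  shows "\<exists>U. open U \<and> U \<noteq> {} \<and> U \<subseteq> chart_dom S \<alpha> \<and> (\<forall>p\<in>U. \<forall>k<m. s k \<alpha> p \<noteq> 0)"
  using s
proof (induction m)
  case 0
  then show ?case using \<alpha> chart_open[OF S] by blast
next
  case (Suc m)
  then obtain U where U: "open U" "U \<noteq> {}" "U \<subseteq> chart_dom S \<alpha>" "\<And>p k. p \<in> U \<Longrightarrow> k < m \<Longrightarrow> s k \<alpha> p \<noteq> 0"
    using less_SucI by metis
  have sm: "holo_section S (M m) (s m)" "\<not> zero_section S (s m)" using Suc.prems by auto
  obtain \<beta> p where p: "p \<in> U" "p \<in> chart_dom S \<beta>" "s m \<beta> p \<noteq> 0"
    using holo_section_nonzero_dense[OF S sm U(1,2)] by blast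
  have "s m \<beta> p = M m \<beta> \<alpha> p * s m \<alpha> p" using sm(1) p U(3) unfolding holo_section_def by blast
  with p(3) have nz: "s m \<alpha> p \<noteq> 0" by auto
  have "open (U \<inter> s m \<alpha> -` (- {0}))"
    by (rule continuous_open_preimage[OF continuous_on_subset[OF holo_section_continuous[OF S sm(1)] U(3)] U(1)]) auto
  then show ?case
    by (intro exI[of _ "U \<inter> s m \<alpha> -` (- {0})"]) (use U p(1) nz in \<open>auto simp: less_Suc_eq\<close>)
qed

section \<open>Monotonicity in the parameter\<close>

lemma toda_term_continuous:
  assumes S: "closed_riemann_surface S" and \<tau>: "det_trivialization S (direct_sum n L) \<tau>"
    and hm: "harmonic_metric S n (direct_sum n L) \<tau> (cyclic_field n \<gamma>) H"
    and \<gamma>: "continuous_on (chart_dom S \<alpha>) (\<gamma> k \<alpha>)" and k: "k < n"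
  shows "continuous_on (chart_dom S \<alpha>) (toda_term n \<gamma> H k \<alpha>)"
proof -
  have h: "continuous_on (chart_dom S \<alpha>) (metric_diag H j \<alpha>)" if "j < n" for j
  proof -
    have "continuous_on (chart_dom S \<alpha>) (\<lambda>p. ln (metric_diag H j \<alpha> p))"
      unfolding continuous_on_chart_iff[OF S]
      by (rule has_laplacian_imp_continuous_on[OF toda_system(1)[OF S \<tau> hm that]])
    then have "continuous_on (chart_dom S \<alpha>) (\<lambda>p. exp (ln (metric_diag H j \<alpha> p)))"
      by (rule continuous_on_exp)
    then show ?thesis
      by (rule continuous_on_eq) (simp add: metric_diag_facts(2)[OF hm _ that])
  qed
  have "cyc_suc n k < n" using k by auto
  moreover have "metric_diag H k \<alpha> p \<noteq> 0" if "p \<in> chart_dom S \<alpha>" for p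
    using metric_diag_facts(2)[OF hm that k] by simp
  ultimately show ?thesis unfolding toda_term_def by (intro continuous_intros \<gamma> h k) auto
qed

text \<open>The comparison is applied to \<open>v\<^sub>k = ln (a\<^sub>k / a\<^sub>k')\<close>, written as the telescoping difference of
  \<open>r\<^sub>k = ln (h\<^sub>k / h\<^sub>k')\<close> plus a constant in the last index, so that no logarithm of a vanishing
  \<open>\<gamma>\<^sub>k\<close> occurs. The transition functions of the line bundles cancel in \<open>r\<^sub>k\<close>.\<close>

theorem toda_term_strict_mono:
  fixes S :: "('i, 'a::t2_space) surface"
  assumes S: "closed_riemann_surface S" and n: "0 < n"
    and cyc: "cyclic_higgs_bundle S n L \<tau> \<gamma>" and last: "\<not> zero_section S (\<gamma> (n - 1))"
    and hm: "harmonic_metric S n (direct_sum n L) \<tau> (cyclic_field n (scale_last n t \<gamma>)) H"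
    and hm': "harmonic_metric S n (direct_sum n L) \<tau> (cyclic_field n (scale_last n t' \<gamma>)) H'"
    and t: "cmod t' < cmod t" and k: "k < n" and p: "p \<in> chart_dom S \<alpha>"
  shows "toda_term n (scale_last n t' \<gamma>) H' k \<alpha> p \<le> toda_term n (scale_last n t \<gamma>) H k \<alpha> p"
    and "\<gamma> k \<alpha> p \<noteq> 0 \<Longrightarrow>
      toda_term n (scale_last n t' \<gamma>) H' k \<alpha> p < toda_term n (scale_last n t \<gamma>) H k \<alpha> p"
proof -
  let ?V = "\<lambda>\<alpha>. coord S \<alpha> ` chart_dom S \<alpha>"
  let ?g = "scale_last n t \<gamma>" and ?g' = "scale_last n t' \<gamma>"
  let ?a = "toda_term n ?g H" and ?a' = "toda_term n ?g' H'"
  let ?h = "metric_diag H" and ?h' = "metric_diag H'"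
  have \<tau>: "det_trivialization S (direct_sum n L) \<tau>" using cyc unfolding cyclic_higgs_bundle_def by blast
  have sec: "holo_section S (tensor (dual (L k)) (tensor (L (Suc k mod n)) (canonical_bundle S))) (\<gamma> k)" if "k < n" for k
    using cyc that unfolding cyclic_higgs_bundle_def by blast
  have nonzero: "\<not> zero_section S (\<gamma> k)" if "k < n" for k
  proof (cases "k = n - 1")
    case False
    then have "k < n - 1" using that by simp
    then show ?thesis using cyc unfolding cyclic_higgs_bundle_def by blast
  qed (use last in simp)
  have h: "0 < ?h k \<alpha> p" and h': "0 < ?h' k \<alpha> p" if "k < n" "p \<in> chart_dom S \<alpha>" for k \<alpha> p
    using metric_diag_facts(2)[OF hm that(2,1)] metric_diag_facts(2)[OF hm' that(2,1)] by auto
  have suc: "cyc_suc n k < n" for k using n by simp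
  have t0: "t \<noteq> 0" using t by auto
  have g_cont: "continuous_on (chart_dom S \<alpha>) (scale_last n u \<gamma> k \<alpha>)" if "k < n" for \<alpha> k u
    using holo_section_continuous[OF S sec[OF that]]
    by (cases "k = n - 1") (auto simp: scale_last_def intro!: continuous_intros)
  have a_cont: "continuous_on (chart_dom S \<alpha>) (?a k \<alpha>)" and a'_cont: "continuous_on (chart_dom S \<alpha>) (?a' k \<alpha>)"
    if "k < n" for \<alpha> k
    using toda_term_continuous[OF S \<tau> hm g_cont[OF that] that] toda_term_continuous[OF S \<tau> hm' g_cont[OF that] that] .

  have "\<exists>r. \<forall>\<alpha> p. k < n \<longrightarrow> p \<in> chart_dom S \<alpha> \<longrightarrow> r p = ln (?h k \<alpha> p) - ln (?h' k \<alpha> p)" for k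
  proof (cases "k < n")
    case True
    have "ln (?h k \<alpha> p) - ln (?h' k \<alpha> p) = ln (?h k \<beta> p) - ln (?h' k \<beta> p)"
      if p: "p \<in> chart_dom S \<alpha>" "p \<in> chart_dom S \<beta>" for \<alpha> \<beta> p
    proof -
      note T = metric_diag_transition[OF hm p True] metric_diag_transition[OF hm' p True]
      have "0 < (cmod (L k \<alpha> \<beta> p))\<^sup>2" using T(1) h[OF True p(2)] by auto
      then show ?thesis unfolding T using h[OF True p(1)] h'[OF True p(1)]
        by (simp add: ln_mult_pos)
    qed
    from glue_charts[OF S, of "\<lambda>\<alpha> p. ln (?h k \<alpha> p) - ln (?h' k \<alpha> p)", OF this]
    obtain u where "\<And>\<alpha> p. p \<in> chart_dom S \<alpha> \<Longrightarrow> u p = ln (?h k \<alpha> p) - ln (?h' k \<alpha> p)" by blast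
    then show ?thesis by blast
  qed simp
  then obtain r where r: "\<And>k \<alpha> p. k < n \<Longrightarrow> p \<in> chart_dom S \<alpha> \<Longrightarrow> r k p = ln (?h k \<alpha> p) - ln (?h' k \<alpha> p)"
    by metis
  define f where "f k \<alpha> p = ?a k \<alpha> p - ?a' k \<alpha> p" for k \<alpha> p
  have r_lap: "has_laplacian (?V \<alpha>) (\<lambda>z. r k (param S \<alpha> z)) (\<lambda>z. f (cyc_pred n k) \<alpha> (param S \<alpha> z) - f k \<alpha> (param S \<alpha> z))"
    if "k < n" for k \<alpha>
  proof (rule has_laplacian_cong[OF has_laplacian_diff[OF toda_system(1)[OF S \<tau> hm that, of \<alpha>]
          toda_system(1)[OF S \<tau> hm' that, of \<alpha>]] chart_image_open[OF S]])
    fix z assume "z \<in> ?V \<alpha>"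
    from r[OF that param_in_chart[OF S this]]
    show "ln (?h k \<alpha> (param S \<alpha> z)) - ln (?h' k \<alpha> (param S \<alpha> z)) = r k (param S \<alpha> z)" by simp
  qed (simp add: f_def)
  have r_cont: "continuous_on UNIV (r k)" if "k < n" for k
    by (rule continuous_on_charts[OF S])
       (simp only: continuous_on_chart_iff[OF S] has_laplacian_imp_continuous_on[OF r_lap[OF that]])

  have "\<exists>c>0. if t' = 0 then (\<forall>p. 0 < r 0 p - r (n - 1) p + c) else (cmod t)\<^sup>2 = (cmod t')\<^sup>2 * exp c"
  proof (cases "t' = 0")
    case True
    have "compact (UNIV :: 'a set)" using S by (simp add: closed_riemann_surface_def)
    moreover have "continuous_on UNIV (\<lambda>p. r 0 p - r (n - 1) p)" using n by (intro continuous_intros r_cont) auto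
    ultimately obtain m where m: "\<And>p. r 0 m - r (n - 1) m \<le> r 0 p - r (n - 1) p"
      using continuous_attains_inf[of UNIV "\<lambda>p. r 0 p - r (n - 1) p"] by auto
    have "0 < r 0 p - r (n - 1) p + max 1 (1 - (r 0 m - r (n - 1) m))" for p
      using m[of p] by linarith
    then show ?thesis using True by (intro exI[of _ "max 1 (1 - (r 0 m - r (n - 1) m))"]) auto
  next
    case False
    let ?q = "(cmod t)\<^sup>2 / (cmod t')\<^sup>2"
    have "(cmod t')\<^sup>2 < (cmod t)\<^sup>2" using t by (intro power_strict_mono) auto
    then have "1 < ?q" using False by (simp add: field_simps)
    then have "0 < ln ?q" "exp (ln ?q) = ?q" by simp_all
    then show ?thesis using False by (intro exI[of _ "ln ?q"]) simp
  qed
  then obtain c where c: "c > 0"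
    and c': "if t' = 0 then (\<forall>p. 0 < r 0 p - r (n - 1) p + c) else (cmod t)\<^sup>2 = (cmod t')\<^sup>2 * exp c"
    by blast
  have c0: "0 < r 0 p - r (n - 1) p + c" if "t' = 0" for p using c' that by simp
  have c1: "(cmod t)\<^sup>2 = (cmod t')\<^sup>2 * exp c" if "t' \<noteq> 0" using c' that by simp
  define v where "v k p = r (cyc_suc n k) p - r k p + (if k = n - 1 then c else 0)" for k p
  have v_last: "0 < v (n - 1) p" if "t' = 0" for p
    using c0[OF that, of p] n by (simp add: v_def)
  have v_sum: "(\<Sum>k<n. v k p) = c" for p
  proof -
    have "(\<Sum>k<n. v k p) = (\<Sum>k<n. r (cyc_suc n k) p) - (\<Sum>k<n. r k p) + (\<Sum>k<n. if k = n - 1 then c else 0)"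
      unfolding v_def by (simp add: sum.distrib sum_subtractf)
    also have "(\<Sum>k<n. if k = n - 1 then c else 0) = c" using n by simp
    finally show ?thesis using sum_cyc_suc[of "\<lambda>k. r k p" n] by simp
  qed
  have v_lap: "has_laplacian (?V \<alpha>) (\<lambda>z. v k (param S \<alpha> z))
      (\<lambda>z. 2 * f k \<alpha> (param S \<alpha> z) - f (cyc_pred n k) \<alpha> (param S \<alpha> z) - f (cyc_suc n k) \<alpha> (param S \<alpha> z))"
    if "k < n" for k \<alpha>
  proof (rule has_laplacian_cong[OF has_laplacian_add[OF has_laplacian_diff[OF r_lap[OF suc] r_lap[OF that]] has_laplacian_const]
          chart_image_open[OF S]])
    show "r (cyc_suc n k) (param S \<alpha> z) - r k (param S \<alpha> z) + (if k = n - 1 then c else 0) = v k (param S \<alpha> z)" for z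
      by (simp add: v_def)
  qed (simp add: cyc_pred_suc[OF that] del: One_nat_def)

  \<comment> \<open>\<open>a = a' e\<^sup>v\<close>, except for the last term when \<open>t' = 0\<close>.\<close>
  have a_exp: "?a k \<alpha> p = ?a' k \<alpha> p * exp (v k p)"
    if k: "k < n" and p: "p \<in> chart_dom S \<alpha>" and nonspecial: "\<not> (k = n - 1 \<and> t' = 0)" for k \<alpha> p
  proof -
    have "exp (r j p) = ?h j \<alpha> p / ?h' j \<alpha> p" if "j < n" for j
      using r[OF that p] h[OF that p] h'[OF that p] by (simp add: exp_diff)
    then have e: "exp (v k p) = (?h (cyc_suc n k) \<alpha> p / ?h' (cyc_suc n k) \<alpha> p) / (?h k \<alpha> p / ?h' k \<alpha> p) * exp (if k = n - 1 then c else 0)"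
      unfolding v_def exp_add exp_diff using suc k by simp
    have g: "(cmod (?g k \<alpha> p))\<^sup>2 = (cmod (?g' k \<alpha> p))\<^sup>2 * exp (if k = n - 1 then c else 0)"
      using nonspecial c1 by (auto simp: scale_last_def norm_mult power_mult_distrib)
    show ?thesis unfolding toda_term_def e g
      using h[OF k p] h'[OF k p] h'[OF suc p, of k] by (simp add: field_simps)
  qed
  \<comment> \<open>For \<open>t' = 0\<close> the last term \<open>a'\<close> vanishes and the factor is found by solving for it.\<close>
  define A where "A k \<alpha> p = (if k = n - 1 \<and> t' = 0 then ?a k \<alpha> p / (exp (v k p) - 1) else ?a' k \<alpha> p)" for k \<alpha> p
  have special: "?a' (n - 1) \<alpha> p = 0" if "t' = 0" for \<alpha> p
    using that by (simp add: toda_term_def scale_last_def)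
  have v_pos: "1 < exp (v (n - 1) p)" if "t' = 0" for p
    using v_last[OF that] by simp
  have fA: "f k \<alpha> p = A k \<alpha> p * (exp (v k p) - 1)" if "k < n" "p \<in> chart_dom S \<alpha>" for k \<alpha> p
  proof (cases "k = n - 1 \<and> t' = 0")
    case True
    then show ?thesis using special[of \<alpha> p] v_pos[of p] by (simp add: f_def A_def)
  next
    case False
    then have "A k \<alpha> p = ?a' k \<alpha> p" by (auto simp: A_def)
    then show ?thesis using a_exp[OF that False] by (simp add: f_def algebra_simps)
  qed
  have a_nonneg: "0 \<le> ?a k \<alpha> p" "0 \<le> ?a' k \<alpha> p" if "k < n" "p \<in> chart_dom S \<alpha>" for k \<alpha> p
    unfolding toda_term_def using h[OF that] h'[OF that] h[OF suc that(2)] h'[OF suc that(2)]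
    by (auto intro!: divide_nonneg_nonneg mult_nonneg_nonneg simp: less_imp_le)
  have A_nonneg: "0 \<le> A k \<alpha> p" if "k < n" "p \<in> chart_dom S \<alpha>" for k \<alpha> p
    using a_nonneg[OF that] v_pos[of p] by (auto simp: A_def intro!: divide_nonneg_nonneg)
  have A_pos: "0 < A k \<alpha> p" if "k < n" "p \<in> chart_dom S \<alpha>" "\<gamma> k \<alpha> p \<noteq> 0" for k \<alpha> p
  proof -
    have "0 < ?a k \<alpha> p"
      unfolding toda_term_def using h[OF that(1,2)] h[OF suc that(2)] that(3) t0
      by (intro divide_pos_pos mult_pos_pos) (auto simp: scale_last_def)
    moreover have "0 < ?a' k \<alpha> p" if "\<not> (k = n - 1 \<and> t' = 0)"
      unfolding toda_term_def using h'[OF \<open>k < n\<close> \<open>p \<in> chart_dom S \<alpha>\<close>] h'[OF suc \<open>p \<in> chart_dom S \<alpha>\<close>] \<open>\<gamma> k \<alpha> p \<noteq> 0\<close> that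
      by (intro divide_pos_pos mult_pos_pos) (auto simp: scale_last_def)
    ultimately show ?thesis using v_pos[of p] by (auto simp: A_def)
  qed
  have A_cont: "continuous_on (chart_dom S \<alpha>) (A k \<alpha>)" if "k < n" for k \<alpha>
  proof (cases "k = n - 1 \<and> t' = 0")
    case True
    have "continuous_on UNIV (v k)" unfolding v_def by (intro continuous_intros r_cont suc that)
    then have "continuous_on (chart_dom S \<alpha>) (v k)" by (rule continuous_on_subset) simp
    then have "continuous_on (chart_dom S \<alpha>) (\<lambda>p. ?a k \<alpha> p / (exp (v k p) - 1))"
      using True v_pos by (intro continuous_intros a_cont that) (auto simp: less_imp_neq[symmetric])
    then show ?thesis using True by (simp add: A_def)
  next
    case False
    then have "A k \<alpha> = ?a' k \<alpha>" by (auto simp: A_def)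
    then show ?thesis using a'_cont[OF that] by simp
  qed
  have "\<exists>U. open U \<and> U \<noteq> {} \<and> U \<subseteq> chart_dom S \<alpha> \<and> (\<forall>p\<in>U. \<forall>k<n. \<gamma> k \<alpha> p \<noteq> 0)"
    by (rule holo_sections_common_nonzero[OF S sec nonzero]) (use p in auto)
  then obtain x where x: "x \<in> chart_dom S \<alpha>" "\<And>k. k < n \<Longrightarrow> \<gamma> k \<alpha> x \<noteq> 0" by blast
  have "0 < v k p" if "k < n" for k p
    by (rule toda_comparison[OF S v_lap fA A_nonneg A_cont x(1) _ _ that])
       (use A_pos x c v_sum in auto)
  then have v: "1 < exp (v k p)" using k by simp
  have "0 \<le> f k \<alpha> p" unfolding fA[OF k p] using A_nonneg[OF k p] v by simp
  then show "?a' k \<alpha> p \<le> ?a k \<alpha> p" by (simp add: f_def)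
  assume "\<gamma> k \<alpha> p \<noteq> 0"
  then have "0 < f k \<alpha> p" unfolding fA[OF k p] using A_pos[OF k p] v by simp
  then show "?a' k \<alpha> p < ?a k \<alpha> p" by (simp add: f_def)
qed

section \<open>Integration over a surface\<close>

lemma chart_bump:
  fixes S :: "('i, 'a::t2_space) surface"
  assumes S: "closed_riemann_surface S"
  shows "\<exists>\<alpha> b. continuous_on UNIV b \<and> (\<forall>q. 0 \<le> b q) \<and> 0 < b p \<and>
      closure {q. b q \<noteq> (0::real)} \<subseteq> chart_dom S \<alpha>"
proof -
  obtain \<alpha> where \<alpha>: "p \<in> chart_dom S \<alpha>" using chart_cover[OF S] .
  let ?D = "chart_dom S \<alpha>" and ?c = "coord S \<alpha>"
  obtain r where r: "r > 0" "cball (?c p) r \<subseteq> ?c ` ?D"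
    using chart_image_open[OF S, of \<alpha>] \<alpha> open_contains_cball by blast
  define K where "K = param S \<alpha> ` cball (?c p) r"
  have "compact K" unfolding K_def
    by (rule compact_continuous_image[OF continuous_on_subset[OF param_continuous[OF S] r(2)] compact_cball])
  then have K: "closed K" by (rule compact_imp_closed)
  have KD: "K \<subseteq> ?D" unfolding K_def using r(2) param_in_chart[OF S] by blast
  define b where "b q = (if q \<in> ?D then max 0 (r - dist (?c q) (?c p)) else 0)" for q
  have out: "b q = 0" if "q \<notin> K" for q
  proof (cases "q \<in> ?D")
    case True
    have "?c q \<notin> cball (?c p) r"
    proof
      assume "?c q \<in> cball (?c p) r"
      then have "param S \<alpha> (?c q) \<in> K" by (auto simp: K_def)
      with that show False by (simp add: param_coord[OF S True])
    qed
    then show ?thesis using True by (simp add: b_def dist_commute)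
  qed (simp add: b_def)
  have "continuous_on ?D (\<lambda>q. max 0 (r - dist (?c q) (?c p)))"
    by (intro continuous_intros coord_continuous[OF S])
  then have "continuous_on ?D b" by (rule continuous_on_eq) (simp add: b_def)
  moreover have "continuous_on (- K) b"
    by (rule continuous_on_eq[OF continuous_on_const[of _ 0]]) (simp add: out)
  ultimately have "continuous_on (?D \<union> - K) b"
    using K by (intro continuous_on_open_Un chart_open[OF S]) auto
  moreover have "?D \<union> - K = UNIV" using KD by blast
  ultimately have "continuous_on UNIV b" by simp
  moreover have "0 \<le> b q" for q by (simp add: b_def)
  moreover have "0 < b p" using \<alpha> r(1) by (simp add: b_def)
  moreover have "closure {q. b q \<noteq> 0} \<subseteq> K" using K out by (intro closure_minimal) auto
  ultimately show ?thesis using KD by blast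
qed

text \<open>By compactness the bumps of finitely many points cover the surface. Those that live in the same
  chart are added up, since the partition is indexed by charts and not by points.\<close>

lemma partition_of_unity_exists:
  fixes S :: "('i, 'a::t2_space) surface"
  assumes S: "closed_riemann_surface S"
  shows "\<exists>A \<rho>. partition_of_unity S A \<rho>"
proof -
  obtain a b where b: "\<And>p. continuous_on UNIV (b p)" "\<And>p q. 0 \<le> b p q" "\<And>p. 0 < b p p"
    "\<And>p. closure {q. b p q \<noteq> (0::real)} \<subseteq> chart_dom S (a p)"
    using chart_bump[OF S] by metis
  have comp: "compact (UNIV :: 'a set)" using S by (simp add: closed_riemann_surface_def)
  have "open {q. 0 < b p q}" for p
    by (rule open_Collect_less) (auto intro: b(1))
  moreover have "(UNIV :: 'a set) \<subseteq> (\<Union>p\<in>UNIV. {q. 0 < b p q})" using b(3) by auto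
  ultimately obtain P where P: "finite P" "UNIV \<subseteq> (\<Union>p\<in>P. {q. 0 < b p q})"
    using compactE_image[OF comp, of UNIV "\<lambda>p. {q. 0 < b p q}"] by metis
  define s where "s q = (\<Sum>p\<in>P. b p q)" for q
  have s: "0 < s q" for q
  proof -
    obtain p where "p \<in> P" "0 < b p q" using P(2) by blast
    then show ?thesis unfolding s_def using P(1) b(2) by (intro sum_pos2) auto
  qed
  define \<rho> where "\<rho> \<alpha> q = (\<Sum>p\<in>{p\<in>P. a p = \<alpha>}. b p q) / s q" for \<alpha> q
  have "partition_of_unity S (a ` P) \<rho>"
    unfolding partition_of_unity_def
  proof (intro conjI ballI allI)
    show "finite (a ` P)" using P(1) by simp
    fix \<alpha>
    have "s q \<noteq> 0" for q using s[of q] by simp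
    then show "continuous_on UNIV (\<rho> \<alpha>)" unfolding \<rho>_def s_def
      by (intro continuous_intros b(1)) auto
    show "0 \<le> \<rho> \<alpha> q" for q unfolding \<rho>_def
      using s[of q] b(2) by (intro divide_nonneg_pos sum_nonneg) auto
    have "\<rho> \<alpha> q = 0" if "q \<notin> (\<Union>p\<in>{p\<in>P. a p = \<alpha>}. closure {q. b p q \<noteq> 0})" for q
    proof -
      have "b p q = 0" if "p \<in> {p\<in>P. a p = \<alpha>}" for p
        using that \<open>q \<notin> _\<close> closure_subset[of "{q. b p q \<noteq> 0}"] by blast
      then show ?thesis by (simp add: \<rho>_def)
    qed
    then have "closure {q. \<rho> \<alpha> q \<noteq> 0} \<subseteq> (\<Union>p\<in>{p\<in>P. a p = \<alpha>}. closure {q. b p q \<noteq> 0})"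
      using P(1) by (intro closure_minimal closed_UN) auto
    also have "\<dots> \<subseteq> chart_dom S \<alpha>" using b(4) by blast
    finally show "closure {q. \<rho> \<alpha> q \<noteq> 0} \<subseteq> chart_dom S \<alpha>" .
  next
    fix q
    have "(\<Sum>\<alpha>\<in>a ` P. \<rho> \<alpha> q) = (\<Sum>\<alpha>\<in>a ` P. \<Sum>p\<in>{p\<in>P. a p = \<alpha>}. b p q) / s q"
      by (simp add: \<rho>_def sum_divide_distrib)
    also have "(\<Sum>\<alpha>\<in>a ` P. \<Sum>p\<in>{p\<in>P. a p = \<alpha>}. b p q) = s q"
      unfolding s_def by (rule sum.image_gen[OF P(1), symmetric])
    finally show "(\<Sum>\<alpha>\<in>a ` P. \<rho> \<alpha> q) = 1" using s[of q] by simp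
  qed
  then show ?thesis by blast
qed

text \<open>Extended by zero, \<open>g\<close> becomes a continuous function of compact support on the whole plane.\<close>

lemma chart_integral:
  fixes S :: "('i, 'a::t2_space) surface" and g :: "'a \<Rightarrow> real"
  assumes S: "closed_riemann_surface S" and cont: "continuous_on (chart_dom S \<alpha>) g"
    and supp: "closure {p. g p \<noteq> 0} \<subseteq> chart_dom S \<alpha>"
  shows "(\<lambda>z. g (param S \<alpha> z)) integrable_on (coord S \<alpha> ` chart_dom S \<alpha>)"
    and "(\<And>p. 0 \<le> g p) \<Longrightarrow> x \<in> chart_dom S \<alpha> \<Longrightarrow> 0 < g x \<Longrightarrow>
      0 < integral (coord S \<alpha> ` chart_dom S \<alpha>) (\<lambda>z. g (param S \<alpha> z))"
proof -
  let ?D = "chart_dom S \<alpha>" and ?c = "coord S \<alpha>"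
  let ?V = "?c ` ?D"
  define G where "G z = (if z \<in> ?V then g (param S \<alpha> z) else 0)" for z
  define K where "K = ?c ` closure {p. g p \<noteq> 0}"
  have "compact (UNIV :: 'a set)" using S by (simp add: closed_riemann_surface_def)
  then have "compact (closure {p. g p \<noteq> 0})" using closed_Int_compact[of "closure {p. g p \<noteq> 0}" UNIV] by simp
  then have K: "compact K" unfolding K_def
    by (intro compact_continuous_image continuous_on_subset[OF coord_continuous[OF S] supp])
  have KV: "K \<subseteq> ?V" using supp by (auto simp: K_def)
  have out: "G z = 0" if "z \<notin> K" for z
  proof (cases "z \<in> ?V")
    case True
    have "param S \<alpha> z \<notin> closure {p. g p \<noteq> 0}"
      using that coord_param[OF S True] by (force simp: K_def)
    then show ?thesis using closure_subset[of "{p. g p \<noteq> 0}"] by (auto simp: G_def)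
  qed (simp add: G_def)
  have "continuous_on ?V G"
    by (rule continuous_on_eq[OF cont[unfolded continuous_on_chart_iff[OF S]]]) (simp add: G_def)
  moreover have "continuous_on (- K) G"
    by (rule continuous_on_eq[OF continuous_on_const[of _ 0]]) (simp add: out)
  ultimately have "continuous_on (?V \<union> - K) G"
    using compact_imp_closed[OF K] by (intro continuous_on_open_Un chart_image_open[OF S]) auto
  moreover have "?V \<union> - K = UNIV" using KV by blast
  ultimately have G: "continuous_on UNIV G" by simp
  obtain d where d: "K \<subseteq> box (- d) d" using bounded_subset_box_symmetric[OF compact_imp_bounded[OF K]] by blast
  let ?B = "cbox (- d) d"
  have Gint: "G integrable_on ?B" by (rule integrable_continuous[OF continuous_on_subset[OF G]]) simp
  have "(G has_integral integral ?B G) UNIV"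
  proof (rule has_integral_on_superset[OF integrable_integral[OF Gint]])
    show "G z = 0" if "z \<notin> ?B" for z using that d box_subset_cbox[of "- d" d] by (intro out) blast
  qed simp
  then have has: "((\<lambda>z. g (param S \<alpha> z)) has_integral integral ?B G) ?V"
    unfolding G_def by (simp only: has_integral_restrict_UNIV)
  then show "(\<lambda>z. g (param S \<alpha> z)) integrable_on ?V" by (rule has_integral_integrable)
  assume nonneg: "\<And>p. 0 \<le> g p" and x: "x \<in> ?D" "0 < g x"
  have Gx: "0 < G (?c x)" using x by (simp add: G_def param_coord[OF S x(1)])
  have Gnn: "0 \<le> G z" for z using nonneg by (simp add: G_def)
  have xB: "?c x \<in> box (- d) d" using Gx out d by force
  have "integral ?B G \<noteq> 0"
  proof
    assume "integral ?B G = 0"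
    then have "(G has_integral 0) ?B" using integrable_integral[OF Gint] by simp
    then have "G (?c x) = 0"
      by (rule has_integral_0_cbox_imp_0[OF continuous_on_subset[OF G subset_UNIV] Gnn])
         (use xB box_subset_cbox[of "- d" d] in auto)
    with Gx show False by simp
  qed
  moreover have "0 \<le> integral ?B G" by (rule integral_nonneg[OF Gint]) (rule Gnn)
  ultimately show "0 < integral ?V (\<lambda>z. g (param S \<alpha> z))" using integral_unique[OF has] by simp
qed

text \<open>Both integrals use the same chosen partition of unity, so they can be compared chart by chart. Some
  member of the partition is positive at \<open>x\<close>, and its chart integral is strictly larger by continuity.\<close>

lemma surface_integral_strict_mono:
  fixes S :: "('i, 'a::t2_space) surface"
  assumes S: "closed_riemann_surface S"
    and cont: "\<And>\<alpha>. continuous_on (chart_dom S \<alpha>) (w \<alpha>)" "\<And>\<alpha>. continuous_on (chart_dom S \<alpha>) (w' \<alpha>)"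
    and le: "\<And>\<alpha> p. p \<in> chart_dom S \<alpha> \<Longrightarrow> w \<alpha> p \<le> w' \<alpha> p"
    and less: "\<And>\<alpha>. x \<in> chart_dom S \<alpha> \<Longrightarrow> w \<alpha> x < w' \<alpha> x"
  shows "surface_integral S w < surface_integral S w'"
proof -
  obtain A \<rho> where A\<rho>: "(A, \<rho>) = (SOME (A, \<rho>). partition_of_unity S A \<rho>)" by (metis surj_pair)
  have "case (SOME (A, \<rho>). partition_of_unity S A \<rho>) of (A, \<rho>) \<Rightarrow> partition_of_unity S A \<rho>"
    using someI_ex[of "\<lambda>(A, \<rho>). partition_of_unity S A \<rho>"] partition_of_unity_exists[OF S] by auto
  then have pu: "partition_of_unity S A \<rho>" by (simp add: A\<rho>[symmetric])
  then have A: "finite A" and \<rho>: "\<And>\<alpha>. \<alpha> \<in> A \<Longrightarrow> continuous_on UNIV (\<rho> \<alpha>)" "\<And>\<alpha> p. \<alpha> \<in> A \<Longrightarrow> 0 \<le> \<rho> \<alpha> p"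
    "\<And>\<alpha>. \<alpha> \<in> A \<Longrightarrow> closure {p. \<rho> \<alpha> p \<noteq> 0} \<subseteq> chart_dom S \<alpha>" "(\<Sum>\<alpha>\<in>A. \<rho> \<alpha> x) = 1"
    unfolding partition_of_unity_def by blast+
  let ?V = "\<lambda>\<alpha>. coord S \<alpha> ` chart_dom S \<alpha>"
  have eq: "surface_integral S u = (\<Sum>\<alpha>\<in>A. integral (?V \<alpha>) (\<lambda>z. \<rho> \<alpha> (param S \<alpha> z) * u \<alpha> (param S \<alpha> z)))" for u
    unfolding surface_integral_def A\<rho>[symmetric] Let_def by simp
  have supp: "closure {p. \<rho> \<alpha> p * u p \<noteq> 0} \<subseteq> chart_dom S \<alpha>" if "\<alpha> \<in> A" for \<alpha> and u :: "'a \<Rightarrow> real"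
    by (rule order_trans[OF closure_mono \<rho>(3)[OF that]]) auto
  have \<rho>cont: "continuous_on (chart_dom S \<alpha>) (\<rho> \<alpha>)" if "\<alpha> \<in> A" for \<alpha>
    by (rule continuous_on_subset[OF \<rho>(1)[OF that]]) simp
  define \<delta> where "\<delta> \<alpha> = integral (?V \<alpha>) (\<lambda>z. \<rho> \<alpha> (param S \<alpha> z) * (w' \<alpha> (param S \<alpha> z) - w \<alpha> (param S \<alpha> z)))" for \<alpha>
  have diff: "\<delta> \<alpha> = integral (?V \<alpha>) (\<lambda>z. \<rho> \<alpha> (param S \<alpha> z) * w' \<alpha> (param S \<alpha> z)) -
      integral (?V \<alpha>) (\<lambda>z. \<rho> \<alpha> (param S \<alpha> z) * w \<alpha> (param S \<alpha> z))" if "\<alpha> \<in> A" for \<alpha>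
    unfolding \<delta>_def right_diff_distrib
    by (rule integral_diff)
       (rule chart_integral(1)[OF S continuous_on_mult[OF \<rho>cont[OF that]] supp[OF that]], rule cont)+
  have nonneg: "0 \<le> \<rho> \<alpha> p * (w' \<alpha> p - w \<alpha> p)" if "\<alpha> \<in> A" for \<alpha> p
  proof (cases "p \<in> chart_dom S \<alpha>")
    case True then show ?thesis using \<rho>(2)[OF that] le[OF True] by simp
  next
    case False
    then have "\<rho> \<alpha> p = 0" using \<rho>(3)[OF that] closure_subset[of "{p. \<rho> \<alpha> p \<noteq> 0}"] by blast
    then show ?thesis by simp
  qed
  have \<delta>0: "0 \<le> \<delta> \<alpha>" if "\<alpha> \<in> A" for \<alpha>
    unfolding \<delta>_def
    by (rule integral_nonneg[OF chart_integral(1)[OF S _ supp[OF that]] nonneg[OF that]])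
       (intro continuous_on_mult \<rho>cont that continuous_on_diff cont)
  obtain \<beta> where \<beta>: "\<beta> \<in> A" "\<rho> \<beta> x \<noteq> 0" using \<rho>(4) by (metis sum.neutral zero_neq_one)
  have x\<beta>: "x \<in> chart_dom S \<beta>" using \<rho>(3)[OF \<beta>(1)] \<beta>(2) closure_subset[of "{p. \<rho> \<beta> p \<noteq> 0}"] by blast
  have "0 < \<delta> \<beta>"
    unfolding \<delta>_def
  proof (rule chart_integral(2)[OF S _ supp[OF \<beta>(1)] nonneg[OF \<beta>(1)] x\<beta>])
    show "continuous_on (chart_dom S \<beta>) (\<lambda>p. \<rho> \<beta> p * (w' \<beta> p - w \<beta> p))"
      by (intro continuous_on_mult \<rho>cont \<beta>(1) continuous_on_diff cont)
    have "0 < \<rho> \<beta> x" using \<rho>(2)[OF \<beta>(1), of x] \<beta>(2) by simp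
    then show "0 < \<rho> \<beta> x * (w' \<beta> x - w \<beta> x)" using less[OF x\<beta>] by simp
  qed
  then have "0 < (\<Sum>\<alpha>\<in>A. \<delta> \<alpha>)" using A \<beta>(1) \<delta>0 by (intro sum_pos2) auto
  also have "(\<Sum>\<alpha>\<in>A. \<delta> \<alpha>) = surface_integral S w' - surface_integral S w"
    unfolding eq sum_subtractf[symmetric] by (intro sum.cong refl diff)
  finally show ?thesis by simp
qed

section \<open>Monotonicity of the pullback metric and the Morse function\<close>

theorem theorem1p4:
  fixes S :: "('i, 'a::t2_space) surface"
    and n g :: nat
    and L :: "nat \<Rightarrow> ('i, 'a) cocycle"
    and \<tau> :: "'i \<Rightarrow> 'a \<Rightarrow> complex"
    and \<gamma> :: "nat \<Rightarrow> 'i \<Rightarrow> 'a \<Rightarrow> complex"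
    and \<Phi> H :: "complex \<Rightarrow> ('i, 'a) mat_family"
  defines "\<Phi> \<equiv> \<lambda>t. cyclic_field n (scale_last n t \<gamma>)"
  assumes "3 \<le> n"
    and "closed_riemann_surface S" and "has_genus S g" and "2 \<le> g"
    and "cyclic_higgs_bundle S n L \<tau> \<gamma>"
    and "\<not> zero_section S (\<gamma> (n - 1))"
    and "stable_higgs S n (direct_sum n L) (\<Phi> 0)"
    and "\<And>t. harmonic_metric S n (direct_sum n L) \<tau> (\<Phi> t) (H t)"
  shows "\<forall>t t'. cmod t' < cmod t \<longrightarrow>
           (\<forall>\<alpha>. \<forall>p \<in> chart_dom S \<alpha>. (\<exists>k<n. \<gamma> k \<alpha> p \<noteq> 0) \<longrightarrow>
              pullback_metric n (H t') (\<Phi> t') \<alpha> p < pullback_metric n (H t) (\<Phi> t) \<alpha> p) \<and>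
           morse_function S (H t') (\<Phi> t') < morse_function S (H t) (\<Phi> t)"
proof (intro allI impI)
  fix t t' :: complex assume t: "cmod t' < cmod t"
  note S = \<open>closed_riemann_surface S\<close> and cyc = \<open>cyclic_higgs_bundle S n L \<tau> \<gamma>\<close>
  have n: "0 < n" using \<open>3 \<le> n\<close> by simp
  have \<tau>: "det_trivialization S (direct_sum n L) \<tau>" using cyc unfolding cyclic_higgs_bundle_def by blast
  have sec: "holo_section S (tensor (dual (L k)) (tensor (L (Suc k mod n)) (canonical_bundle S))) (\<gamma> k)" if "k < n" for k
    using cyc that unfolding cyclic_higgs_bundle_def by blast
  have hm: "harmonic_metric S n (direct_sum n L) \<tau> (cyclic_field n (scale_last n u \<gamma>)) (H u)" for u
    using assms(9)[of u] unfolding \<Phi>_def .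
  let ?a = "\<lambda>u. toda_term n (scale_last n u \<gamma>) (H u)"
  have energy: "higgs_energy (H u) (\<Phi> u) \<alpha> p = (\<Sum>k<n. ?a u k \<alpha> p)" if "p \<in> chart_dom S \<alpha>" for u \<alpha> p
    unfolding \<Phi>_def by (rule toda_system(2)[OF S \<tau> hm that])
  note mono = toda_term_strict_mono[OF S n cyc \<open>\<not> zero_section S (\<gamma> (n - 1))\<close> hm hm t]
  have le: "higgs_energy (H t') (\<Phi> t') \<alpha> p \<le> higgs_energy (H t) (\<Phi> t) \<alpha> p" if "p \<in> chart_dom S \<alpha>" for \<alpha> p
    unfolding energy[OF that] by (intro sum_mono mono(1) that) simp
  have less: "higgs_energy (H t') (\<Phi> t') \<alpha> p < higgs_energy (H t) (\<Phi> t) \<alpha> p"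
    if p: "p \<in> chart_dom S \<alpha>" and "k < n" "\<gamma> k \<alpha> p \<noteq> 0" for \<alpha> p k
    unfolding energy[OF p]
    by (rule sum_strict_mono_ex1) (use mono[OF _ p] that in \<open>auto intro!: bexI[of _ k]\<close>)
  have cont: "continuous_on (chart_dom S \<alpha>) (\<lambda>p. 2 * higgs_energy (H u) (\<Phi> u) \<alpha> p)" for u \<alpha>
  proof -
    have "continuous_on (chart_dom S \<alpha>) (scale_last n u \<gamma> k \<alpha>)" if "k < n" for k
      using holo_section_continuous[OF S sec[OF that]]
      by (cases "k = n - 1") (auto simp: scale_last_def intro!: continuous_intros)
    then have "continuous_on (chart_dom S \<alpha>) (\<lambda>p. 2 * (\<Sum>k<n. ?a u k \<alpha> p))"
      by (intro continuous_intros toda_term_continuous[OF S \<tau> hm]) auto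
    then show ?thesis by (rule continuous_on_eq) (simp add: energy)
  qed
  have last: "n - 1 < n" using n by simp
  obtain \<alpha>0 x where x: "x \<in> chart_dom S \<alpha>0" "\<gamma> (n - 1) \<alpha>0 x \<noteq> 0"
    using holo_section_nonzero_dense[OF S sec[OF last] \<open>\<not> zero_section S (\<gamma> (n - 1))\<close> open_UNIV UNIV_not_empty]
    by blast
  have x': "\<gamma> (n - 1) \<beta> x \<noteq> 0" if x\<beta>: "x \<in> chart_dom S \<beta>" for \<beta>
  proof
    assume "\<gamma> (n - 1) \<beta> x = 0"
    moreover have "\<exists>M. \<gamma> (n - 1) \<alpha>0 x = M * \<gamma> (n - 1) \<beta> x"
      using sec[OF last] x(1) x\<beta> unfolding holo_section_def by blast
    ultimately show False using x(2) by auto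
  qed
  have "morse_function S (H t') (\<Phi> t') < morse_function S (H t) (\<Phi> t)"
    unfolding morse_function_def
    by (rule surface_integral_strict_mono[OF S cont cont, where x = x])
       (use le less[OF _ _ x'] n in auto)
  then show "(\<forall>\<alpha>. \<forall>p \<in> chart_dom S \<alpha>. (\<exists>k<n. \<gamma> k \<alpha> p \<noteq> 0) \<longrightarrow>
              pullback_metric n (H t') (\<Phi> t') \<alpha> p < pullback_metric n (H t) (\<Phi> t) \<alpha> p) \<and>
           morse_function S (H t') (\<Phi> t') < morse_function S (H t) (\<Phi> t)"
    using less n unfolding pullback_metric_def by auto
qed

end
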